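(* There exists a finitely generated torsion free group that is not unitarizable and contains no non-abelian free subgroup.
   Context: Groups are discrete. For a Hilbert space $H$, let $B(H)$ denote the algebra of bounded linear operators on $H$. A representation $\pi\colon G\to B(H)$ of a group $G$ (i.e., a homomorphism from $G$ to the group of invertible elements of $B(H)$) is uniformly bounded if $\sup_{g\in G}\|\pi(g)\|<\infty$. It is unitarizable if there exists an invertible operator $S\colon H\to H$ such that $g\mapsto S^{-1}\pi(g)S$ is a unitary representation of $G$. A group $G$ is unitarizable if every uniformly bounded representation $\pi\colon G\to B(H)$ on a Hilbert space $H$ is unitarizable. A group is torsion free if it has no non-trivial elements of finite order. *)

theory Defs
  imports Complex_Main "HOL-Algebra.Module" "HOL-Algebra.Generated_Groups"
begin

section \<open>Complex Hilbert spaces\<close>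

definition complex_field :: "complex ring" where
  "complex_field = \<lparr>carrier = UNIV, mult = (*), one = 1, zero = 0, add = (+)\<rparr>"

text \<open>
  Hilbert spaces have explicit carriers, so that they can be quantified over inside a formula.
  The fields \<open>mult\<close> and \<open>one\<close> inherited from the library's module record play no role.
\<close>

record 'h inner_space = "(complex, 'h) module" +
  inner_prod :: "'h \<Rightarrow> 'h \<Rightarrow> complex"

definition hnorm :: "('h, 'm) inner_space_scheme \<Rightarrow> 'h \<Rightarrow> real" where
  "hnorm H x = sqrt (Re (inner_prod H x x))"

locale hilbert_space = module complex_field H
  for H :: "('h, 'm) inner_space_scheme" (structure) +
  assumes inner_add_left:
      "\<lbrakk>x \<in> carrier H; y \<in> carrier H; z \<in> carrier H\<rbrakk> \<Longrightarrow>
        inner_prod H (x \<oplus> y) z = inner_prod H x z + inner_prod H y z"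
    and inner_smult_left:
      "\<lbrakk>x \<in> carrier H; y \<in> carrier H\<rbrakk> \<Longrightarrow>
        inner_prod H (a \<odot> x) y = a * inner_prod H x y"
    and inner_commute:
      "\<lbrakk>x \<in> carrier H; y \<in> carrier H\<rbrakk> \<Longrightarrow>
        inner_prod H y x = cnj (inner_prod H x y)"
    and inner_pos:
      "\<lbrakk>x \<in> carrier H; x \<noteq> \<zero>\<rbrakk> \<Longrightarrow> 0 < Re (inner_prod H x x)"
    and complete:
      "\<lbrakk>\<And>n :: nat. X n \<in> carrier H;
        \<And>e. 0 < e \<Longrightarrow> \<exists>N. \<forall>m\<ge>N. \<forall>n\<ge>N. hnorm H (X m \<ominus> X n) < e\<rbrakk> \<Longrightarrow>
        \<exists>l\<in>carrier H. (\<lambda>n. hnorm H (X n \<ominus> l)) \<longlonglongrightarrow> 0"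


section \<open>Bounded operators\<close>

definition bounded_operators ::
    "('h, 'm) inner_space_scheme \<Rightarrow> ('h \<Rightarrow> 'h) set" where
  "bounded_operators H =
    {T \<in> carrier H \<rightarrow>\<^sub>E carrier H.
      (\<forall>x\<in>carrier H. \<forall>y\<in>carrier H. T (x \<oplus>\<^bsub>H\<^esub> y) = T x \<oplus>\<^bsub>H\<^esub> T y) \<and>
      (\<forall>a. \<forall>x\<in>carrier H. T (a \<odot>\<^bsub>H\<^esub> x) = a \<odot>\<^bsub>H\<^esub> T x) \<and>
      (\<exists>C. \<forall>x\<in>carrier H. hnorm H (T x) \<le> C * hnorm H x)}"

definition op_norm :: "('h, 'm) inner_space_scheme \<Rightarrow> ('h \<Rightarrow> 'h) \<Rightarrow> real" where
  "op_norm H T = (SUP x\<in>{x \<in> carrier H. hnorm H x \<le> 1}. hnorm H (T x))"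

text \<open>The multiplicative monoid of \<open>B(H)\<close>; \<open>units_of (op_monoid H)\<close> is its group of
  invertible elements.\<close>

definition op_monoid :: "('h, 'm) inner_space_scheme \<Rightarrow> ('h \<Rightarrow> 'h) monoid" where
  "op_monoid H =
    \<lparr>carrier = bounded_operators H, mult = compose (carrier H), one = (\<lambda>x\<in>carrier H. x)\<rparr>"

definition unitary_operators ::
    "('h, 'm) inner_space_scheme \<Rightarrow> ('h \<Rightarrow> 'h) set" where
  "unitary_operators H =
    {U \<in> Units (op_monoid H).
      \<forall>x\<in>carrier H. \<forall>y\<in>carrier H. inner_prod H (U x) (U y) = inner_prod H x y}"


section \<open>Representations and unitarizability\<close>

definition representation ::
    "('g, 'a) monoid_scheme \<Rightarrow> ('h, 'm) inner_space_scheme \<Rightarrow> ('g \<Rightarrow> 'h \<Rightarrow> 'h) \<Rightarrow> bool" where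
  "representation G H \<pi> \<longleftrightarrow> \<pi> \<in> hom G (units_of (op_monoid H))"

definition uniformly_bounded ::
    "('g, 'a) monoid_scheme \<Rightarrow> ('h, 'm) inner_space_scheme \<Rightarrow> ('g \<Rightarrow> 'h \<Rightarrow> 'h) \<Rightarrow> bool" where
  "uniformly_bounded G H \<pi> \<longleftrightarrow> bdd_above ((\<lambda>g. op_norm H (\<pi> g)) ` carrier G)"

definition unitary_representation ::
    "('g, 'a) monoid_scheme \<Rightarrow> ('h, 'm) inner_space_scheme \<Rightarrow> ('g \<Rightarrow> 'h \<Rightarrow> 'h) \<Rightarrow> bool" where
  "unitary_representation G H \<pi> \<longleftrightarrow>
    representation G H \<pi> \<and> (\<forall>g\<in>carrier G. \<pi> g \<in> unitary_operators H)"

definition unitarizable_representation ::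
    "('g, 'a) monoid_scheme \<Rightarrow> ('h, 'm) inner_space_scheme \<Rightarrow> ('g \<Rightarrow> 'h \<Rightarrow> 'h) \<Rightarrow> bool" where
  "unitarizable_representation G H \<pi> \<longleftrightarrow>
    (\<exists>S \<in> Units (op_monoid H).
      unitary_representation G H
        (\<lambda>g. inv\<^bsub>op_monoid H\<^esub> S \<otimes>\<^bsub>op_monoid H\<^esub> \<pi> g \<otimes>\<^bsub>op_monoid H\<^esub> S))"

text \<open>
  HOL cannot quantify over types inside a formula, so the type in which the carriers of the
  Hilbert spaces live is a parameter. Failure of \<open>unitarizable TYPE('h) G\<close> for any one type
  \<open>'h\<close> means that \<open>G\<close> is not unitarizable. Every separable Hilbert space has a
  copy with carrier in \<open>nat \<Rightarrow> complex\<close> (for instance the square-summable sequences).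
\<close>

definition unitarizable :: "'h itself \<Rightarrow> ('g, 'a) monoid_scheme \<Rightarrow> bool" where
  "unitarizable _ G \<longleftrightarrow>
    (\<forall>(H :: 'h inner_space) \<pi>. hilbert_space H \<longrightarrow>
      representation G H \<pi> \<longrightarrow> uniformly_bounded G H \<pi> \<longrightarrow>
      unitarizable_representation G H \<pi>)"


section \<open>Group-theoretic notions\<close>

definition finitely_generated :: "('g, 'a) monoid_scheme \<Rightarrow> bool" where
  "finitely_generated G \<longleftrightarrow> (\<exists>X \<subseteq> carrier G. finite X \<and> generate G X = carrier G)"

definition torsion_free :: "('g, 'a) monoid_scheme \<Rightarrow> bool" where
  "torsion_free G \<longleftrightarrow>
    (\<forall>x\<in>carrier G. \<forall>n::nat. 0 < n \<longrightarrow> x [^]\<^bsub>G\<^esub> n = \<one>\<^bsub>G\<^esub> \<longrightarrow> x = \<one>\<^bsub>G\<^esub>)"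

text \<open>Words in group elements and their formal inverses: \<open>(x, True)\<close> stands for \<open>x\<close>
  and \<open>(x, False)\<close> for its inverse.\<close>

definition letter_value :: "('g, 'a) monoid_scheme \<Rightarrow> 'g \<times> bool \<Rightarrow> 'g" where
  "letter_value G l = (if snd l then fst l else inv\<^bsub>G\<^esub> (fst l))"

definition word_value :: "('g, 'a) monoid_scheme \<Rightarrow> ('g \<times> bool) list \<Rightarrow> 'g" where
  "word_value G w = foldr (\<lambda>l g. letter_value G l \<otimes>\<^bsub>G\<^esub> g) w \<one>\<^bsub>G\<^esub>"

definition reduced_word :: "('g \<times> bool) list \<Rightarrow> bool" where
  "reduced_word w \<longleftrightarrow> successively (\<lambda>k l. fst k = fst l \<longrightarrow> snd k = snd l) w"

definition free_basis :: "('g, 'a) monoid_scheme \<Rightarrow> 'g set \<Rightarrow> bool" where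
  "free_basis G X \<longleftrightarrow>
    X \<subseteq> carrier G \<and> generate G X = carrier G \<and>
    (\<forall>w. w \<noteq> [] \<longrightarrow> set w \<subseteq> X \<times> UNIV \<longrightarrow> reduced_word w \<longrightarrow> word_value G w \<noteq> \<one>\<^bsub>G\<^esub>)"

definition free_group :: "('g, 'a) monoid_scheme \<Rightarrow> bool" where
  "free_group G \<longleftrightarrow> group G \<and> (\<exists>X. free_basis G X)"

definition has_nonabelian_free_subgroup :: "('g, 'a) monoid_scheme \<Rightarrow> bool" where
  "has_nonabelian_free_subgroup G \<longleftrightarrow>
    (\<exists>K. subgroup K G \<and> free_group (G\<lparr>carrier := K\<rparr>) \<and> \<not> comm_group (G\<lparr>carrier := K\<rparr>))"

end

theory Submission
  imports Defs "HOL-Analysis.Analysis" "HOL-Library.Z2" "HOL-Library.Function_Algebras"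
begin

text \<open>
  Let \<open>Q\<close> be the largest residually finite group on two generators in which every word \<open>w\<close> satisfies
  \<open>w\<^sup>K = 1\<close>, \<open>K = 2\<^sup>k\<^sup>+\<^sup>2\<close> if \<open>w\<close> is the \<open>k\<close>-th word. As in Schlage-Puchta's construction the sum of
  the \<open>1 / K\<close> is small enough to leave the subgroups \<open>M\<close> of finite index \<open>n\<close> with at least about
  \<open>n / 2\<close> independent homomorphisms to the field with two elements.

  Let \<open>N\<close> be normal of finite index, with Schreier generators \<open>S\<close>, and \<open>M\<close> a small normal subgroup
  inside it. Linear algebra selects many edges of the Cayley graph of \<open>N / M\<close> whose lifts to \<open>N\<close> are
  sparse on every finite set that embeds into \<open>N / M\<close>, hence can be oriented with bounded out-degree.
  Averaging over \<open>N / M\<close> and letting \<open>M\<close> shrink gives \<open>f\<close> on \<open>S\<close> and nonnegative kernels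
  \<open>a + b = f (x\<^sup>-\<^sup>1 y)\<close> where the rows of \<open>a\<close> and the columns of \<open>b\<close> have sum at most \<open>2\<close>, while the
  squared \<open>\<ell>\<^sup>2\<close> norm of \<open>f\<close> grows linearly with the index of \<open>N\<close>.

  Such a Littlewood decomposition yields a bounded derivation \<open>g a - a g\<close> on \<open>\<ell>\<^sup>2(Q)\<close>, thus a uniformly
  bounded representation on a sum of two copies. If the sum of these representations over a sequence
  of \<open>f\<close> is unitarizable, the orthogonal projection for the invariant inner product differs from \<open>a\<close>
  by a convolution kernel, and comparing a row and a column bounds the norm of \<open>f\<close>.

  Finally \<open>Q\<close> is replaced by the Magnus extension of \<open>Q\<close> by a free abelian group (for \<open>Q = F / R\<close> this is
  \<open>F / [R, R]\<close>): it is torsion free, it maps onto \<open>Q\<close>, and any two elements have commuting positive powers.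
\<close>

section \<open>The torsion group\<close>

text \<open>The model is a free group. Orient its Cayley tree towards the root: every vertex has at
  most one outgoing edge, so the indicator of the free generators is such a function
  \<open>f\<close>. A subgroup of index \<open>n\<close> has about \<open>n\<close> free generators
  (Schreier), and the norm grows. Without free subgroups there is no tree, but sparseness is enough:
  a set of edges on which arbitrary values modulo 2 are differences of potentials has at least as
  many vertices as edges. Growth of the first cohomology modulo 2 thus replaces freeness, and
  averages replace indicators.

  The coefficients have characteristic 2 and the exponents are powers of 2 so that a relator costs
  nothing where its root has smaller order: a closed walk run twice sums to 0. Otherwise its
  conjugates impose at most \<open>n / K\<close> conditions. Residual finiteness enters because all
  counting takes place in finite quotients, which must see every finite piece of the group.

  A single \<open>f\<close> only yields an estimate that depends on the similarity; hence a
  sequence. A torsion group suffices at that stage because representations pull back from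
  quotients.\<close>

definition wpow :: "bool list \<Rightarrow> nat \<Rightarrow> bool list" where
  "wpow w k = concat (replicate k w)"

text \<open>
  The constant \<open>2\<close> makes the sum of all \<open>1 / expo w\<close> at most \<open>1 / 2\<close>.
\<close>

definition expo :: "bool list \<Rightarrow> nat" where
  "expo w = 2 ^ (to_nat w + 2)"

lemma wpow_0 [simp]: "wpow w 0 = []"
  by (simp add: wpow_def)

lemma wpow_Suc: "wpow w (Suc k) = w @ wpow w k"
  by (simp add: wpow_def)

lemma wpow_add: "wpow w (j + k) = wpow w j @ wpow w k"
  by (simp add: wpow_def replicate_add)

lemma wpow_Suc': "wpow w (Suc k) = wpow w k @ w"
  using wpow_add [of w k 1] by (simp add: wpow_Suc)

lemma expo_pos [simp]: "0 < expo w"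
  by (simp add: expo_def)

text \<open>
  Positive words suffice, since \<open>wpow w (expo w - 1)\<close> is an inverse of \<open>w\<close>.
\<close>

definition relcong :: "(bool list \<Rightarrow> bool list \<Rightarrow> bool) \<Rightarrow> bool" where
  "relcong \<theta> \<longleftrightarrow> equivp \<theta> \<and> (\<forall>x x' y y'. \<theta> x x' \<longrightarrow> \<theta> y y' \<longrightarrow> \<theta> (x @ y) (x' @ y')) \<and>
    finite (range \<theta>) \<and> (\<forall>w. \<theta> (wpow w (expo w)) [])"

text \<open>Intersecting all congruences of finite index that satisfy the relations makes the
  quotient residually finite by construction, and maximal: a function of words factors through it as
  soon as one such congruence determines the function.\<close>

definition word_eq :: "bool list \<Rightarrow> bool list \<Rightarrow> bool" where
  "word_eq x y \<longleftrightarrow> (\<forall>\<theta>. relcong \<theta> \<longrightarrow> \<theta> x y)"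

lemma equivp_word_eq: "equivp word_eq"
proof (rule equivpI)
  have *: "equivp \<theta>" if "relcong \<theta>" for \<theta>
    using that by (simp add: relcong_def)
  show "reflp word_eq"
    unfolding reflp_def word_eq_def using * by (blast intro: equivp_reflp)
  show "symp word_eq"
    unfolding symp_def word_eq_def by (metis * equivp_symp)
  show "transp word_eq"
    unfolding transp_def word_eq_def by (metis * equivp_transp)
qed

quotient_type tgrp = "bool list" / word_eq
  by (rule equivp_word_eq)

lemma word_eq_append:
  "word_eq x x' \<Longrightarrow> word_eq y y' \<Longrightarrow> word_eq (x @ y) (x' @ y')"
  unfolding word_eq_def
proof (intro allI impI)
  fix \<theta>
  assume "\<forall>\<theta>. relcong \<theta> \<longrightarrow> \<theta> x x'" "\<forall>\<theta>. relcong \<theta> \<longrightarrow> \<theta> y y'" "relcong \<theta>"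
  moreover have "\<theta> x x' \<Longrightarrow> \<theta> y y' \<Longrightarrow> \<theta> (x @ y) (x' @ y')"
    using \<open>relcong \<theta>\<close> unfolding relcong_def by blast
  ultimately show "\<theta> (x @ y) (x' @ y')"
    by blast
qed

definition ev :: "bool list \<Rightarrow> tgrp" where
  "ev = abs_tgrp"

lemma ev_eq_iff: "ev x = ev y \<longleftrightarrow> word_eq x y"
  by (simp add: ev_def tgrp.abs_eq_iff)

lemma ev_rep [simp]: "ev (rep_tgrp x) = x"
  by (metis ev_def Quotient_tgrp Quotient_abs_rep)

instantiation tgrp :: group_add
begin

lift_definition plus_tgrp :: "tgrp \<Rightarrow> tgrp \<Rightarrow> tgrp" is append
  by (rule word_eq_append)

definition zero_tgrp :: tgrp where
  "zero_tgrp = ev []"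

definition uminus_tgrp :: "tgrp \<Rightarrow> tgrp" where
  "uminus_tgrp x = ev (wpow (rep_tgrp x) (expo (rep_tgrp x) - 1))"

definition minus_tgrp :: "tgrp \<Rightarrow> tgrp \<Rightarrow> tgrp" where
  "minus_tgrp x y = x + - y"

lemma ev_append': "ev (x @ y) = ev x + ev y"
  by (simp add: ev_def plus_tgrp.abs_eq)

lemma ev_wpow_expo: "ev (wpow w (expo w)) = ev []"
  by (simp add: ev_eq_iff word_eq_def relcong_def)

instance
proof
  fix a b c :: tgrp
  show "a + b + c = a + (b + c)"
    by (metis append_assoc ev_append' ev_rep)
  show "0 + a = a"
    by (metis append_Nil ev_append' ev_rep zero_tgrp_def)
  show "a + 0 = a"
    by (metis append_Nil2 ev_append' ev_rep zero_tgrp_def)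
  have "wpow (rep_tgrp a) (expo (rep_tgrp a)) =
      wpow (rep_tgrp a) (expo (rep_tgrp a) - 1) @ rep_tgrp a"
    using wpow_Suc' [of "rep_tgrp a" "expo (rep_tgrp a) - 1"] by simp
  then show "- a + a = 0"
    by (metis ev_append' ev_rep ev_wpow_expo uminus_tgrp_def zero_tgrp_def)
  show "a + - b = a - b"
    by (simp add: minus_tgrp_def)
qed

end

instance tgrp :: countable
  by (rule countable_classI [of "\<lambda>x. to_nat (rep_tgrp x)"]) (metis ev_rep from_nat_to_nat)

lemma ev_Nil [simp]: "ev [] = 0"
  by (simp add: zero_tgrp_def)

lemma ev_append [simp]: "ev (x @ y) = ev x + ev y"
  by (rule ev_append')

definition gen :: "bool \<Rightarrow> tgrp" where
  "gen a = ev [a]"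

lemma ev_Cons: "ev (a # w) = gen a + ev w"
  using ev_append [of "[a]" w] by (simp add: gen_def)

lemma tgrp_induct [case_names zero gen]:
  assumes "P 0" "\<And>x a. P x \<Longrightarrow> P (x + gen a)"
  shows "P x"
proof -
  have "P (ev w)" for w
    by (induction w rule: rev_induct) (use assms in \<open>auto simp: gen_def\<close>)
  then show ?thesis
    by (metis ev_rep)
qed

lemma finite_range_factor:
  assumes "finite (range f)" "\<And>x y. f x = f y \<Longrightarrow> g x = g y"
  shows "finite (range g)"
proof -
  have "g x = g (SOME y. f y = f x)" for x
    by (rule assms(2)) (metis (mono_tags, lifting) someI)
  then have "range g \<subseteq> (\<lambda>u. g (SOME y. f y = u)) ` range f"
    by blast
  then show ?thesis
    using assms(1) by (meson finite_imageI finite_subset)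
qed

section \<open>Normal subgroups of finite index\<close>

definition coset :: "'g::group_add set \<Rightarrow> 'g \<Rightarrow> 'g set" where
  "coset M x = {y. - x + y \<in> M}"

definition fin_normal :: "'g::group_add set \<Rightarrow> bool" where
  "fin_normal M \<longleftrightarrow> 0 \<in> M \<and> (\<forall>x\<in>M. \<forall>y\<in>M. x + y \<in> M) \<and> (\<forall>x\<in>M. - x \<in> M) \<and>
    (\<forall>x\<in>M. \<forall>g. g + x - g \<in> M) \<and> finite (range (coset M))"

lemma fin_normalD:
  assumes "fin_normal M"
  shows "0 \<in> M" "x \<in> M \<Longrightarrow> y \<in> M \<Longrightarrow> x + y \<in> M" "x \<in> M \<Longrightarrow> - x \<in> M"
    "x \<in> M \<Longrightarrow> g + x - g \<in> M" "finite (range (coset M))"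
  using assms by (auto simp: fin_normal_def)

lemma fin_normal_conj':
  assumes "fin_normal M" "x \<in> M"
  shows "- g + x + g \<in> M"
  using fin_normalD(4)[OF assms, of "- g"] by (simp add: add.assoc)

lemma fin_normal_diff_comm:
  assumes "fin_normal M"
  shows "- x + y \<in> M \<longleftrightarrow> y - x \<in> M"
  using fin_normalD(4)[OF assms, of "- x + y" x] fin_normal_conj'[OF assms, of "y - x" x]
  by (auto simp: add.assoc algebra_simps)

lemma coset_eq_iff:
  assumes "fin_normal M"
  shows "coset M x = coset M y \<longleftrightarrow> - x + y \<in> M"
proof
  assume "coset M x = coset M y"
  moreover have "y \<in> coset M y"
    using fin_normalD(1)[OF assms] by (simp add: coset_def)
  ultimately have "y \<in> coset M x"
    by simp
  then show "- x + y \<in> M"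
    by (simp add: coset_def)
next
  assume *: "- x + y \<in> M"
  have "- x + z \<in> M \<longleftrightarrow> - y + z \<in> M" for z
  proof
    assume "- x + z \<in> M"
    then have "- (- x + y) + (- x + z) \<in> M"
      using * fin_normalD(2,3)[OF assms] by blast
    then show "- y + z \<in> M"
      by (simp add: minus_add add.assoc)
  next
    assume "- y + z \<in> M"
    then have "(- x + y) + (- y + z) \<in> M"
      using * fin_normalD(2,3)[OF assms] by blast
    then show "- x + z \<in> M"
      by (simp add: add.assoc)
  qed
  then show "coset M x = coset M y"
    by (simp add: coset_def)
qed

lemma coset_add_left:
  assumes "fin_normal M"
  shows "coset M (z + x) = coset M (z + y) \<longleftrightarrow> coset M x = coset M y"
  by (simp add: coset_eq_iff[OF assms] minus_add add.assoc del: add_uminus_conv_diff)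

lemma coset_add_right:
  assumes "fin_normal M"
  shows "coset M (x + z) = coset M (y + z) \<longleftrightarrow> coset M x = coset M y"
proof -
  have "coset M (x + z) = coset M (y + z) \<longleftrightarrow> y + z - (x + z) \<in> M"
    by (simp add: coset_eq_iff[OF assms] fin_normal_diff_comm[OF assms])
  also have "y + z - (x + z) = y - x"
    by (metis add_diff_cancel diff_diff_add diff_add_eq_diff_diff_swap)
  finally show ?thesis
    by (simp add: coset_eq_iff[OF assms] fin_normal_diff_comm[OF assms])
qed

lemma fin_normal_Int:
  assumes "fin_normal M" "fin_normal N"
  shows "fin_normal (M \<inter> N)"
proof -
  have "finite (range (\<lambda>x. (coset M x, coset N x)))"
    by (rule finite_subset[of _ "range (coset M) \<times> range (coset N)"])
      (auto intro: fin_normalD(5)[OF assms(1)] fin_normalD(5)[OF assms(2)])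
  then have "finite (range (coset (M \<inter> N)))"
  proof (rule finite_range_factor)
    fix x y
    assume "(coset M x, coset N x) = (coset M y, coset N y)"
    then have "coset M x = coset M y" "coset N x = coset N y"
      by auto
    moreover have "coset (M \<inter> N) x = coset M x \<inter> coset N x" for x
      by (auto simp: coset_def)
    ultimately show "coset (M \<inter> N) x = coset (M \<inter> N) y"
      by simp
  qed
  then show ?thesis
    using assms by (auto simp: fin_normal_def)
qed

lemma fin_normal_UNIV: "fin_normal (UNIV :: 'g::group_add set)"
  by (auto simp: fin_normal_def coset_def)

text \<open>\<open>\<theta>\<close> contains \<open>word_eq\<close>, so it descends to the torsion
  group, and the set is the kernel of the resulting finite quotient. Its cosets are counted by the
  congruence classes of representatives.\<close>

lemma fin_normal_of_relcong:
  assumes "relcong \<theta>"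
  shows "fin_normal {x. \<theta> (rep_tgrp x) []}" (is "fin_normal ?M")
proof -
  note eq = assms[unfolded relcong_def, THEN conjunct1]
  have th_ev: "\<theta> v w" if "ev v = ev w" for v w
    using that assms unfolding ev_eq_iff word_eq_def by blast
  have app: "\<theta> x x' \<Longrightarrow> \<theta> y y' \<Longrightarrow> \<theta> (x @ y) (x' @ y')" for x x' y y'
    using assms unfolding relcong_def by blast
  have refl: "\<theta> x x" for x
    using eq by (rule equivp_reflp)
  have tr: "\<theta> x y \<Longrightarrow> \<theta> y z \<Longrightarrow> \<theta> x z" for x y z
    using eq by (rule equivp_transp)
  have sy: "\<theta> x y \<Longrightarrow> \<theta> y x" for x y
    using eq by (rule equivp_symp)
  have in_iff: "ev w \<in> ?M \<longleftrightarrow> \<theta> w []" for w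
    using th_ev[of "rep_tgrp (ev w)" w] by (metis ev_rep mem_Collect_eq sy tr)
  have zero: "0 \<in> ?M"
    using in_iff[of "[]"] refl by simp
  have add: "x + y \<in> ?M" if "x \<in> ?M" "y \<in> ?M" for x y
  proof -
    have "\<theta> (rep_tgrp x @ rep_tgrp y) ([] @ [])"
      using that by (intro app) auto
    then show ?thesis
      using in_iff[of "rep_tgrp x @ rep_tgrp y"] by simp
  qed
  have ev0: "\<theta> w []" if "ev w = 0" for w
    using that th_ev[of w "[]"] by simp
  \<comment> \<open>Conjugation without inverse words: the middle factor may be erased, and what
    remains represents 0.\<close>
  have sandwich: "x + y + z \<in> ?M" if "y \<in> ?M" "x + z = 0" for x y z
  proof -
    have "\<theta> ((rep_tgrp x @ rep_tgrp y) @ rep_tgrp z) ((rep_tgrp x @ []) @ rep_tgrp z)"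
      using that by (intro app refl) auto
    moreover have "\<theta> ((rep_tgrp x @ []) @ rep_tgrp z) []"
      using that by (intro ev0) auto
    ultimately show ?thesis
      using in_iff[of "(rep_tgrp x @ rep_tgrp y) @ rep_tgrp z"] tr by (metis ev_append ev_rep)
  qed
  have minus: "- x \<in> ?M" if "x \<in> ?M" for x
  proof -
    have "\<theta> (rep_tgrp (- x) @ rep_tgrp x) (rep_tgrp (- x) @ [])"
      using that by (intro app refl) auto
    moreover have "\<theta> (rep_tgrp (- x) @ rep_tgrp x) []"
      by (intro ev0) auto
    ultimately have "\<theta> (rep_tgrp (- x)) []"
      by (metis append_Nil2 sy tr)
    then show ?thesis
      by simp
  qed
  have "finite (range (\<lambda>x. \<theta> (rep_tgrp x)))"
    by (rule finite_subset[of _ "range \<theta>"]) (use assms in \<open>auto simp: relcong_def\<close>)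
  then have "finite (range (coset ?M))"
  proof (rule finite_range_factor)
    fix x y
    assume *: "\<theta> (rep_tgrp x) = \<theta> (rep_tgrp y)"
    have mem_iff: "- x + z \<in> ?M \<longleftrightarrow> \<theta> (rep_tgrp x) (rep_tgrp z)" for x z
    proof
      assume a: "- x + z \<in> ?M"
      have "\<theta> (rep_tgrp x @ rep_tgrp (- x + z)) (rep_tgrp x @ [])"
        using a by (intro app refl) auto
      moreover have "\<theta> (rep_tgrp x @ rep_tgrp (- x + z)) (rep_tgrp z)"
        by (intro th_ev) (simp add: add.assoc[symmetric])
      ultimately show "\<theta> (rep_tgrp x) (rep_tgrp z)"
        by (metis append_Nil2 sy tr)
    next
      assume a: "\<theta> (rep_tgrp x) (rep_tgrp z)"
      have "\<theta> (rep_tgrp (- x) @ rep_tgrp z) (rep_tgrp (- x) @ rep_tgrp x)"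
        using a sy by (intro app refl) auto
      moreover have "\<theta> (rep_tgrp (- x) @ rep_tgrp x) []"
        by (intro ev0) auto
      ultimately show "- x + z \<in> ?M"
        using in_iff[of "rep_tgrp (- x) @ rep_tgrp z"] tr by (metis ev_append ev_rep)
    qed
    show "coset ?M x = coset ?M y"
      unfolding coset_def mem_iff * ..
  qed
  moreover have "g + x - g \<in> ?M" if "x \<in> ?M" for x g
    using sandwich[OF that, of g "- g"] by (simp del: mem_Collect_eq)
  ultimately show ?thesis
    unfolding fin_normal_def using zero add minus by blast
qed

lemma tgrp_residually_finite:
  fixes x :: tgrp
  assumes "x \<noteq> 0"
  obtains M where "fin_normal M" "x \<notin> M"
proof -
  have "\<not> word_eq (rep_tgrp x) []"
    using assms by (metis ev_Nil ev_eq_iff ev_rep)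
  then obtain \<theta> where "relcong \<theta>" "\<not> \<theta> (rep_tgrp x) []"
    by (auto simp: word_eq_def)
  then show ?thesis
    using that[OF fin_normal_of_relcong[of \<theta>]] by simp
qed

lemma tgrp_separate:
  fixes E :: "tgrp set"
  assumes "finite E" "0 \<notin> E" "fin_normal N"
  shows "\<exists>M. fin_normal M \<and> M \<subseteq> N \<and> M \<inter> E = {}"
  using assms
proof (induction E)
  case empty
  then show ?case by auto
next
  case (insert x E)
  then obtain M where M: "fin_normal M" "M \<subseteq> N" "M \<inter> E = {}"
    by auto
  obtain M' where M': "fin_normal M'" "x \<notin> M'"
    using insert.prems tgrp_residually_finite[of x] by auto
  show ?case
    by (rule exI[of _ "M \<inter> M'"]) (use M M' fin_normal_Int in auto)
qed

lemma tgrp_torsion: "ev (wpow w (expo w)) = 0"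
  using ev_wpow_expo by simp

section \<open>Derivations with values in the field with two elements\<close>

declare add_bit_eq_xor [simp del] mult_bit_eq_and [simp del] minus_bit_def [simp del]
  uminus_bit_def [simp del]

lemma bit_add_self [simp]: "x + x = (0::bit)"
  by (cases x) auto

lemma UNIV_bit: "UNIV = {0, 1 :: bit}"
proof -
  have "x = 0 \<or> x = 1" for x :: bit
    by (cases x) auto
  then show ?thesis
    by blast
qed

instance bit :: finite
  by standard (simp add: UNIV_bit)

primrec walk :: "(tgrp \<Rightarrow> bool \<Rightarrow> bit) \<Rightarrow> tgrp \<Rightarrow> bool list \<Rightarrow> bit" where
  "walk c x [] = 0"
| "walk c x (a # w) = c x a + walk c (x + gen a) w"

lemma walk_append: "walk c x (v @ w) = walk c x v + walk c (x + ev v) w"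
  by (induction v arbitrary: x) (simp_all add: ev_Cons add.assoc)

lemma walk_plus: "walk (c + d) x w = walk c x w + walk d x w"
  by (induction w arbitrary: x) (simp_all add: algebra_simps)

text \<open>
  Labels on the edges of the Cayley graph of the quotient by \<open>M\<close> describe the derivations of the
  free group with values in the functions on the quotient. The valid ones factor through the torsion
  group, where they have a potential.
\<close>

definition labels :: "tgrp set \<Rightarrow> (tgrp \<Rightarrow> bool \<Rightarrow> bit) set" where
  "labels M = {c. \<forall>x y. coset M x = coset M y \<longrightarrow> c x = c y}"

lemma walk_coset:
  assumes "fin_normal M" "c \<in> labels M" "coset M x = coset M y"
  shows "walk c x w = walk c y w"
  using assms(3)
proof (induction w arbitrary: x y)
  case Nil
  then show ?case by simp
next
  case (Cons a w)
  have "c x = c y"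
    using assms(2) Cons.prems unfolding labels_def by blast
  moreover have "coset M (x + gen a) = coset M (y + gen a)"
    using Cons.prems coset_add_right[OF assms(1)] by blast
  then have "walk c (x + gen a) w = walk c (y + gen a) w"
    by (rule Cons.IH)
  ultimately show ?case
    by simp
qed

definition valid :: "tgrp set \<Rightarrow> (tgrp \<Rightarrow> bool \<Rightarrow> bit) set" where
  "valid M = {c \<in> labels M. \<forall>w x. walk c x (wpow w (expo w)) = 0}"

text \<open>Maximality of the torsion group is used here: it suffices that "same coset and same sums
  from every starting point" is an admissible congruence. It has finite index because a sum depends
  on the start only through its coset, so finitely many bits describe a word; validity makes the
  relators trivial.\<close>

lemma walk_word_eq:
  assumes M: "fin_normal M" and c: "c \<in> valid M" and vw: "ev v = ev w"
  shows "walk c x v = walk c x w"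
proof -
  have lab: "c \<in> labels M"
    using c by (simp add: valid_def)
  define \<theta> where "\<theta> v w \<longleftrightarrow> coset M (ev v) = coset M (ev w) \<and> (\<forall>x. walk c x v = walk c x w)"
    for v w
  have "equivp \<theta>"
    by (rule equivpI) (auto simp: \<theta>_def reflp_def symp_def transp_def)
  moreover have "\<theta> (v @ w) (v' @ w')" if "\<theta> v v'" "\<theta> w w'" for v w v' w'
  proof -
    have "coset M (ev v + ev w) = coset M (ev v' + ev w')"
      using that coset_add_left[OF M] coset_add_right[OF M] unfolding \<theta>_def by metis
    moreover have "walk c (x + ev v) w = walk c (x + ev v') w'" for x
    proof -
      have "coset M (x + ev v) = coset M (x + ev v')"
        using that coset_add_left[OF M] unfolding \<theta>_def by blast
      then have "walk c (x + ev v) w = walk c (x + ev v') w"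
        by (rule walk_coset[OF M lab])
      then show ?thesis
        using that unfolding \<theta>_def by simp
    qed
    ultimately show ?thesis
      using that unfolding \<theta>_def by (simp add: walk_append)
  qed
  moreover have "finite (range \<theta>)"
  proof -
    let ?P = "range (coset M)"
    let ?g = "\<lambda>v. (coset M (ev v), \<lambda>C\<in>?P. walk c (inv_into UNIV (coset M) C) v)"
    have "range ?g \<subseteq> ?P \<times> (?P \<rightarrow>\<^sub>E UNIV)"
      by auto
    moreover have "finite (?P \<times> (?P \<rightarrow>\<^sub>E (UNIV :: bit set)))"
      using fin_normalD(5)[OF M] by (intro finite_cartesian_product finite_PiE) auto
    ultimately have "finite (range ?g)"
      by (rule finite_subset)
    then show ?thesis
    proof (rule finite_range_factor)
      fix v w
      assume eq: "?g v = ?g w"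
      have "walk c x v = walk c x w" for x
      proof -
        have "coset M (inv_into UNIV (coset M) (coset M x)) = coset M x"
          by (simp add: f_inv_into_f)
        then have *: "walk c (inv_into UNIV (coset M) (coset M x)) u = walk c x u" for u
          by (rule walk_coset[OF M lab])
        have "(\<lambda>C\<in>?P. walk c (inv_into UNIV (coset M) C) v) (coset M x) =
            (\<lambda>C\<in>?P. walk c (inv_into UNIV (coset M) C) w) (coset M x)"
          using eq by (simp only: prod.inject)
        then show ?thesis
          by (simp add: *)
      qed
      moreover have "coset M (ev v) = coset M (ev w)"
        using eq by simp
      ultimately show "\<theta> v = \<theta> w"
        unfolding \<theta>_def by (simp add: fun_eq_iff)
    qed
  qed
  moreover have "\<theta> (wpow w (expo w)) []" for w
    using c by (simp add: \<theta>_def valid_def tgrp_torsion)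
  ultimately have "relcong \<theta>"
    unfolding relcong_def by blast
  then have "\<theta> v w"
    using vw unfolding ev_eq_iff word_eq_def by blast
  then show ?thesis
    by (simp add: \<theta>_def)
qed

definition pot :: "(tgrp \<Rightarrow> bool \<Rightarrow> bit) \<Rightarrow> tgrp \<Rightarrow> bit" where
  "pot c x = walk c 0 (rep_tgrp x)"

lemma pot_ev:
  assumes "fin_normal M" "c \<in> valid M"
  shows "pot c (ev w) = walk c 0 w"
  unfolding pot_def by (rule walk_word_eq[OF assms]) simp

lemma pot_add_ev:
  assumes "fin_normal M" "c \<in> valid M"
  shows "pot c (x + ev w) = pot c x + walk c x w"
  using pot_ev[OF assms, of "rep_tgrp x @ w"] by (simp add: walk_append pot_def)

lemma pot_add_gen:
  assumes "fin_normal M" "c \<in> valid M"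
  shows "pot c (x + gen a) = pot c x + c x a"
  using pot_add_ev[OF assms, of x "[a]"] by (simp add: gen_def)

text \<open>The potential need not descend modulo \<open>M\<close>, but its increments do, being
  sums along walks. So any \<open>s\<close>, not just a generator, can label edges of the
  quotient.\<close>

lemma pot_coset:
  assumes "fin_normal M" "c \<in> valid M" "coset M x = coset M y"
  shows "pot c (x + s) + pot c x = pot c (y + s) + pot c y"
proof -
  have "walk c x (rep_tgrp s) = walk c y (rep_tgrp s)"
    by (rule walk_coset[OF assms(1) _ assms(3)]) (use assms(2) in \<open>simp add: valid_def\<close>)
  then show ?thesis
    using pot_add_ev[OF assms(1,2), of x "rep_tgrp s"] pot_add_ev[OF assms(1,2), of y "rep_tgrp s"]
    by (simp add: algebra_simps add.assoc[symmetric])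
qed

section \<open>Linear algebra over the field with two elements, by counting vectors\<close>

text \<open>One linear condition with two possible values holds for at least half of the vectors, so
  cardinalities can carry all rank arguments.\<close>

lemma card_kernel_ge:
  fixes V :: "'v::ab_group_add set" and L :: "'j \<Rightarrow> 'v \<Rightarrow> bit"
  assumes "finite J" "finite V"
    and add: "\<And>u v. u \<in> V \<Longrightarrow> v \<in> V \<Longrightarrow> u + v \<in> V"
    and L: "\<And>j u v. L j (u + v) = L j u + L j v"
  shows "card V \<le> 2 ^ card J * card {v\<in>V. \<forall>j\<in>J. L j v = 0}"
  using assms(1)
proof (induction J)
  case empty
  then show ?case by simp
next
  case (insert j J)
  let ?W = "{v\<in>V. \<forall>j\<in>J. L j v = 0}" and ?K = "{v\<in>V. \<forall>j\<in>insert j J. L j v = 0}"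
  have "card ?W \<le> 2 * card ?K"
  proof (cases "\<exists>u\<in>?W. L j u = 1")
    case False
    then have "?W = ?K"
      by auto
    then show ?thesis by simp
  next
    case True
    then obtain u where u: "u \<in> ?W" "L j u = 1"
      by blast
    have "?W \<subseteq> ?K \<union> (\<lambda>v. v - u) ` ?K"
    proof
      fix v assume v: "v \<in> ?W"
      show "v \<in> ?K \<union> (\<lambda>v. v - u) ` ?K"
      proof (cases "L j v = 0")
        case False
        then have "v + u \<in> ?K"
          using u v add L by auto
        then show ?thesis
          by (auto simp: image_iff intro!: bexI[of _ "v + u"])
      qed (use v in auto)
    qed
    then have "card ?W \<le> card (?K \<union> (\<lambda>v. v - u) ` ?K)"
      using \<open>finite V\<close> by (intro card_mono) auto
    also have "\<dots> \<le> card ?K + card ((\<lambda>v. v - u) ` ?K)"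
      by (rule card_Un_le)
    also have "\<dots> \<le> card ?K + card ?K"
      using \<open>finite V\<close> by (intro add_left_mono card_image_le) auto
    finally show ?thesis by simp
  qed
  then have "2 ^ card J * card ?W \<le> 2 ^ card J * (2 * card ?K)"
    by (rule mult_left_mono) simp
  also have "\<dots> = 2 ^ card (insert j J) * card ?K"
    using insert.hyps by simp
  finally show ?case
    using insert.IH by (rule le_trans [rotated])
qed

text \<open>\<open>B\<close> plays the part of a basis among the functionals of \<open>U\<close>
  restricted to \<open>V\<close>: their values can be prescribed independently, and they account for
  the whole quotient of \<open>V\<close> by the common kernel.\<close>

lemma shatter:
  fixes V :: "'v::ab_group_add set" and L :: "'j \<Rightarrow> 'v \<Rightarrow> bit"
  assumes "finite U" "finite V" "V \<noteq> {}"
    and add: "\<And>u v. u \<in> V \<Longrightarrow> v \<in> V \<Longrightarrow> u + v \<in> V"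
    and L: "\<And>j u v. L j (u + v) = L j u + L j v"
  shows "\<exists>B\<subseteq>U. (\<forall>t. \<exists>v\<in>V. \<forall>j\<in>B. L j v = t j) \<and>
    card V \<le> 2 ^ card B * card {v\<in>V. \<forall>j\<in>U. L j v = 0}"
  using assms(1)
proof (induction U)
  case empty
  then show ?case
    using \<open>V \<noteq> {}\<close> by auto
next
  case (insert j U)
  then obtain B where B: "B \<subseteq> U" "\<And>t. \<exists>v\<in>V. \<forall>j\<in>B. L j v = t j"
    "card V \<le> 2 ^ card B * card {v\<in>V. \<forall>j\<in>U. L j v = 0}"
    by blast
  let ?W = "{v\<in>V. \<forall>j\<in>U. L j v = 0}" and ?K = "{v\<in>V. \<forall>j\<in>insert j U. L j v = 0}"
  show ?case
  proof (cases "\<exists>u\<in>?W. L j u = 1")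
    case False
    then have "?W = ?K"
      by auto
    with B show ?thesis
      by (intro exI[of _ B]) auto
  next
    case True
    \<comment> \<open>Here \<open>j\<close> is independent of the functionals met so far: adding
      \<open>u\<close> corrects the value at \<open>j\<close> and leaves the values on
      \<open>B\<close> alone.\<close>
    then obtain u where u: "u \<in> ?W" "L j u = 1"
      by blast
    have "j \<notin> B"
      using B(1) insert by blast
    have "finite B"
      using B(1) insert finite_subset by blast
    have "card ?W \<le> 2 ^ card {j} * card {v\<in>?W. \<forall>j\<in>{j}. L j v = 0}"
      by (rule card_kernel_ge) (use \<open>finite V\<close> add L in auto)
    also have "{v\<in>?W. \<forall>j\<in>{j}. L j v = 0} = ?K"
      by auto
    finally have "card ?W \<le> 2 * card ?K"
      by simp
    then have "2 ^ card B * card ?W \<le> 2 ^ card B * (2 * card ?K)"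
      by (rule mult_left_mono) simp
    also have "\<dots> = 2 ^ card (insert j B) * card ?K"
      using \<open>j \<notin> B\<close> \<open>finite B\<close> by simp
    finally have "card V \<le> 2 ^ card (insert j B) * card ?K"
      using B(3) by (rule le_trans [rotated])
    moreover have "\<exists>v\<in>V. \<forall>i\<in>insert j B. L i v = t i" for t
    proof -
      obtain v where v: "v \<in> V" "\<forall>i\<in>B. L i v = t i"
        using B(2) by blast
      show ?thesis
      proof (cases "L j v = t j")
        case False
        then have "L j (v + u) = t j"
          using u L by (cases "t j"; cases "L j v") auto
        moreover have "L i (v + u) = t i" if "i \<in> B" for i
          using that u v B(1) L by auto
        ultimately show ?thesis
          using u v add by (intro bexI[of _ "v + u"]) auto
      qed (use v in auto)
    qed
    ultimately show ?thesis
      using B(1) by (intro exI[of _ "insert j B"]) auto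
  qed
qed

section \<open>Counting derivations\<close>

lemma odd_part:
  assumes "0 < (d::nat)"
  obtains j m where "odd m" "d = 2 ^ j * m"
proof -
  have "\<exists>j m. odd m \<and> d = 2 ^ j * m"
    using assms
  proof (induction d rule: less_induct)
    case (less d)
    show ?case
    proof (cases "odd d")
      case True
      then show ?thesis
        by (intro exI[of _ 0] exI[of _ d]) simp
    next
      case False
      then obtain e where e: "d = 2 * e"
        by blast
      then obtain j m where "odd m" "e = 2 ^ j * m"
        using less.IH[of e] less.prems by auto
      then show ?thesis
        using e by (intro exI[of _ "Suc j"] exI[of _ m]) simp
    qed
  qed
  then show ?thesis
    using that by blast
qed

text \<open>Closure under sums and differences puts the greatest common divisor of \<open>d\<close>
  and \<open>2 ^ Suc k\<close> among the exponents with \<open>P\<close>; it is a proper divisor of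
  \<open>2 ^ Suc k\<close> and therefore divides \<open>2 ^ k\<close>. For powers of a group
  element: an order below the full one already shows at half the exponent.\<close>

lemma half_period:
  fixes P :: "nat \<Rightarrow> bool"
  assumes add: "\<And>a b. P a \<Longrightarrow> P b \<Longrightarrow> P (a + b)" and diff: "\<And>a b. P (a + b) \<Longrightarrow> P b \<Longrightarrow> P a"
    and zero: "P 0" and top: "P (2 ^ Suc k)" and d: "0 < d" "d < 2 ^ Suc k" "P d"
  shows "P (2 ^ k)"
proof -
  have mult: "P (l * a)" if "P a" for l a
    by (induction l) (use that add zero in auto)
  obtain j m where jm: "odd m" "d = 2 ^ j * m"
    using odd_part[OF d(1)] .
  have "0 < m"
    using jm by (auto intro: Nat.gr0I)
  then have "2 ^ j * 1 \<le> 2 ^ j * m"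
    by (intro mult_left_mono) auto
  then have "2 ^ j < (2::nat) ^ Suc k"
    using d(2) jm by linarith
  then have "j \<le> k"
    by (simp add: power_strict_increasing_iff less_Suc_eq_le del: power_Suc)
  then have "2 ^ (k - j) * d = 2 ^ k * m"
    using jm by (simp add: power_add[symmetric] mult.assoc[symmetric])
  then have "P (2 ^ k * m)"
    using mult[OF d(3), of "2 ^ (k - j)"] by simp
  moreover have "2 ^ k * m = 2 ^ k + (m div 2) * 2 ^ Suc k"
    using jm(1) by (auto elim!: oddE simp: algebra_simps)
  ultimately show ?thesis
    using diff mult[OF top, of "m div 2"] by metis
qed

lemma card_UNIV_bit: "card (UNIV :: bit set) = 2"
  by (simp add: UNIV_bit)

lemma card_labels:
  assumes M: "fin_normal M"
  shows "finite (labels M)" "card (labels M) = 2 ^ (2 * card (range (coset M)))"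
proof -
  let ?P = "range (coset M)"
  let ?f = "\<lambda>d x (a :: bool). d (coset M x, a) :: bit"
  have inj: "inj_on ?f ((?P \<times> UNIV) \<rightarrow>\<^sub>E UNIV)"
  proof (rule inj_onI)
    fix d d'
    assume d: "d \<in> (?P \<times> UNIV) \<rightarrow>\<^sub>E UNIV" "d' \<in> (?P \<times> UNIV) \<rightarrow>\<^sub>E UNIV" "?f d = ?f d'"
    show "d = d'"
    proof (rule PiE_ext[OF d(1,2)])
      fix p assume "p \<in> ?P \<times> (UNIV :: bool set)"
      then obtain x a where "p = (coset M x, a)"
        by auto
      then show "d p = d' p"
        using fun_cong[OF fun_cong[OF d(3)], of x a] by simp
    qed
  qed
  have "labels M = ?f ` ((?P \<times> UNIV) \<rightarrow>\<^sub>E UNIV)"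
  proof (intro equalityI subsetI)
    fix c assume c: "c \<in> labels M"
    define d where "d = (\<lambda>(C, a)\<in>?P \<times> UNIV. c (inv_into UNIV (coset M) C) a)"
    have "c (inv_into UNIV (coset M) (coset M x)) = c x" for x
      using c f_inv_into_f[of "coset M x" "coset M" UNIV] unfolding labels_def by blast
    then have "c = ?f d"
      by (simp add: d_def fun_eq_iff)
    moreover have "d \<in> (?P \<times> UNIV) \<rightarrow>\<^sub>E UNIV"
      by (simp add: d_def)
    ultimately show "c \<in> ?f ` ((?P \<times> UNIV) \<rightarrow>\<^sub>E UNIV)"
      by blast
  next
    fix c assume "c \<in> ?f ` ((?P \<times> UNIV) \<rightarrow>\<^sub>E UNIV)"
    then show "c \<in> labels M"
      by (auto simp: labels_def)
  qed
  moreover have "finite ?P"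
    by (rule fin_normalD(5)[OF M])
  ultimately show "finite (labels M)" "card (labels M) = 2 ^ (2 * card ?P)"
    using card_image[OF inj]
    by (auto simp: card_PiE card_UNIV_bit card_cartesian_product mult.commute intro!: finite_PiE)
qed

lemma labels_plus: "c \<in> labels M \<Longrightarrow> d \<in> labels M \<Longrightarrow> c + d \<in> labels M"
proof -
  assume "c \<in> labels M" "d \<in> labels M"
  then have "coset M x = coset M y \<Longrightarrow> c x = c y" "coset M x = coset M y \<Longrightarrow> d x = d y" for x y
    unfolding labels_def by blast+
  then show ?thesis
    unfolding labels_def mem_Collect_eq plus_fun_apply by metis
qed

lemma valid_plus: "c \<in> valid M \<Longrightarrow> d \<in> valid M \<Longrightarrow> c + d \<in> valid M"
  by (simp add: valid_def labels_plus walk_plus)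

lemma zero_valid: "0 \<in> valid M"
proof -
  have "walk 0 x w = 0" for x w
    by (induction w arbitrary: x) auto
  then show ?thesis
    by (simp add: valid_def labels_def)
qed

lemma ev_wpow_add: "ev (wpow w (j + k)) = ev (wpow w j) + ev (wpow w k)"
  by (simp add: wpow_add)

lemma wpow_commute: "wpow w k @ w = w @ wpow w k"
  using wpow_Suc wpow_Suc' by metis

text \<open>
  The relator \<open>w\<^sup>K\<close> imposes a condition on labels only if \<open>w\<close> has order exactly \<open>K\<close>
  modulo \<open>M\<close>; otherwise it runs an even number of times around a closed walk.
\<close>

definition full_order :: "tgrp set \<Rightarrow> bool list \<Rightarrow> bool" where
  "full_order M w \<longleftrightarrow> ev (wpow w (expo w div 2)) \<notin> M"

lemma relator_trivial:
  assumes M: "fin_normal M" and c: "c \<in> labels M" and w: "\<not> full_order M w"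
  shows "walk c x (wpow w (expo w)) = 0"
proof -
  let ?h = "wpow w (expo w div 2)"
  have "expo w = expo w div 2 + expo w div 2"
    by (simp add: expo_def)
  then have "wpow w (expo w) = ?h @ ?h"
    using wpow_add by metis
  then have "walk c x (wpow w (expo w)) = walk c x ?h + walk c (x + ev ?h) ?h"
    by (simp add: walk_append)
  moreover have "coset M (x + ev ?h) = coset M x"
    using w coset_eq_iff[OF M, of x "x + ev ?h"]
    by (simp add: full_order_def add.assoc[symmetric])
  then have "walk c (x + ev ?h) ?h = walk c x ?h"
    by (rule walk_coset[OF M c])
  ultimately show ?thesis
    by simp
qed

text \<open>The relator commutes with its root \<open>w\<close>, and its walk is closed in the
  torsion group, so the two passages through \<open>w\<close> cancel. Hence one condition serves a
  whole orbit of \<open>w\<close> on the cosets.\<close>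

lemma relator_shift:
  assumes M: "fin_normal M" and c: "c \<in> labels M"
  shows "walk c (x + ev (wpow w i)) (wpow w (expo w)) = walk c x (wpow w (expo w))"
proof -
  let ?r = "wpow w (expo w)"
  have step: "walk c (x + ev w) ?r = walk c x ?r" for x
  proof -
    have "walk c x (w @ ?r) = walk c x (?r @ w)"
      by (simp add: wpow_commute)
    then show ?thesis
      by (simp add: walk_append tgrp_torsion add.commute)
  qed
  show ?thesis
  proof (induction i arbitrary: x)
    case (Suc i)
    then show ?case
      using Suc[of "x + ev w"] step[of x] by (simp add: wpow_Suc add.assoc)
  qed simp
qed

text \<open>\<open>R\<close> picks one point from each orbit of right translation by
  \<open>w\<close> on the cosets. Full order makes every orbit at least \<open>expo w\<close> long,
  and disjointness of the orbits bounds their number.\<close>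

lemma card_relators:
  assumes M: "fin_normal M" and w: "full_order M w"
  obtains R where "finite R" "card R * expo w \<le> card (range (coset M))"
    "\<And>x. \<exists>r\<in>R. \<exists>i. coset M x = coset M (r + ev (wpow w i))"
proof -
  let ?P = "range (coset M)"
  let ?e = "\<lambda>i. ev (wpow w i)"
  have finP: "finite ?P"
    by (rule fin_normalD(5)[OF M])
  define orb where "orb x = range (\<lambda>i. coset M (x + ?e i))" for x
  have eK: "?e (i + l * expo w) = ?e i" for i l
  proof (induction l)
    case (Suc l)
    have "?e (i + Suc l * expo w) = ?e (i + l * expo w) + ?e (expo w)"
      using ev_wpow_add[of w "i + l * expo w" "expo w"] by (simp add: algebra_simps)
    then show ?case
      using Suc tgrp_torsion by simp
  qed simp
  have card_orb: "expo w \<le> card (orb x)" for x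
  proof -
    have "inj_on (\<lambda>i. coset M (x + ?e i)) {..<expo w}"
    proof (rule linorder_inj_onI')
      fix i j
      assume ij: "i \<in> {..<expo w}" "j \<in> {..<expo w}" "i < j"
      show "coset M (x + ?e i) \<noteq> coset M (x + ?e j)"
      proof
        assume "coset M (x + ?e i) = coset M (x + ?e j)"
        then have "coset M (?e i) = coset M (?e i + ?e (j - i))"
          using coset_add_left[OF M] ij ev_wpow_add[of w i "j - i"] by auto
        then have d: "?e (j - i) \<in> M"
          by (simp add: coset_eq_iff[OF M] add.assoc[symmetric])
        let ?k = "to_nat w + 1"
        have "?e (2 ^ ?k) \<in> M"
        proof (rule half_period[where P = "\<lambda>i. ?e i \<in> M" and d = "j - i"])
          show "?e (a + b) \<in> M" if "?e a \<in> M" "?e b \<in> M" for a b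
            using that fin_normalD(2)[OF M] ev_wpow_add by metis
          show "?e a \<in> M" if "?e (a + b) \<in> M" "?e b \<in> M" for a b
          proof -
            have "?e (a + b) + - ?e b \<in> M"
              using that fin_normalD(2,3)[OF M] by blast
            then show ?thesis
              by (simp add: ev_wpow_add add.assoc)
          qed
          show "?e (2 ^ Suc ?k) \<in> M"
            using tgrp_torsion[of w] fin_normalD(1)[OF M] by (simp add: expo_def)
          show "j - i < 2 ^ Suc ?k"
            using ij by (auto simp: expo_def)
        qed (use ij d fin_normalD(1)[OF M] in auto)
        moreover have "expo w div 2 = 2 ^ ?k"
          by (simp add: expo_def)
        ultimately show False
          using w by (simp add: full_order_def)
      qed
    qed
    then have "expo w = card ((\<lambda>i. coset M (x + ?e i)) ` {..<expo w})"
      by (simp add: card_image)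
    also have "\<dots> \<le> card (orb x)"
      unfolding orb_def by (rule card_mono) (auto intro: finite_subset[OF _ finP])
    finally show ?thesis .
  qed
  have orb_sub: "orb x \<subseteq> orb y" if meet: "coset M (x + ?e i) = coset M (y + ?e j)" for x y i j
  proof
    fix C assume "C \<in> orb x"
    then obtain l where C: "C = coset M (x + ?e l)"
      by (auto simp: orb_def)
    \<comment> \<open>Only nonnegative powers are at hand: going back by \<open>i\<close> steps
      means going forward by \<open>i * expo w - i\<close>.\<close>
    have "i \<le> i * expo w"
      by (simp add: Suc_le_eq)
    then have l: "i + (l + (i * expo w - i)) = l + i * expo w"
      by linarith
    have "?e l = ?e i + ?e (l + (i * expo w - i))"
      using eK[of l i] ev_wpow_add[of w i "l + (i * expo w - i)"] l by simp
    then have "C = coset M (y + ?e j + ?e (l + (i * expo w - i)))"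
      using C meet coset_add_right[OF M] by (metis add.assoc)
    also have "y + ?e j + ?e (l + (i * expo w - i)) = y + ?e (j + (l + (i * expo w - i)))"
      by (simp only: ev_wpow_add add.assoc)
    finally show "C \<in> orb y"
      by (auto simp: orb_def)
  qed
  have disj: "orb x = orb y" if ne: "orb x \<inter> orb y \<noteq> {}" for x y
  proof -
    obtain C where "C \<in> orb x" "C \<in> orb y"
      using ne by blast
    then obtain i j where "C = coset M (x + ?e i)" "C = coset M (y + ?e j)"
      unfolding orb_def by blast
    then have "coset M (x + ?e i) = coset M (y + ?e j)"
      by simp
    then show ?thesis
      using orb_sub[of x i y j] orb_sub[of y j x i] by auto
  qed
  have finO: "finite (range orb)"
    by (rule finite_subset[of _ "Pow ?P"]) (use finP in \<open>auto simp: orb_def\<close>)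
  have "card (range orb) * expo w = (\<Sum>C\<in>range orb. expo w)"
    by simp
  also have "\<dots> \<le> (\<Sum>C\<in>range orb. card C)"
    by (rule sum_mono) (use card_orb in auto)
  also have "\<dots> = card (\<Union>(range orb))"
  proof (rule card_Union_disjoint[symmetric])
    show "pairwise disjnt (range orb)"
      using disj by (auto simp: pairwise_def disjnt_def)
    show "finite C" if C: "C \<in> range orb" for C
      by (rule finite_subset[OF _ finP]) (use C in \<open>auto simp: orb_def\<close>)
  qed
  also have "\<dots> \<le> card ?P"
    by (rule card_mono[OF finP]) (auto simp: orb_def)
  finally have cO: "card (range orb) * expo w \<le> card ?P" .
  let ?R = "inv_into UNIV orb ` range orb"
  show ?thesis
  proof
    show "finite ?R"
      using finO by simp
    have "card ?R \<le> card (range orb)"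
      by (rule card_image_le[OF finO])
    then show "card ?R * expo w \<le> card ?P"
      using cO by (meson le_trans mult_le_mono1)
    fix x
    have "coset M x = coset M (x + ?e 0)"
      by simp
    then have "coset M x \<in> orb x"
      unfolding orb_def by blast
    also have "orb x = orb (inv_into UNIV orb (orb x))"
      by (simp add: f_inv_into_f)
    finally show "\<exists>r\<in>?R. \<exists>i. coset M x = coset M (r + ?e i)"
      unfolding orb_def by blast
  qed
qed

text \<open>Of the \<open>2 n\<close> dimensions of labels at most \<open>n / 2\<close> are lost:
  the relator of \<open>w\<close> costs at most \<open>n / expo w\<close> conditions, and the
  numbers \<open>1 / 2 ^ (t + 2)\<close> over distinct codes \<open>t\<close> sum to at most
  \<open>1 / 2\<close>.\<close>

lemma card_valid:
  assumes M: "fin_normal M"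
  obtains k where "2 * k \<le> card (range (coset M))" "finite (valid M)"
    "2 ^ (2 * card (range (coset M))) \<le> 2 ^ k * card (valid M)"
proof -
  let ?n = "card (range (coset M))"
  define R where "R w = (SOME R. finite R \<and> card R * expo w \<le> ?n \<and>
    (\<forall>x. \<exists>r\<in>R. \<exists>i. coset M x = coset M (r + ev (wpow w i))))" for w
  have R: "finite (R w) \<and> card (R w) * expo w \<le> ?n \<and>
    (\<forall>x. \<exists>r\<in>R w. \<exists>i. coset M x = coset M (r + ev (wpow w i)))" if "full_order M w" for w
    unfolding R_def by (rule someI_ex) (use card_relators[OF M that] in metis)
  define W where "W = {w. full_order M w}"
  \<comment> \<open>An orbit of length \<open>expo w\<close> must fit into the \<open>n\<close>
    cosets, so only finitely many relators impose conditions.\<close>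
  have "to_nat ` W \<subseteq> {..?n}"
  proof
    fix k assume "k \<in> to_nat ` W"
    then obtain w where w: "w \<in> W" "k = to_nat w"
      by auto
    have "R w \<noteq> {}"
      using R w by (auto simp: W_def)
    then have "1 \<le> card (R w)"
      using R w by (simp add: W_def card_gt_0_iff Suc_le_eq)
    then have "1 * expo w \<le> card (R w) * expo w"
      by (rule mult_le_mono1)
    also have "\<dots> \<le> ?n"
      using R[of w] w by (simp add: W_def)
    finally have "expo w \<le> ?n"
      by simp
    moreover have "to_nat w < 2 ^ to_nat w"
      by (rule less_exp)
    moreover have "(2::nat) ^ to_nat w \<le> expo w"
      by (simp add: expo_def)
    ultimately have "to_nat w \<le> ?n"
      by linarith
    then show "k \<in> {..?n}"
      using w by simp
  qed
  then have finW: "finite W"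
    by (meson finite_atMost finite_imageD finite_subset inj_on_subset inj_to_nat subset_UNIV)
  define J where "J = Sigma W R"
  have finJ: "finite J"
    unfolding J_def using finW R by (auto simp: W_def)
  have "real (card J) = (\<Sum>w\<in>W. real (card (R w)))"
    unfolding J_def using finW R by (subst card_SigmaI) (auto simp: W_def)
  also have "\<dots> \<le> (\<Sum>w\<in>W. real ?n / 4 * (1 / 2) ^ to_nat w)"
  proof (rule sum_mono)
    fix w assume "w \<in> W"
    then have "real (card (R w) * expo w) \<le> real ?n"
      using R by (simp only: of_nat_le_iff W_def mem_Collect_eq)
    then show "real (card (R w)) \<le> real ?n / 4 * (1 / 2) ^ to_nat w"
      by (simp add: expo_def field_simps)
  qed
  also have "\<dots> = real ?n / 4 * (\<Sum>k\<in>to_nat ` W. (1 / 2) ^ k)"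
    by (simp add: sum_distrib_left sum.reindex inj_on_subset[OF inj_to_nat])
  also have "\<dots> \<le> real ?n / 4 * 2"
  proof (rule mult_left_mono)
    have "(\<Sum>k\<in>to_nat ` W. (1 / 2) ^ k) \<le> (\<Sum>k. (1 / 2 :: real) ^ k)"
      by (rule sum_le_suminf) (use finW in auto)
    also have "\<dots> = 2"
      using suminf_geometric[of "1 / 2 :: real"] by simp
    finally show "(\<Sum>k\<in>to_nat ` W. (1 / 2) ^ k) \<le> (2 :: real)" .
  qed simp
  finally have J: "2 * card J \<le> ?n"
    by simp
  note fl = card_labels[OF M]
  have sub: "{c \<in> labels M. \<forall>(w, r)\<in>J. walk c r (wpow w (expo w)) = 0} \<subseteq> valid M"
  proof
    fix c assume c: "c \<in> {c \<in> labels M. \<forall>(w, r)\<in>J. walk c r (wpow w (expo w)) = 0}"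
    have "walk c x (wpow w (expo w)) = 0" for x w
    proof (cases "full_order M w")
      case True
      then obtain r i where r: "r \<in> R w" "coset M x = coset M (r + ev (wpow w i))"
        using R by meson
      have "walk c x (wpow w (expo w)) = walk c (r + ev (wpow w i)) (wpow w (expo w))"
        by (rule walk_coset[OF M _ r(2)]) (use c in simp)
      also have "\<dots> = walk c r (wpow w (expo w))"
        by (rule relator_shift[OF M]) (use c in simp)
      also have "\<dots> = 0"
        using c r True by (auto simp: J_def W_def)
      finally show ?thesis .
    qed (use c relator_trivial[OF M] in simp)
    then show "c \<in> valid M"
      using c by (simp add: valid_def)
  qed
  have finV: "finite (valid M)"
    by (rule finite_subset[OF _ fl(1)]) (auto simp: valid_def)
  have "card (labels M) \<le> 2 ^ card J * card {c \<in> labels M. \<forall>j\<in>J. (\<lambda>(w, r). walk c r (wpow w (expo w))) j = 0}"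
    by (rule card_kernel_ge[OF finJ fl(1)]) (auto simp: labels_plus walk_plus split: prod.splits)
  also have "\<dots> \<le> 2 ^ card J * card (valid M)"
    by (intro mult_left_mono card_mono finV) (use sub in auto)
  finally have "2 ^ (2 * ?n) \<le> 2 ^ card J * card (valid M)"
    by (simp add: fl(2))
  then show ?thesis
    using that[of "card J"] finV J by blast
qed

section \<open>Infinitude of the torsion group\<close>

lemma pot_plus: "pot (c + d) x = pot c x + pot d x"
  by (simp add: pot_def walk_plus)

text \<open>A label that is the coboundary of a function on the cosets is determined by that
  function, so such labels span at most \<open>n\<close> dimensions.\<close>

lemma card_potentials_le:
  assumes M: "fin_normal M" and K: "finite K" "K \<subseteq> valid M"
    and h: "\<And>c x a. c \<in> K \<Longrightarrow> c x a = h c (x + gen a) + h c x"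
    and h_coset: "\<And>c x y. c \<in> K \<Longrightarrow> coset M x = coset M y \<Longrightarrow> h c x = (h c y :: bit)"
  shows "card K \<le> 2 ^ card (range (coset M))"
proof -
  let ?P = "range (coset M)"
  define H where "H c = (\<lambda>C\<in>?P. h c (inv_into UNIV (coset M) C))" for c
  have H: "H c (coset M x) = h c x" if "c \<in> K" for c x
    using h_coset[OF that, of "inv_into UNIV (coset M) (coset M x)" x] by (simp add: H_def f_inv_into_f)
  have "inj_on H K"
  proof (rule inj_onI)
    fix c d
    assume cd: "c \<in> K" "d \<in> K" "H c = H d"
    have "c x a = d x a" for x a
      using h[OF cd(1)] h[OF cd(2)] H[OF cd(1)] H[OF cd(2)] cd(3) by metis
    then show "c = d"
      by (simp add: fun_eq_iff)
  qed
  moreover have "H ` K \<subseteq> ?P \<rightarrow>\<^sub>E UNIV"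
    by (auto simp: H_def)
  moreover have "finite ?P"
    by (rule fin_normalD(5)[OF M])
  ultimately have "card K \<le> card (?P \<rightarrow>\<^sub>E (UNIV :: bit set))"
    by (intro card_inj_on_le) (auto intro: finite_PiE)
  also have "\<dots> = 2 ^ card ?P"
    using \<open>finite ?P\<close> by (simp add: card_PiE card_UNIV_bit)
  finally show ?thesis .
qed

text \<open>If \<open>M\<close> were trivial, the potentials would be functions on the
  \<open>n\<close> cosets, and every valid label would be a coboundary: at most \<open>n\<close>
  dimensions, against at least \<open>3 n / 2\<close>. In particular the torsion group is
  infinite.\<close>

lemma fin_normal_nontrivial:
  assumes M: "fin_normal (M :: tgrp set)"
  shows "\<exists>m\<in>M. m \<noteq> 0"
proof (rule ccontr)
  let ?n = "card (range (coset M))"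
  assume "\<not> (\<exists>m\<in>M. m \<noteq> 0)"
  then have eq: "x = y" if "coset M x = coset M y" for x y
    using that coset_eq_iff[OF M, of x y] by (metis add.right_neutral add_minus_cancel)
  obtain k where k: "2 * k \<le> ?n" "finite (valid M)" "2 ^ (2 * ?n) \<le> 2 ^ k * card (valid M)"
    using card_valid[OF M] .
  have "card (valid M) \<le> 2 ^ ?n"
  proof (rule card_potentials_le[OF M k(2) subset_refl, of pot])
    fix c x a assume "c \<in> valid M"
    then show "c x a = pot c (x + gen a) + pot c x"
      using pot_add_gen[OF M, of c x a] by (simp add: add.commute add.left_commute)
  qed (use eq in auto)
  then have "2 ^ k * card (valid M) \<le> 2 ^ k * 2 ^ ?n"
    by (rule mult_left_mono) simp
  from le_trans[OF k(3) this] have "(2::nat) ^ (2 * ?n) \<le> 2 ^ (k + ?n)"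
    by (simp only: power_add)
  then have "2 * ?n \<le> k + ?n"
    by (simp only: power_increasing_iff)
  moreover have "?n > 0"
    using fin_normalD(5)[OF M] by (auto simp: card_gt_0_iff)
  ultimately show False
    using k(1) by linarith
qed

text \<open>Residual finiteness keeps a nonzero element of \<open>N\<close> out of some smaller
  \<open>M\<close>, so the index increases strictly.\<close>

lemma fin_normal_index_unbounded: "\<exists>N :: tgrp set. fin_normal N \<and> k \<le> card (range (coset N))"
proof (induction k)
  case 0
  then show ?case
    using fin_normal_UNIV by auto
next
  case (Suc k)
  then obtain N :: "tgrp set" where N: "fin_normal N" "k \<le> card (range (coset N))"
    by blast
  obtain m where m: "m \<in> N" "m \<noteq> 0"
    using fin_normal_nontrivial[OF N(1)] by blast
  obtain M where M: "fin_normal M" "M \<subseteq> N" "m \<notin> M"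
    using tgrp_separate[of "{m}" N] N(1) m by auto
  let ?\<phi> = "\<lambda>C. coset N (inv_into UNIV (coset M) C)"
  have phi: "?\<phi> (coset M x) = coset N x" for x
  proof -
    have "coset M (inv_into UNIV (coset M) (coset M x)) = coset M x"
      by (simp add: f_inv_into_f)
    then show ?thesis
      using M(2) by (auto simp: coset_eq_iff[OF M(1)] coset_eq_iff[OF N(1)])
  qed
  have "?\<phi> ` range (coset M) = range (coset N)"
    using phi by (auto simp: image_image)
  moreover have "\<not> inj_on ?\<phi> (range (coset M))"
  proof
    assume inj: "inj_on ?\<phi> (range (coset M))"
    have "?\<phi> (coset M 0) = ?\<phi> (coset M m)"
      unfolding phi using m(1) by (simp add: coset_eq_iff[OF N(1)])
    then have "coset M 0 = coset M m"
      using inj by (meson inj_onD rangeI)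
    then show False
      using M(3) by (simp add: coset_eq_iff[OF M(1)])
  qed
  ultimately have "card (range (coset N)) < card (range (coset M))"
    using fin_normalD(5)[OF M(1)]
    by (metis card_image_le eq_card_imp_inj_on le_neq_implies_less)
  then show ?case
    using N(2) M(1) by (intro exI[of _ M]) auto
qed

section \<open>Sparse sets of edges\<close>

definition srep :: "tgrp set \<Rightarrow> tgrp \<Rightarrow> tgrp" where
  "srep N x = inv_into UNIV (coset N) (coset N x)"

lemma coset_srep: "coset N (srep N x) = coset N x"
  by (simp add: srep_def f_inv_into_f)

lemma srep_cong: "coset N x = coset N y \<Longrightarrow> srep N x = srep N y"
  by (simp add: srep_def)

text \<open>The classical Schreier generators for the transversal \<open>range (srep N)\<close>: the
  edge of the large Cayley graph at \<open>x\<close> becomes a step in \<open>N\<close> from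
  \<open>x - srep N x\<close>.\<close>

definition schreier :: "tgrp set \<Rightarrow> tgrp set" where
  "schreier N = (\<lambda>(t, a). t + gen a - srep N (t + gen a)) ` (range (srep N) \<times> UNIV)"

lemma schreier_subset:
  assumes N: "fin_normal N"
  shows "schreier N \<subseteq> N"
proof
  fix s assume "s \<in> schreier N"
  then obtain x where "s = x - srep N x"
    by (auto simp: schreier_def)
  moreover have "- srep N x + x \<in> N"
    using coset_srep[of N x] coset_eq_iff[OF N] by blast
  ultimately show "s \<in> N"
    using fin_normal_diff_comm[OF N] by simp
qed

lemma finite_schreier:
  assumes N: "fin_normal N"
  shows "finite (schreier N)" "card (schreier N) \<le> 2 * card (range (coset N))"
proof -
  have eq: "range (srep N) = inv_into UNIV (coset N) ` range (coset N)"
    by (auto simp: srep_def)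
  have fin: "finite (range (srep N))" "card (range (srep N)) \<le> card (range (coset N))"
    unfolding eq using fin_normalD(5)[OF N] by (auto intro: card_image_le)
  then show "finite (schreier N)"
    by (simp add: schreier_def)
  have "card (schreier N) \<le> card (range (srep N) \<times> (UNIV :: bool set))"
    unfolding schreier_def by (rule card_image_le) (use fin in simp)
  then show "card (schreier N) \<le> 2 * card (range (coset N))"
    using fin(2) by (simp add: card_cartesian_product)
qed

text \<open>
  At least \<open>3 n / 2\<close> dimensions of valid labels are available, and the labels whose potential is
  constant along all edges span at most \<open>n\<close> dimensions; the difference is the rank of the edges.
\<close>

lemma shattered_edges:
  assumes N: "fin_normal N" and M: "fin_normal M" "M \<subseteq> N"
  obtains B where "B \<subseteq> coset M ` N \<times> schreier N" "card (range (coset M)) \<le> 2 * card B"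
    "\<And>t. \<exists>c\<in>valid M. \<forall>x\<in>N. \<forall>s. (coset M x, s) \<in> B \<longrightarrow> pot c (x + s) + pot c x = t (coset M x, s)"
proof -
  let ?n = "card (range (coset M))" and ?S = "schreier N"
  obtain k where k: "2 * k \<le> ?n" "finite (valid M)" "2 ^ (2 * ?n) \<le> 2 ^ k * card (valid M)"
    using card_valid[OF M(1)] .
  define L where "L e c = pot c (inv_into UNIV (coset M) (fst e) + snd e) + pot c (inv_into UNIV (coset M) (fst e))"
    for e c
  have L: "L (coset M x, s) c = pot c (x + s) + pot c x" if "c \<in> valid M" for x s c
    unfolding L_def fst_conv snd_conv
    by (rule pot_coset[OF M(1) that]) (simp add: f_inv_into_f)
  let ?U = "coset M ` N \<times> ?S"
  have "finite ?U"
    using finite_schreier[OF N] fin_normalD(5)[OF M(1)]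
    by (intro finite_cartesian_product) (auto intro: finite_subset [OF image_mono])
  moreover have "valid M \<noteq> {}"
    using zero_valid by blast
  ultimately obtain B where B: "B \<subseteq> ?U" "\<And>t. \<exists>c\<in>valid M. \<forall>e\<in>B. L e c = t e"
    "card (valid M) \<le> 2 ^ card B * card {c\<in>valid M. \<forall>e\<in>?U. L e c = 0}"
    using shatter[of ?U "valid M" L] k(2) valid_plus
    by (auto simp: L_def pot_plus algebra_simps)
  let ?K = "{c\<in>valid M. \<forall>e\<in>?U. L e c = 0}"
  have K: "pot c (x + s) = pot c x" if "c \<in> ?K" "x \<in> N" "s \<in> ?S" for c x s
  proof -
    have "L (coset M x, s) c = 0"
      using that by auto
    then have "pot c (x + s) + pot c x = 0"
      using L that by simp
    then show ?thesis
      by (cases "pot c (x + s)"; cases "pot c x") auto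
  qed
  \<comment> \<open>For \<open>c\<close> in the kernel the subtracted value does not change along
    Schreier steps, so \<open>h\<close> has the same coboundary as the potential. As the increment
    over \<open>srep N z\<close> from the \<open>N\<close>-part of \<open>z\<close>, it also
    descends modulo \<open>M\<close>.\<close>
  define h where "h c z = pot c z + pot c (z - srep N z)" for c z
  have in_N: "z - srep N z \<in> N" for z
    using coset_srep[of N z] coset_eq_iff[OF N] fin_normal_diff_comm[OF N] by metis
  have "card ?K \<le> 2 ^ ?n"
  proof (rule card_potentials_le[OF M(1), of ?K h])
    fix c x a assume c: "c \<in> ?K"
    then have cv: "c \<in> valid M" by simp
    let ?t = "srep N x" and ?y = "x - srep N x"
    let ?s = "?t + gen a - srep N (?t + gen a)"
    have "coset N (?t + gen a) = coset N (x + gen a)"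
      using coset_srep coset_add_right[OF N] by blast
    then have "srep N (?t + gen a) = srep N (x + gen a)"
      by (rule srep_cong)
    then have "x + gen a - srep N (x + gen a) = ?y + ?s"
      by (simp add: add.assoc[symmetric] add_diff_eq)
    moreover have "?s \<in> ?S"
      by (auto simp: schreier_def intro!: image_eqI[of _ _ "(?t, a)"])
    ultimately have "pot c (x + gen a - srep N (x + gen a)) = pot c ?y"
      using K[OF c in_N] by simp
    then have "h c (x + gen a) + h c x = pot c (x + gen a) + pot c x + (pot c ?y + pot c ?y)"
      unfolding h_def by (simp only: add.assoc add.commute add.left_commute)
    then show "c x a = h c (x + gen a) + h c x"
      using pot_add_gen[OF M(1) cv, of x a] by (simp add: add.commute add.left_commute)
  next
    fix c x y assume c: "c \<in> ?K" and xy: "coset M x = coset M y"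
    then have cv: "c \<in> valid M" by simp
    have "coset N x = coset N y"
      using xy M(2) by (auto simp: coset_eq_iff[OF M(1)] coset_eq_iff[OF N])
    then have t: "srep N x = srep N y"
      by (rule srep_cong)
    have "coset M (x - srep N x) = coset M (y - srep N x)"
      using coset_add_right[OF M(1), of x "- srep N x" y] xy by simp
    from pot_coset[OF M(1) cv this, of "srep N x"] t
    show "h c x = h c y"
      by (simp add: h_def)
  qed (use k(2) in auto)
  then have "2 ^ k * (2 ^ card B * card ?K) \<le> 2 ^ k * (2 ^ card B * 2 ^ ?n)"
    by (intro mult_left_mono) auto
  moreover have "2 ^ k * card (valid M) \<le> 2 ^ k * (2 ^ card B * card ?K)"
    using B(3) by (rule mult_left_mono) simp
  ultimately have "2 ^ k * card (valid M) \<le> 2 ^ k * (2 ^ card B * 2 ^ ?n)"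
    by (rule le_trans [rotated])
  from le_trans[OF k(3) this] have "(2::nat) ^ (2 * ?n) \<le> 2 ^ (k + card B + ?n)"
    by (simp only: power_add mult.assoc)
  then have "2 * ?n \<le> k + card B + ?n"
    by (simp only: power_increasing_iff)
  then have n: "?n \<le> 2 * card B"
    using k(1) by linarith
  show ?thesis
  proof (rule that[OF B(1) n])
    fix t
    obtain c where "c \<in> valid M" "\<forall>e\<in>B. L e c = t e"
      using B(2) by blast
    then show "\<exists>c\<in>valid M. \<forall>x\<in>N. \<forall>s. (coset M x, s) \<in> B \<longrightarrow> pot c (x + s) + pot c x = t (coset M x, s)"
      using L by (intro bexI[of _ c]) auto
  qed
qed

text \<open>
  The average degree is at most \<open>2\<close>, so some vertex has degree at most \<open>2\<close>: it takes its edges and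
  is removed.
\<close>

lemma orientation:
  fixes src dst :: "'e \<Rightarrow> 'v"
  assumes "finite A" "\<And>A'. A' \<subseteq> A \<Longrightarrow> card A' \<le> card (src ` A' \<union> dst ` A')"
  shows "\<exists>out. \<forall>v. card {e\<in>A. out e \<and> src e = v} \<le> 2 \<and> card {e\<in>A. \<not> out e \<and> dst e = v} \<le> 2"
  using assms
proof (induction A rule: finite_psubset_induct)
  case (psubset A)
  show ?case
  proof (cases "A = {}")
    case False
    let ?V = "src ` A \<union> dst ` A"
    let ?d = "\<lambda>v. card {e\<in>A. src e = v} + card {e\<in>A. dst e = v}"
    have "\<exists>v\<in>?V. ?d v \<le> 2"
    proof (rule ccontr)
      assume "\<not> (\<exists>v\<in>?V. ?d v \<le> 2)"
      then have d: "\<not> ?d v \<le> 2" if "v \<in> ?V" for v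
        using that by blast
      have "3 \<le> ?d v" if "v \<in> ?V" for v
        using d[OF that] by linarith
      then have "(\<Sum>v\<in>?V. 3) \<le> (\<Sum>v\<in>?V. ?d v)"
        by (rule sum_mono)
      moreover have "(\<Sum>v\<in>?V. card {e\<in>A. src e = v}) = card A"
        using sum.group[of A ?V src "\<lambda>_. 1 :: nat"] psubset.hyps by simp
      moreover have "(\<Sum>v\<in>?V. card {e\<in>A. dst e = v}) = card A"
        using sum.group[of A ?V dst "\<lambda>_. 1 :: nat"] psubset.hyps by simp
      ultimately have "3 * card ?V \<le> 2 * card A"
        by (simp add: sum.distrib)
      moreover have "card A \<le> card ?V"
        using psubset.prems by blast
      moreover have "card ?V > 0"
        using False psubset.hyps by (simp add: card_gt_0_iff)
      ultimately show False
        by linarith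
    qed
    then obtain v where v: "v \<in> ?V" "?d v \<le> 2"
      by blast
    let ?A = "{e\<in>A. src e \<noteq> v \<and> dst e \<noteq> v}"
    have "?A \<subset> A"
      using v(1) by auto
    moreover have "\<And>A'. A' \<subseteq> ?A \<Longrightarrow> card A' \<le> card (src ` A' \<union> dst ` A')"
      using psubset.prems by blast
    ultimately obtain out where out: "\<And>v. card {e\<in>?A. out e \<and> src e = v} \<le> 2"
      "\<And>v. card {e\<in>?A. \<not> out e \<and> dst e = v} \<le> 2"
      using psubset.IH[of ?A] by blast
    \<comment> \<open>Every edge at \<open>v\<close> is charged to \<open>v\<close>, whichever end
      lies there; the other vertices are charged only for edges of \<open>?A\<close>.\<close>
    let ?out = "\<lambda>e. if src e = v then True else if dst e = v then False else out e"
    have "card {e\<in>A. ?out e \<and> src e = u} \<le> 2 \<and> card {e\<in>A. \<not> ?out e \<and> dst e = u} \<le> 2" for u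
    proof (cases "u = v")
      case True
      have "card {e\<in>A. ?out e \<and> src e = v} \<le> card {e\<in>A. src e = v}"
        by (rule card_mono) (use psubset.hyps in auto)
      moreover have "card {e\<in>A. \<not> ?out e \<and> dst e = v} \<le> card {e\<in>A. dst e = v}"
        by (rule card_mono) (use psubset.hyps in auto)
      ultimately show ?thesis
        using v(2) True by simp
    next
      case False
      then have "{e\<in>A. ?out e \<and> src e = u} = {e\<in>?A. out e \<and> src e = u}"
        "{e\<in>A. \<not> ?out e \<and> dst e = u} = {e\<in>?A. \<not> out e \<and> dst e = u}"
        by auto
      then show ?thesis
        using out by simp
    qed
    then show ?thesis
      by (intro exI[of _ ?out] allI)
  qed simp
qed

section \<open>Littlewood functions of large norm\<close>

text \<open>Each translate \<open>y\<close> shows the window a piece \<open>A y\<close> of the edge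
  set \<open>B\<close>, which sparseness allows to orient; an edge counts for \<open>a\<close> if it
  is charged to its source and for \<open>b\<close> if to its target. The translates of a point run
  once through \<open>N / M\<close>, so the share of translates that show an edge does not depend on
  its place. This share is the density \<open>f\<close> of \<open>B\<close>.\<close>

lemma average_window:
  assumes N: "fin_normal N" and M: "fin_normal M" "M \<subseteq> N" and E: "finite E" "E \<subseteq> N"
    and sep: "\<And>x y. x \<in> E \<Longrightarrow> y \<in> E \<Longrightarrow> coset M x = coset M y \<Longrightarrow> x = y"
  obtains f :: "tgrp \<Rightarrow> real" and a b :: "tgrp \<Rightarrow> tgrp \<Rightarrow> real"
  where "card (range (coset N)) / 2 \<le> sum f (schreier N)"
    "\<And>x s. 0 \<le> a x s \<and> a x s \<le> 1" "\<And>x s. 0 \<le> b x s \<and> b x s \<le> 1"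
    "\<And>x s. x \<in> E \<Longrightarrow> s \<in> schreier N \<Longrightarrow> x + s \<in> E \<Longrightarrow> a x s + b x s = f s"
    "\<And>x. (\<Sum>s\<in>schreier N. a x s) \<le> 2" "\<And>z. (\<Sum>s\<in>schreier N. b (z - s) s) \<le> 2"
proof -
  let ?S = "schreier N" and ?P = "coset M ` N"
  have finS: "finite ?S"
    by (rule finite_schreier[OF N])
  have finP: "finite ?P"
    using fin_normalD(5)[OF M(1)] by (rule finite_subset [OF image_mono, rotated]) simp
  obtain B where B: "B \<subseteq> ?P \<times> ?S" "card (range (coset M)) \<le> 2 * card B"
    "\<And>t. \<exists>c\<in>valid M. \<forall>x\<in>N. \<forall>s. (coset M x, s) \<in> B \<longrightarrow> pot c (x + s) + pot c x = t (coset M x, s)"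
    by (rule shattered_edges[OF N M]) blast
  define Y where "Y = inv_into N (coset M) ` ?P"
  have Y_sub: "Y \<subseteq> N"
    unfolding Y_def by (auto intro: inv_into_into)
  have Y_inj: "inj_on (coset M) Y"
    unfolding Y_def by (auto intro!: inj_onI simp: f_inv_into_f)
  have Y_img: "coset M ` Y = ?P"
    unfolding Y_def by (auto simp: image_image f_inv_into_f)
  have finY: "finite Y"
    unfolding Y_def using finP by simp
  define m where "m = card Y"
  have m_card: "m = card ?P"
    using card_image[OF Y_inj] Y_img by (simp add: m_def)
  have "coset M 0 \<in> ?P"
    using fin_normalD(1)[OF N] by blast
  then have m_pos: "0 < m"
    using finP m_card by (auto simp: card_gt_0_iff)
  have transl: "bij_betw (\<lambda>y. coset M (y + x)) Y ?P" if x: "x \<in> N" for x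
  proof -
    have "inj_on (\<lambda>y. coset M (y + x)) Y"
      using Y_inj by (simp add: inj_on_def coset_add_right[OF M(1)])
    moreover have "(\<lambda>y. coset M (y + x)) ` Y \<subseteq> ?P"
      using Y_sub x by (auto intro!: imageI fin_normalD(2)[OF N])
    ultimately show ?thesis
      using finP m_card m_def by (simp add: bij_betw_def card_image card_subset_eq)
  qed
  define A where "A y = {(x, s). x \<in> E \<and> s \<in> ?S \<and> x + s \<in> E \<and> (coset M (y + x), s) \<in> B}" for y
  have finA: "finite (A y)" for y
    by (rule finite_subset[of _ "E \<times> ?S"]) (use E finS in \<open>auto simp: A_def\<close>)
  have sparse: "card A' \<le> card (fst ` A' \<union> (\<lambda>(x, s). x + s) ` A')" if y: "y \<in> Y" and A': "A' \<subseteq> A y" for y A'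
  proof -
    let ?V = "fst ` A' \<union> (\<lambda>(x, s). x + s) ` A'"
    have "finite A'"
      using finA A' by (rule finite_subset[rotated])
    then have fin: "finite A'" "finite ?V"
      by auto
    \<comment> \<open>The coboundary from vertex values to edge values. It is onto since potentials
      realise every assignment on \<open>B\<close>; counting both sides bounds edges by
      vertices.\<close>
    let ?\<Phi> = "\<lambda>v. \<lambda>(x, s)\<in>A'. v (x + s) + v x :: bit"
    have "A' \<rightarrow>\<^sub>E UNIV \<subseteq> ?\<Phi> ` (?V \<rightarrow>\<^sub>E UNIV)"
    proof
      fix t :: "tgrp \<times> tgrp \<Rightarrow> bit" assume t: "t \<in> A' \<rightarrow>\<^sub>E UNIV"
      \<comment> \<open>Transports the prescribed values to edges of \<open>B\<close>: in the
        translate by \<open>y\<close>, an edge at the coset \<open>C\<close> is seen from the unique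
        window point over \<open>C\<close>.\<close>
      define t' where "t' = (\<lambda>(C, s). t (THE x. x \<in> E \<and> coset M (y + x) = C, s))"
      obtain c where c: "\<forall>x\<in>N. \<forall>s. (coset M x, s) \<in> B \<longrightarrow> pot c (x + s) + pot c x = t' (coset M x, s)"
        using B(3) by blast
      define v where "v = (\<lambda>x\<in>?V. pot c (y + x))"
      have "?\<Phi> v = t"
      proof
        fix e
        show "?\<Phi> v e = t e"
        proof (cases "e \<in> A'")
          case True
          obtain x s where e: "e = (x, s)"
            by (cases e)
          then have xs: "x \<in> E" "(coset M (y + x), s) \<in> B"
            using True A' by (auto simp: A_def)
          then have yx: "y + x \<in> N"
            using E(2) y Y_sub by (intro fin_normalD(2)[OF N]) auto
          have "(THE z. z \<in> E \<and> coset M (y + z) = coset M (y + x)) = x"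
            using xs(1) sep coset_add_left[OF M(1)] by (intro the_equality) auto
          then have "pot c (y + x + s) + pot c (y + x) = t (x, s)"
            using c xs(2) yx by (simp add: t'_def)
          moreover have "x \<in> ?V" "x + s \<in> ?V"
            using True e by force+
          ultimately show ?thesis
            using True e by (simp add: v_def add.assoc)
        next
          case False
          then show ?thesis
            using PiE_arb[OF t False] by simp
        qed
      qed
      then show "t \<in> ?\<Phi> ` (?V \<rightarrow>\<^sub>E UNIV)"
        by (intro image_eqI[of _ _ v]) (auto simp: v_def)
    qed
    moreover have "finite (?V \<rightarrow>\<^sub>E (UNIV :: bit set))"
      using fin by (intro finite_PiE) auto
    ultimately have "card (A' \<rightarrow>\<^sub>E (UNIV :: bit set)) \<le> card (?V \<rightarrow>\<^sub>E (UNIV :: bit set))"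
      by (meson card_image_le card_mono finite_imageI le_trans)
    then have "(2::nat) ^ card A' \<le> 2 ^ card ?V"
      using fin by (simp only: card_PiE card_UNIV_bit prod_constant)
    then show ?thesis
      by (simp only: power_increasing_iff)
  qed
  have "\<exists>out. \<forall>v. card {e\<in>A y. out e \<and> fst e = v} \<le> 2 \<and>
      card {e\<in>A y. \<not> out e \<and> (\<lambda>(x, s). x + s) e = v} \<le> 2" if "y \<in> Y" for y
    using finA sparse[OF that] by (rule orientation)
  then have "\<forall>y\<in>Y. \<exists>out. \<forall>v. card {e\<in>A y. out e \<and> fst e = v} \<le> 2 \<and>
      card {e\<in>A y. \<not> out e \<and> (\<lambda>(x, s). x + s) e = v} \<le> 2"
    by blast
  from bchoice[OF this] obtain out where out: "\<And>y v. y \<in> Y \<Longrightarrow> card {e\<in>A y. out y e \<and> fst e = v} \<le> 2"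
    "\<And>y v. y \<in> Y \<Longrightarrow> card {e\<in>A y. \<not> out y e \<and> (\<lambda>(x, s). x + s) e = v} \<le> 2"
    by blast
  define f where "f s = card {C\<in>?P. (C, s) \<in> B} / m" for s
  define a where "a x s = card {y\<in>Y. (x, s) \<in> A y \<and> out y (x, s)} / m" for x s
  define b where "b x s = card {y\<in>Y. (x, s) \<in> A y \<and> \<not> out y (x, s)} / m" for x s
  have frac: "0 \<le> card {y\<in>Y. Q y} / m \<and> card {y\<in>Y. Q y} / m \<le> (1 :: real)" for Q
    using m_pos finY by (auto simp: m_def intro: card_mono)
  have avg: "(\<Sum>s\<in>?S. card {y\<in>Y. Q y s} / m) \<le> (2 :: real)"
    if "\<And>y. y \<in> Y \<Longrightarrow> card {s\<in>?S. Q y s} \<le> 2" for Q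
  proof -
    have "(\<Sum>s\<in>?S. card {y\<in>Y. Q y s}) = (\<Sum>y\<in>Y. card {s\<in>?S. Q y s})"
      using sum.swap_restrict[OF finS finY, of "\<lambda>_ _. 1 :: nat" "\<lambda>s y. Q y s"] by simp
    also have "\<dots> \<le> (\<Sum>y\<in>Y. 2)"
      using that by (rule sum_mono)
    finally have "(\<Sum>s\<in>?S. card {y\<in>Y. Q y s}) \<le> 2 * m"
      by (simp add: m_def)
    then have "real (\<Sum>s\<in>?S. card {y\<in>Y. Q y s}) \<le> 2 * real m"
      by (metis of_nat_le_iff of_nat_mult of_nat_numeral)
    then show ?thesis
      using m_pos by (simp add: sum_divide_distrib[symmetric] divide_le_eq)
  qed
  have row: "(\<Sum>s\<in>?S. a x s) \<le> 2" for x
    unfolding a_def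
  proof (rule avg)
    fix y assume y: "y \<in> Y"
    have "card {s\<in>?S. (x, s) \<in> A y \<and> out y (x, s)} \<le> card {e\<in>A y. out y e \<and> fst e = x}"
      by (rule card_inj_on_le[of "Pair x"]) (use finA in \<open>auto simp: inj_on_def\<close>)
    then show "card {s\<in>?S. (x, s) \<in> A y \<and> out y (x, s)} \<le> 2"
      using out(1)[OF y, of x] by linarith
  qed
  have col: "(\<Sum>s\<in>?S. b (z - s) s) \<le> 2" for z
    unfolding b_def
  proof (rule avg)
    fix y assume y: "y \<in> Y"
    have "card {s\<in>?S. (z - s, s) \<in> A y \<and> \<not> out y (z - s, s)} \<le>
        card {e\<in>A y. \<not> out y e \<and> (\<lambda>(x, s). x + s) e = z}"
      by (rule card_inj_on_le[of "\<lambda>s. (z - s, s)"]) (use finA in \<open>auto simp: inj_on_def\<close>)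
    then show "card {s\<in>?S. (z - s, s) \<in> A y \<and> \<not> out y (z - s, s)} \<le> 2"
      using out(2)[OF y, of z] by linarith
  qed
  have total: "a x s + b x s = f s" if "x \<in> E" "s \<in> ?S" "x + s \<in> E" for x s
  proof -
    have bij: "bij_betw (\<lambda>y. coset M (y + x)) Y ?P"
      using transl that(1) E(2) by blast
    have "bij_betw (\<lambda>y. coset M (y + x)) {y\<in>Y. (coset M (y + x), s) \<in> B} {C\<in>?P. (C, s) \<in> B}"
      unfolding bij_betw_def
    proof
      show "inj_on (\<lambda>y. coset M (y + x)) {y\<in>Y. (coset M (y + x), s) \<in> B}"
        by (rule inj_on_subset[OF bij_betw_imp_inj_on[OF bij]]) blast
      show "(\<lambda>y. coset M (y + x)) ` {y\<in>Y. (coset M (y + x), s) \<in> B} = {C\<in>?P. (C, s) \<in> B}"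
        unfolding bij_betw_imp_surj_on[OF bij, symmetric] by blast
    qed
    then have "card {C\<in>?P. (C, s) \<in> B} = card {y\<in>Y. (coset M (y + x), s) \<in> B}"
      by (rule bij_betw_same_card[symmetric])
    also have "{y\<in>Y. (coset M (y + x), s) \<in> B} =
        {y\<in>Y. (x, s) \<in> A y \<and> out y (x, s)} \<union> {y\<in>Y. (x, s) \<in> A y \<and> \<not> out y (x, s)}"
      using that by (auto simp: A_def)
    also have "card \<dots> = card {y\<in>Y. (x, s) \<in> A y \<and> out y (x, s)} +
        card {y\<in>Y. (x, s) \<in> A y \<and> \<not> out y (x, s)}"
      by (rule card_Un_disjoint) (use finY in auto)
    finally show ?thesis
      by (simp add: a_def b_def f_def add_divide_distrib)
  qed
  have large: "card (range (coset N)) / 2 \<le> sum f ?S"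
  proof -
    let ?Q = "range (coset N)"
    \<comment> \<open>Representatives embed pairs of cosets into the cosets of \<open>M\<close>.
      This half of the multiplicativity of the index bounds \<open>card B / m\<close> from
      below.\<close>
    let ?g = "\<lambda>(C, D). coset M (inv_into N (coset M) C + inv_into UNIV (coset N) D)"
    have "inj_on ?g (?P \<times> ?Q)"
    proof (rule inj_onI, clarify)
      fix x u y w
      assume xy: "x \<in> N" "y \<in> N"
        and eq: "coset M (inv_into N (coset M) (coset M x) + inv_into UNIV (coset N) (coset N u)) =
          coset M (inv_into N (coset M) (coset M y) + inv_into UNIV (coset N) (coset N w))"
      let ?x = "inv_into N (coset M) (coset M x)" and ?y = "inv_into N (coset M) (coset M y)"
      let ?u = "inv_into UNIV (coset N) (coset N u)" and ?w = "inv_into UNIV (coset N) (coset N w)"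
      have x: "?x \<in> N" "coset M ?x = coset M x" and y: "?y \<in> N" "coset M ?y = coset M y"
        using xy by (auto intro: inv_into_into simp: f_inv_into_f)
      have u: "coset N ?u = coset N u" and w: "coset N ?w = coset N w"
        by (auto simp: f_inv_into_f)
      have "coset N (z + v) = coset N v" if "z \<in> N" for z v
        using coset_add_right[OF N, of z v 0] coset_eq_iff[OF N, of z 0] that fin_normalD(3)[OF N]
        by simp
      then have "coset N (?x + ?u) = coset N ?u" "coset N (?y + ?w) = coset N ?w"
        using x y by auto
      moreover have "coset N (?x + ?u) = coset N (?y + ?w)"
        using eq M(2) by (auto simp: coset_eq_iff[OF M(1)] coset_eq_iff[OF N])
      ultimately have uw: "coset N u = coset N w"
        using u w by simp
      then have "coset M ?x = coset M ?y"
        using eq coset_add_right[OF M(1)] by simp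
      then show "coset M x = coset M y \<and> coset N u = coset N w"
        using x y uw by simp
    qed
    then have "card (?P \<times> ?Q) \<le> card (range (coset M))"
      by (rule card_inj_on_le) (use fin_normalD(5)[OF M(1)] in auto)
    then have "m * card ?Q \<le> 2 * card B"
      using B(2) by (simp add: card_cartesian_product m_card)
    moreover have "card B = (\<Sum>s\<in>?S. card {C\<in>?P. (C, s) \<in> B})"
    proof -
      have "B = (\<lambda>(s, C). (C, s)) ` (SIGMA s:?S. {C\<in>?P. (C, s) \<in> B})"
        using B(1) by auto
      also have "card \<dots> = card (SIGMA s:?S. {C\<in>?P. (C, s) \<in> B})"
        by (rule card_image) (auto simp: inj_on_def)
      also have "\<dots> = (\<Sum>s\<in>?S. card {C\<in>?P. (C, s) \<in> B})"
        by (rule card_SigmaI) (use finS finP in auto)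
      finally show ?thesis .
    qed
    ultimately have "real (m * card ?Q) \<le> real (2 * (\<Sum>s\<in>?S. card {C\<in>?P. (C, s) \<in> B}))"
      by (metis of_nat_le_iff)
    then show ?thesis
      using m_pos by (simp add: f_def sum_divide_distrib[symmetric] field_simps)
  qed
  show ?thesis
    by (rule that[OF large _ _ total row col]) (simp_all add: a_def b_def frac)
qed

section \<open>Passage to the limit over exhausting windows\<close>

lemma compact_unit_cube: "compact (UNIV \<rightarrow>\<^sub>E {0..1::real} :: ('i \<Rightarrow> real) set)"
proof -
  have "compactin (product_topology (\<lambda>_. euclidean) UNIV) (UNIV \<rightarrow>\<^sub>E {0..1::real} :: ('i \<Rightarrow> real) set)"
    unfolding compactin_PiE by simp
  then show ?thesis
    by (simp add: euclidean_product_topology)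
qed

text \<open>The kernels for windows exhausting \<open>N\<close> lie in a cube with countably many
  coordinates, so a subsequence converges pointwise. Each condition involves finitely many
  coordinates and survives.\<close>

lemma littlewood_subgroup:
  assumes N: "fin_normal (N :: tgrp set)"
  obtains f :: "tgrp \<Rightarrow> real" and a b :: "tgrp \<Rightarrow> tgrp \<Rightarrow> real"
  where "card (range (coset N)) / 2 \<le> sum f (schreier N)"
    "\<And>x s. 0 \<le> a x s" "\<And>x s. 0 \<le> b x s"
    "\<And>x s. x \<in> N \<Longrightarrow> s \<in> schreier N \<Longrightarrow> a x s + b x s = f s"
    "\<And>x. (\<Sum>s\<in>schreier N. a x s) \<le> 2" "\<And>z. (\<Sum>s\<in>schreier N. b (z - s) s) \<le> 2"
proof -
  let ?S = "schreier N"
  define E where "E k = {x\<in>N. to_nat x < k}" for k :: nat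
  have finE: "finite (E k)" for k
  proof -
    have "E k \<subseteq> to_nat -` {..<k}"
      by (auto simp: E_def)
    then show ?thesis
      by (rule finite_subset) (simp add: finite_vimageI)
  qed
  define P where "P k f a b \<longleftrightarrow> card (range (coset N)) / 2 \<le> sum f ?S \<and>
    (\<forall>x s. 0 \<le> a x s \<and> a x s \<le> (1::real)) \<and> (\<forall>x s. 0 \<le> b x s \<and> b x s \<le> (1::real)) \<and>
    (\<forall>x s. x \<in> E k \<longrightarrow> s \<in> ?S \<longrightarrow> x + s \<in> E k \<longrightarrow> a x s + b x s = f s) \<and>
    (\<forall>x. (\<Sum>s\<in>?S. a x s) \<le> 2) \<and> (\<forall>z. (\<Sum>s\<in>?S. b (z - s) s) \<le> 2)" for k f a b
  have "\<exists>f a b. P k f a b" for k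
  proof -
    have "finite ((\<lambda>(x, y). - x + y) ` (E k \<times> E k) - {0})"
      using finE by auto
    then obtain M where M: "fin_normal M" "M \<subseteq> N"
      "M \<inter> ((\<lambda>(x, y). - x + y) ` (E k \<times> E k) - {0}) = {}"
      using tgrp_separate[of "(\<lambda>(x, y). - x + y) ` (E k \<times> E k) - {0}" N] N by auto
    have sep: "x = y" if xy: "x \<in> E k" "y \<in> E k" and "coset M x = coset M y" for x y
    proof -
      have "- x + y \<in> M"
        using that coset_eq_iff[OF M(1)] by blast
      then have "- x + y = 0"
        using M(3) xy by force
      then show ?thesis
        by (metis add.right_neutral add_minus_cancel)
    qed
    have "E k \<subseteq> N"
      by (auto simp: E_def)
    obtain f a b where "card (range (coset N)) / 2 \<le> sum f ?S"
      "\<And>x s. 0 \<le> a x s \<and> a x s \<le> (1::real)" "\<And>x s. 0 \<le> b x s \<and> b x s \<le> (1::real)"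
      "\<And>x s. x \<in> E k \<Longrightarrow> s \<in> ?S \<Longrightarrow> x + s \<in> E k \<Longrightarrow> a x s + b x s = f s"
      "\<And>x. (\<Sum>s\<in>?S. a x s) \<le> 2" "\<And>z. (\<Sum>s\<in>?S. b (z - s) s) \<le> 2"
      by (rule average_window[OF N M(1,2) finE \<open>E k \<subseteq> N\<close> sep]) blast+
    then have "P k f a b"
      unfolding P_def by blast
    then show ?thesis
      by blast
  qed
  then have "\<forall>k. \<exists>t. P k (fst t) (fst (snd t)) (snd (snd t))"
    by simp
  from choice[OF this] obtain t where t: "\<forall>k. P k (fst (t k)) (fst (snd (t k))) (snd (snd (t k)))"
    by blast
  define f a b where "f k = fst (t k)" and "a k = fst (snd (t k))" and "b k = snd (snd (t k))" for k
  have "P k (f k) (a k) (b k)" for k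
    using t by (simp add: f_def a_def b_def)
  then have F: "\<And>k. card (range (coset N)) / 2 \<le> sum (f k) ?S"
    "\<And>k x s. 0 \<le> a k x s \<and> a k x s \<le> (1::real)" "\<And>k x s. 0 \<le> b k x s \<and> b k x s \<le> (1::real)"
    "\<And>k x s. x \<in> E k \<Longrightarrow> s \<in> ?S \<Longrightarrow> x + s \<in> E k \<Longrightarrow> a k x s + b k x s = f k s"
    "\<And>k x. (\<Sum>s\<in>?S. a k x s) \<le> 2" "\<And>k z. (\<Sum>s\<in>?S. b k (z - s) s) \<le> 2"
    unfolding P_def by blast+
  define G where "G k = (\<lambda>(c, x, s). if c then a k x s else b k x s)" for k
  have "G k \<in> UNIV \<rightarrow>\<^sub>E {0..1}" for k
    using F(2,3) by (auto simp: G_def PiE_def extensional_def)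
  then obtain l r where l: "strict_mono r" "(G \<circ> r) \<longlonglongrightarrow> l"
    using compact_imp_seq_compact[OF compact_unit_cube] unfolding seq_compact_def by metis
  have coord: "(\<lambda>k. G (r k) i) \<longlonglongrightarrow> l i" for i
    using continuous_on_tendsto_compose[OF continuous_on_product_coordinates[of i] l(2)]
    by (simp add: o_def)
  define a' where "a' x s = l (True, x, s)" for x s
  define b' where "b' x s = l (False, x, s)" for x s
  have a': "(\<lambda>k. a (r k) x s) \<longlonglongrightarrow> a' x s" for x s
    using coord[of "(True, x, s)"] by (simp add: G_def a'_def)
  have b': "(\<lambda>k. b (r k) x s) \<longlonglongrightarrow> b' x s" for x s
    using coord[of "(False, x, s)"] by (simp add: G_def b'_def)
  \<comment> \<open>For fixed \<open>s\<close> the density eventually equals \<open>a + b\<close> at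
    any given point of \<open>N\<close>, so all points have the same limit and 0 may serve.\<close>
  define f' where "f' s = a' 0 s + b' 0 s" for s
  have ev_f: "\<forall>\<^sub>F k in sequentially. f (r k) s = a (r k) x s + b (r k) x s"
    if x: "x \<in> N" and s: "s \<in> ?S" for x s
  proof -
    have "x + s \<in> N"
      using x s schreier_subset[OF N] fin_normalD(2)[OF N] by blast
    have "\<forall>\<^sub>F k in sequentially. k > max (to_nat x) (to_nat (x + s))"
      by (rule eventually_gt_at_top)
    then show ?thesis
    proof eventually_elim
      case (elim k)
      have "k \<le> r k"
        using l(1) by (rule seq_suble)
      then have "x \<in> E (r k)" "x + s \<in> E (r k)"
        using elim x \<open>x + s \<in> N\<close> by (auto simp: E_def)
      then show ?case
        using F(4)[of x "r k" s] s by simp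
    qed
  qed
  have lim_f: "(\<lambda>k. f (r k) s) \<longlonglongrightarrow> a' x s + b' x s" if "x \<in> N" "s \<in> ?S" for x s
    using Lim_transform_eventually[OF tendsto_add[OF a' b'], of x s x s "\<lambda>k. f (r k) s"]
      ev_f[OF that] by (simp add: eq_commute)
  have zero: "0 \<in> N"
    by (rule fin_normalD(1)[OF N])
  have lim_f': "(\<lambda>k. f (r k) s) \<longlonglongrightarrow> f' s" if "s \<in> ?S" for s
    using lim_f[OF zero that] by (simp add: f'_def)
  show ?thesis
  proof (rule that[of f' a' b'])
    have "(\<lambda>k. sum (f (r k)) ?S) \<longlonglongrightarrow> sum f' ?S"
      using lim_f' by (rule tendsto_sum)
    then show "card (range (coset N)) / 2 \<le> sum f' ?S"
      by (rule LIMSEQ_le_const) (use F(1) in auto)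
    show "0 \<le> a' x s" for x s
      by (rule LIMSEQ_le_const[OF a']) (use F(2) in auto)
    show "0 \<le> b' x s" for x s
      by (rule LIMSEQ_le_const[OF b']) (use F(3) in auto)
    show "a' x s + b' x s = f' s" if "x \<in> N" "s \<in> ?S" for x s
      using lim_f[OF that] lim_f'[OF that(2)] by (rule LIMSEQ_unique)
    show "(\<Sum>s\<in>?S. a' x s) \<le> 2" for x
    proof (rule LIMSEQ_le_const2)
      show "(\<lambda>k. \<Sum>s\<in>?S. a (r k) x s) \<longlonglongrightarrow> (\<Sum>s\<in>?S. a' x s)"
        by (intro tendsto_sum a')
    qed (use F(5) in auto)
    show "(\<Sum>s\<in>?S. b' (z - s) s) \<le> 2" for z
    proof (rule LIMSEQ_le_const2)
      show "(\<lambda>k. \<Sum>s\<in>?S. b (r k) (z - s) s) \<longlonglongrightarrow> (\<Sum>s\<in>?S. b' (z - s) s)"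
        by (intro tendsto_sum b')
    qed (use F(6) in auto)
  qed
qed

text \<open>Every left coset of \<open>N\<close> gets a copy of the kernels, read through the
  \<open>N\<close>-part \<open>- srep N x + x\<close>; as the steps lie in \<open>N\<close>, rows
  and columns stay inside a coset. A sum of at least \<open>n / 2\<close> over at most
  \<open>2 n\<close> steps has square sum at least \<open>n / 8\<close> by Cauchy-Schwarz, whence
  the factor 8.\<close>

lemma littlewood_unbounded:
  fixes K :: real
  obtains S :: "tgrp set" and f :: "tgrp \<Rightarrow> real" and a b :: "tgrp \<Rightarrow> tgrp \<Rightarrow> real"
  where "finite S" "\<And>x s. 0 \<le> a x s" "\<And>x s. 0 \<le> b x s"
    "\<And>x s. s \<in> S \<Longrightarrow> a x s + b x s = f s"
    "\<And>x. (\<Sum>s\<in>S. a x s) \<le> 2" "\<And>z. (\<Sum>s\<in>S. b (z - s) s) \<le> 2"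
    "K \<le> (\<Sum>s\<in>S. (f s)\<^sup>2)"
proof -
  obtain k :: nat where k: "8 * K \<le> real k"
    using real_arch_simple by blast
  obtain N :: "tgrp set" where N: "fin_normal N" "Suc k \<le> card (range (coset N))"
    using fin_normal_index_unbounded by blast
  let ?S = "schreier N" and ?n = "card (range (coset N))"
  obtain f a b where F: "?n / 2 \<le> sum f ?S" "\<And>x s. 0 \<le> a x s" "\<And>x s. 0 \<le> b x s"
    "\<And>x s. x \<in> N \<Longrightarrow> s \<in> ?S \<Longrightarrow> a x s + b x s = f s"
    "\<And>x. (\<Sum>s\<in>?S. a x s) \<le> (2::real)" "\<And>z. (\<Sum>s\<in>?S. b (z - s) s) \<le> (2::real)"
    by (rule littlewood_subgroup[OF N(1)]) blast
  note S = finite_schreier[OF N(1)]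
  have in_N: "- srep N x + x \<in> N" for x
    using coset_srep[of N x] coset_eq_iff[OF N(1)] by blast
  show ?thesis
  proof (rule that[of ?S "\<lambda>x s. a (- srep N x + x) s" "\<lambda>x s. b (- srep N x + x) s" f])
    show "a (- srep N x + x) s + b (- srep N x + x) s = f s" if "s \<in> ?S" for x s
      using F(4) in_N that by blast
    show "(\<Sum>s\<in>?S. b (- srep N (z - s) + (z - s)) s) \<le> 2" for z
    proof -
      have "- srep N (z - s) + (z - s) = (- srep N z + z) - s" if "s \<in> ?S" for s
      proof -
        have "coset N (z - s) = coset N z"
          using that schreier_subset[OF N(1)] by (auto simp: coset_eq_iff[OF N(1)] minus_diff_eq add.assoc diff_add_eq)
        then have "srep N (z - s) = srep N z"
          by (rule srep_cong)
        then show ?thesis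
          by (simp add: add_diff_eq)
      qed
      then show ?thesis
        using F(6)[of "- srep N z + z"] by simp
    qed
    have "real ?n / 2 * (real ?n / 2) \<le> sum f ?S * sum f ?S"
      using F(1) by (intro mult_mono) auto
    also have "\<dots> = (\<Sum>s\<in>?S. f s * 1)\<^sup>2"
      by (simp add: power2_eq_square)
    also have "\<dots> \<le> (\<Sum>s\<in>?S. (f s)\<^sup>2) * (\<Sum>s\<in>?S. 1\<^sup>2)"
      by (rule Cauchy_Schwarz_ineq_sum)
    also have "\<dots> \<le> (\<Sum>s\<in>?S. (f s)\<^sup>2) * (2 * real ?n)"
    proof (rule mult_left_mono)
      show "(\<Sum>s\<in>?S. 1\<^sup>2) \<le> 2 * real ?n"
        using S(2) by simp
    qed (simp add: sum_nonneg)
    finally have "real ?n * (real ?n / 8) \<le> real ?n * (\<Sum>s\<in>?S. (f s)\<^sup>2)"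
      by (simp add: field_simps)
    moreover have "0 < real ?n"
      using N(2) by simp
    ultimately have "real ?n / 8 \<le> (\<Sum>s\<in>?S. (f s)\<^sup>2)"
      using mult_le_cancel_left_pos by blast
    then show "K \<le> (\<Sum>s\<in>?S. (f s)\<^sup>2)"
      using k N(2) by linarith
  qed (use S F in auto)
qed

section \<open>Square-summable families and invariant forms\<close>

definition l2 :: "('i \<Rightarrow> complex) set" where
  "l2 = {v. (\<lambda>i. (cmod (v i))\<^sup>2) summable_on UNIV}"

definition lsq :: "('i \<Rightarrow> complex) \<Rightarrow> real" where
  "lsq v = (\<Sum>\<^sub>\<infinity>i. (cmod (v i))\<^sup>2)"

definition scl :: "complex \<Rightarrow> ('i \<Rightarrow> complex) \<Rightarrow> 'i \<Rightarrow> complex" where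
  "scl a v = (\<lambda>i. a * v i)"

lemma l2_summable: "v \<in> l2 \<Longrightarrow> (\<lambda>i. (cmod (v i))\<^sup>2) summable_on UNIV"
  by (simp add: l2_def)

lemma l2_bound:
  assumes "\<And>A. finite A \<Longrightarrow> (\<Sum>i\<in>A. (cmod (v i))\<^sup>2) \<le> C"
  shows "v \<in> l2" "lsq v \<le> C"
proof -
  have "(\<lambda>i. (cmod (v i))\<^sup>2) summable_on UNIV"
    by (rule nonneg_bdd_above_summable_on) (use assms in \<open>auto simp: bdd_above_def\<close>)
  then show "v \<in> l2" "lsq v \<le> C"
    using assms unfolding l2_def lsq_def by (auto intro!: infsum_le_finite_sums)
qed

lemma l2_sum_le:
  assumes "v \<in> l2" "finite A"
  shows "(\<Sum>i\<in>A. (cmod (v i))\<^sup>2) \<le> lsq v"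
  unfolding lsq_def by (rule finite_sum_le_infsum) (use assms l2_summable in auto)

lemma lsq_nonneg: "0 \<le> lsq v"
  unfolding lsq_def by (rule infsum_nonneg) simp

lemma l2_coord_le: "v \<in> l2 \<Longrightarrow> (cmod (v i))\<^sup>2 \<le> lsq v"
  using l2_sum_le[of v "{i}"] by simp

lemma cmod_add_sq_le: "(cmod (x + y))\<^sup>2 \<le> 2 * (cmod x)\<^sup>2 + 2 * (cmod y)\<^sup>2"
proof -
  have "(cmod (x + y))\<^sup>2 \<le> (cmod x + cmod y)\<^sup>2"
    by (intro power_mono norm_triangle_ineq) simp
  also have "\<dots> \<le> 2 * (cmod x)\<^sup>2 + 2 * (cmod y)\<^sup>2"
    using sum_squares_bound[of "cmod x" "cmod y"] by (simp add: power2_sum)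
  finally show ?thesis .
qed

lemma l2_add_bound:
  assumes "u \<in> l2" "v \<in> l2"
  shows "u + v \<in> l2" "lsq (u + v) \<le> 2 * lsq u + 2 * lsq v"
proof -
  have "(\<Sum>i\<in>A. (cmod ((u + v) i))\<^sup>2) \<le> 2 * lsq u + 2 * lsq v" if "finite A" for A
  proof -
    have "(\<Sum>i\<in>A. (cmod ((u + v) i))\<^sup>2) \<le> (\<Sum>i\<in>A. 2 * (cmod (u i))\<^sup>2 + 2 * (cmod (v i))\<^sup>2)"
      by (rule sum_mono) (simp add: cmod_add_sq_le)
    also have "\<dots> = 2 * (\<Sum>i\<in>A. (cmod (u i))\<^sup>2) + 2 * (\<Sum>i\<in>A. (cmod (v i))\<^sup>2)"
      by (simp add: sum.distrib sum_distrib_left)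
    finally show ?thesis
      using l2_sum_le[OF assms(1) that] l2_sum_le[OF assms(2) that] by linarith
  qed
  from l2_bound[OF this] show "u + v \<in> l2" "lsq (u + v) \<le> 2 * lsq u + 2 * lsq v"
    by blast+
qed

lemma l2_scl:
  assumes "v \<in> l2"
  shows "scl a v \<in> l2" "lsq (scl a v) = (cmod a)\<^sup>2 * lsq v"
  using assms
  by (auto simp: l2_def lsq_def scl_def norm_mult power_mult_distrib
      intro: summable_on_cmult_right infsum_cmult_right)

lemma l2_zero [simp]: "0 \<in> l2"
  by (simp add: l2_def)

lemma scl_minus_one: "scl (- 1) v = - v"
  by (auto simp: scl_def)

lemma l2_minus: "v \<in> l2 \<Longrightarrow> - v \<in> l2"
  using l2_scl(1)[of v "- 1"] by (simp add: scl_minus_one)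

lemma l2_diff: "u \<in> l2 \<Longrightarrow> v \<in> l2 \<Longrightarrow> u - v \<in> l2"
  using l2_add_bound(1)[of u "- v"] by (simp add: l2_minus)

lemma lsq_eq_0:
  assumes "v \<in> l2" "lsq v \<le> 0"
  shows "v = 0"
proof
  fix i
  have "(cmod (v i))\<^sup>2 \<le> 0"
    using l2_coord_le[OF assms(1), of i] assms(2) by linarith
  then show "v i = 0 i"
    by simp
qed

text \<open>Coordinatewise convergence is part of the conclusion because it shows at once that
  subspaces given by vanishing coordinates are closed.\<close>

lemma l2_complete:
  assumes X: "\<And>n :: nat. X n \<in> l2"
    and Cauchy: "\<And>e. 0 < e \<Longrightarrow> \<exists>N. \<forall>m\<ge>N. \<forall>n\<ge>N. lsq (X m - X n) < e"
  obtains l where "l \<in> l2" "(\<lambda>n. lsq (X n - l)) \<longlonglongrightarrow> 0" "\<And>i. (\<lambda>n. X n i) \<longlonglongrightarrow> l i"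
proof -
  have "Cauchy (\<lambda>n. X n i)" for i
  proof (rule CauchyI)
    fix e :: real assume "0 < e"
    then obtain N where N: "\<forall>m\<ge>N. \<forall>n\<ge>N. lsq (X m - X n) < e\<^sup>2"
      using Cauchy[of "e\<^sup>2"] by auto
    have "cmod (X m i - X n i) < e" if "m \<ge> N" "n \<ge> N" for m n
    proof -
      have "(cmod (X m i - X n i))\<^sup>2 < e\<^sup>2"
        using l2_coord_le[OF l2_diff[OF X X], of m n i] N that by fastforce
      then show ?thesis
        using \<open>0 < e\<close> by (simp add: power2_less_imp_less)
    qed
    then show "\<exists>M. \<forall>m\<ge>M. \<forall>n\<ge>M. norm (X m i - X n i) < e"
      by blast
  qed
  then have "\<forall>i. \<exists>l. (\<lambda>n. X n i) \<longlonglongrightarrow> l"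
    by (simp add: Cauchy_convergent_iff convergent_def)
  from choice[OF this] obtain l where l: "\<And>i. (\<lambda>n. X n i) \<longlonglongrightarrow> l i"
    by blast
  have close: "X n - l \<in> l2 \<and> lsq (X n - l) \<le> e"
    if N: "\<forall>m\<ge>N. \<forall>n\<ge>N. lsq (X m - X n) < e" and n: "n \<ge> N" for e N n
  proof -
    have "(\<Sum>i\<in>A. (cmod ((X n - l) i))\<^sup>2) \<le> e" if "finite A" for A
    proof (rule LIMSEQ_le_const2)
      show "(\<lambda>m. \<Sum>i\<in>A. (cmod (X n i - X m i))\<^sup>2) \<longlonglongrightarrow> (\<Sum>i\<in>A. (cmod ((X n - l) i))\<^sup>2)"
        unfolding minus_apply by (intro tendsto_intros l)
      have "(\<Sum>i\<in>A. (cmod (X n i - X m i))\<^sup>2) \<le> e" if "m \<ge> N" for m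
        using l2_sum_le[OF l2_diff[OF X X] \<open>finite A\<close>, of n m] N n that by fastforce
      then show "\<exists>M. \<forall>m\<ge>M. (\<Sum>i\<in>A. (cmod (X n i - X m i))\<^sup>2) \<le> e"
        by blast
    qed
    then show ?thesis
      using l2_bound by blast
  qed
  obtain N where "\<forall>m\<ge>N. \<forall>n\<ge>N. lsq (X m - X n) < 1"
    using Cauchy[of 1] by auto
  then have "X N - l \<in> l2"
    using close by blast
  then have "X N - (X N - l) \<in> l2"
    by (rule l2_diff[OF X])
  also have "X N - (X N - l) = l"
    by (simp add: fun_eq_iff)
  finally have "l \<in> l2" .
  moreover have "(\<lambda>n. lsq (X n - l)) \<longlonglongrightarrow> 0"
  proof (rule LIMSEQ_I)
    fix e :: real assume "0 < e"
    then obtain N where N: "\<forall>m\<ge>N. \<forall>n\<ge>N. lsq (X m - X n) < e / 2"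
      using Cauchy[of "e / 2"] by auto
    have "norm (lsq (X n - l) - 0) < e" if "n \<ge> N" for n
      using close[OF N that] \<open>0 < e\<close> lsq_nonneg[of "X n - l"] by simp
    then show "\<exists>N. \<forall>n\<ge>N. norm (lsq (X n - l) - 0) < e"
      by blast
  qed
  ultimately show ?thesis
    using that l by blast
qed

definition ip :: "('i \<Rightarrow> complex) \<Rightarrow> ('i \<Rightarrow> complex) \<Rightarrow> complex" where
  "ip u v = (\<Sum>\<^sub>\<infinity>i. u i * cnj (v i))"

lemma ip_summable:
  assumes "u \<in> l2" "v \<in> l2"
  shows "(\<lambda>i. u i * cnj (v i)) summable_on UNIV"
proof -
  have "(\<lambda>i. norm (u i * cnj (v i))) summable_on UNIV"
  proof (rule nonneg_bdd_above_summable_on)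
    have "(\<Sum>i\<in>A. norm (u i * cnj (v i))) \<le> lsq u + lsq v" if "finite A" for A
    proof -
      have "(\<Sum>i\<in>A. norm (u i * cnj (v i))) \<le> (\<Sum>i\<in>A. (cmod (u i))\<^sup>2 + (cmod (v i))\<^sup>2)"
      proof (rule sum_mono)
        fix i
        have "2 * cmod (u i) * cmod (v i) \<le> (cmod (u i))\<^sup>2 + (cmod (v i))\<^sup>2"
          by (rule sum_squares_bound)
        moreover have "0 \<le> cmod (u i) * cmod (v i)"
          by simp
        ultimately show "norm (u i * cnj (v i)) \<le> (cmod (u i))\<^sup>2 + (cmod (v i))\<^sup>2"
          unfolding norm_mult complex_mod_cnj by linarith
      qed
      then show ?thesis
        using l2_sum_le[OF assms(1) that] l2_sum_le[OF assms(2) that] by (simp add: sum.distrib)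
    qed
    then show "bdd_above (sum (\<lambda>i. norm (u i * cnj (v i))) ` {F. F \<subseteq> UNIV \<and> finite F})"
      by (auto simp: bdd_above_def)
  qed simp
  then show ?thesis
    by (rule abs_summable_summable)
qed

lemma ip_add_left: "u \<in> l2 \<Longrightarrow> v \<in> l2 \<Longrightarrow> w \<in> l2 \<Longrightarrow> ip (u + v) w = ip u w + ip v w"
  unfolding ip_def plus_fun_apply distrib_right by (intro infsum_add ip_summable)

lemma ip_scl_left: "u \<in> l2 \<Longrightarrow> v \<in> l2 \<Longrightarrow> ip (scl a u) v = a * ip u v"
  unfolding ip_def scl_def mult.assoc by (intro infsum_cmult_right ip_summable)

lemma ip_commute: "ip v u = cnj (ip u v)"
  unfolding ip_def infsum_cnj[symmetric] by (simp add: mult.commute)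

lemma Re_ip_self: "v \<in> l2 \<Longrightarrow> Re (ip v v) = lsq v"
proof -
  assume "v \<in> l2"
  have "ip v v = (\<Sum>\<^sub>\<infinity>i. complex_of_real ((cmod (v i))\<^sup>2))"
    unfolding ip_def by (simp only: complex_norm_square)
  also have "\<dots> = complex_of_real (lsq v)"
    using has_sum_infsum[OF l2_summable[OF \<open>v \<in> l2\<close>]] unfolding lsq_def
    by (intro infsumI) (rule has_sum_of_real_iff[THEN iffD2])
  finally show ?thesis
    by simp
qed

section \<open>Orthogonal projection for a form equivalent to the norm\<close>

text \<open>The copy that receives the off-diagonal block of the representation; it is the invariant
  subspace whose complement is at stake.\<close>

definition first_part :: "(bool \<times> 'k \<Rightarrow> complex) set" where
  "first_part = {w\<in>l2. \<forall>k. w (False, k) = 0}"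

text \<open>
  The form \<open>B\<close> plays the role of the inner product that makes a representation unitary.
  Orthogonality with respect to \<open>B\<close> is only used over the reals.
\<close>

locale equivalent_form =
  fixes B :: "(bool \<times> 'k \<Rightarrow> complex) \<Rightarrow> (bool \<times> 'k \<Rightarrow> complex) \<Rightarrow> real" and C :: real
  assumes B_commute: "u \<in> l2 \<Longrightarrow> v \<in> l2 \<Longrightarrow> B u v = B v u"
    and B_add: "u \<in> l2 \<Longrightarrow> v \<in> l2 \<Longrightarrow> w \<in> l2 \<Longrightarrow> B (u + v) w = B u w + B v w"
    and B_scl: "u \<in> l2 \<Longrightarrow> v \<in> l2 \<Longrightarrow> B (scl (of_real t) u) v = t * B u v"
    and B_lower: "u \<in> l2 \<Longrightarrow> lsq u \<le> C * B u u"
    and B_upper: "u \<in> l2 \<Longrightarrow> B u u \<le> C * lsq u"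
    and C_pos: "0 < C"
begin

lemma B_nonneg: "u \<in> l2 \<Longrightarrow> 0 \<le> B u u"
proof -
  assume "u \<in> l2"
  then have "0 \<le> C * B u u"
    using B_lower[of u] lsq_nonneg[of u] by linarith
  then show ?thesis
    using C_pos by (simp add: zero_le_mult_iff)
qed

lemma B_add_right: "u \<in> l2 \<Longrightarrow> v \<in> l2 \<Longrightarrow> w \<in> l2 \<Longrightarrow> B w (u + v) = B w u + B w v"
  using B_add[of u v w] B_commute l2_add_bound(1)[of u v] by simp

lemma B_scl_right: "u \<in> l2 \<Longrightarrow> v \<in> l2 \<Longrightarrow> B v (scl (of_real t) u) = t * B v u"
  using B_scl[of u v t] B_commute l2_scl(1)[of u] by simp

lemma B_zero: "v \<in> l2 \<Longrightarrow> B 0 v = 0"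
  using B_add[of 0 0 v] by simp

lemma B_minus: "u \<in> l2 \<Longrightarrow> v \<in> l2 \<Longrightarrow> B (- u) v = - B u v"
  using B_scl[of u v "- 1"] by (simp add: scl_minus_one)

lemma B_minus_right: "u \<in> l2 \<Longrightarrow> v \<in> l2 \<Longrightarrow> B v (- u) = - B v u"
  using B_scl_right[of u v "- 1"] by (simp add: scl_minus_one)

lemma B_diff: "u \<in> l2 \<Longrightarrow> v \<in> l2 \<Longrightarrow> w \<in> l2 \<Longrightarrow> B (u - v) w = B u w - B v w"
  using B_add[of u "- v" w] B_minus[of v w] by (simp add: l2_minus)

lemma B_square:
  assumes "u \<in> l2" "v \<in> l2"
  shows "B (u + scl (of_real t) v) (u + scl (of_real t) v) =
    B u u + 2 * t * B u v + t\<^sup>2 * B v v"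
proof -
  have s: "scl (of_real t) v \<in> l2"
    using assms l2_scl by blast
  have us: "u + scl (of_real t) v \<in> l2"
    using assms s l2_add_bound by blast
  show ?thesis
    using B_add[OF assms(1) s us] B_add_right[OF assms(1) s] assms s B_scl[OF assms(2) assms(1)]
      B_scl_right[OF assms(2)] B_scl[OF assms(2)] B_commute[OF assms]
    by (simp add: power2_eq_square algebra_simps)
qed

lemma B_diff_self:
  assumes "u \<in> l2" "v \<in> l2"
  shows "B (u - v) (u - v) = B u u - 2 * B u v + B v v"
  using B_square[OF assms, of "- 1"] by (simp add: scl_minus_one)

lemma B_add_self:
  assumes "u \<in> l2" "v \<in> l2"
  shows "B (u + v) (u + v) = B u u + 2 * B u v + B v v"
  using B_square[OF assms, of 1] by (simp add: scl_def plus_fun_def)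

lemma parallelogram:
  assumes "u \<in> l2" "v \<in> l2"
  shows "B (u - v) (u - v) = 2 * B u u + 2 * B v v -
    4 * B (scl (1 / 2) (u + v)) (scl (1 / 2) (u + v))"
proof -
  have w: "u + v \<in> l2"
    using assms l2_add_bound by blast
  have "scl (of_real (1 / 2)) (u + v) \<in> l2"
    using w l2_scl by blast
  then have "B (scl (1 / 2) (u + v)) (scl (1 / 2) (u + v)) = B (u + v) (u + v) / 4"
    using B_scl[OF w, of "scl (1 / 2) (u + v)" "1 / 2"] B_scl_right[OF w w, of "1 / 2"] by simp
  with B_diff_self[OF assms] B_add_self[OF assms] show ?thesis
    by simp
qed

end

lemma first_part_l2: "w \<in> first_part \<Longrightarrow> w \<in> l2"
  by (simp add: first_part_def)

lemma first_part_add: "u \<in> first_part \<Longrightarrow> v \<in> first_part \<Longrightarrow> u + v \<in> first_part"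
  by (simp add: first_part_def l2_add_bound)

lemma first_part_scl: "u \<in> first_part \<Longrightarrow> scl a u \<in> first_part"
  by (simp add: first_part_def l2_scl) (simp add: scl_def)

lemma first_part_minus: "u \<in> first_part \<Longrightarrow> - u \<in> first_part"
  using first_part_scl[of u "- 1"] by (simp add: scl_minus_one)

lemma first_part_diff: "u \<in> first_part \<Longrightarrow> v \<in> first_part \<Longrightarrow> u - v \<in> first_part"
  using first_part_add[of u "- v"] by (simp add: first_part_minus)

text \<open>Divide by \<open>2 * t\<close> and let \<open>t\<close> tend to 0; the explicit
  \<open>t\<close> makes the right side at most half of \<open>\<beta>\<close>.\<close>

lemma small_slope:
  fixes \<beta> b :: real
  assumes "\<And>t. 0 < t \<Longrightarrow> 2 * t * \<beta> \<le> 2 * t\<^sup>2 * b"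
  shows "\<beta> \<le> 0"
proof (rule ccontr)
  assume "\<not> \<beta> \<le> 0"
  then have pos: "0 < \<beta>" by simp
  let ?t = "\<beta> / (2 * (\<bar>b\<bar> + 1))"
  have t: "0 < ?t"
    using pos by simp
  have "2 * ?t * \<beta> \<le> 2 * ?t * (?t * b)"
    using assms[OF t] by (simp add: power2_eq_square mult.assoc)
  then have "\<beta> \<le> ?t * b"
    using t by (metis mult_le_cancel_left_pos mult_pos_pos zero_less_numeral)
  also have "\<dots> \<le> ?t * (\<bar>b\<bar> + 1)"
    using t by (intro mult_left_mono) auto
  also have "\<dots> = \<beta> / 2"
    by (simp add: field_simps)
  finally show False
    using pos by simp
qed

context equivalent_form
begin

text \<open>The first-order condition at a minimiser, with an error \<open>e\<close> because the
  infimum is only approached. For \<open>e = B x x\<close> it becomes a Cauchy-Schwarz inequality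
  without roots.\<close>

lemma near_minimiser_slope:
  assumes "x \<in> l2" "w \<in> l2" "B x x \<le> B (x - scl (of_real t) w) (x - scl (of_real t) w) + e"
  shows "2 * t * B x w \<le> e + t\<^sup>2 * B w w"
proof -
  have "x - scl (of_real t) w = x + scl (of_real (- t)) w"
    by (auto simp: scl_def)
  from assms(3)[unfolded this B_square[OF assms(1,2)]] show ?thesis
    by simp
qed

lemma Cauchy_Schwarz_linear:
  assumes "x \<in> l2" "w \<in> l2"
  shows "2 * t * B x w \<le> B x x + t\<^sup>2 * B w w"
proof (rule near_minimiser_slope[OF assms])
  have "x - scl (of_real t) w \<in> l2"
    using assms l2_diff l2_scl by blast
  then show "B x x \<le> B (x - scl (of_real t) w) (x - scl (of_real t) w) + B x x"
    using B_nonneg by simp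
qed


text \<open>The parallelogram law makes a minimising sequence Cauchy for \<open>B\<close>, hence for
  \<open>lsq\<close>, where completeness is available. It is not shown that the limit attains the
  infimum: the slope estimate is used along the sequence, and its errors vanish in the
  limit.\<close>

lemma projection_exists:
  assumes u: "u \<in> l2"
  shows "\<exists>w\<in>first_part. \<forall>w'\<in>first_part. B (u - w) w' = 0"
proof -
  define D where "D = (\<lambda>w. B (u - w) (u - w)) ` first_part"
  define d where "d = Inf D"
  have uw: "u - w \<in> l2" if "w \<in> first_part" for w
    using l2_diff[OF u first_part_l2[OF that]] .
  have "0 \<in> first_part"
    by (simp add: first_part_def)
  then have "D \<noteq> {}"
    by (auto simp: D_def)
  have d_le: "d \<le> B (u - w) (u - w)" if "w \<in> first_part" for w
    unfolding d_def
  proof (rule cInf_lower)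
    show "B (u - w) (u - w) \<in> D"
      using that by (simp add: D_def)
    show "bdd_below D"
      unfolding D_def by (rule bdd_belowI2[of _ 0]) (use uw B_nonneg in blast)
  qed
  have "\<exists>w. w \<in> first_part \<and> B (u - w) (u - w) < d + 1 / real (Suc n)" for n
  proof -
    have "\<exists>x\<in>D. x < d + 1 / real (Suc n)"
      by (rule cInf_lessD[OF \<open>D \<noteq> {}\<close>]) (simp add: d_def)
    then show ?thesis
      by (auto simp: D_def)
  qed
  then have "\<forall>n. \<exists>w. w \<in> first_part \<and> B (u - w) (u - w) < d + 1 / real (Suc n)"
    by blast
  from choice[OF this] obtain W where W: "\<And>n. W n \<in> first_part"
    "\<And>n. B (u - W n) (u - W n) < d + 1 / real (Suc n)"
    by blast
  have dist_W: "lsq (W m - W n) \<le> C * (2 * (1 / real (Suc m) + 1 / real (Suc n)))" for m n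
  proof -
    have eq: "scl (1 / 2) ((u - W n) + (u - W m)) = u - scl (1 / 2) (W n + W m)"
      by (auto simp: scl_def fun_eq_iff field_simps)
    have "scl (1 / 2) (W n + W m) \<in> first_part"
      by (intro first_part_scl first_part_add W)
    then have "d \<le> B (scl (1 / 2) ((u - W n) + (u - W m))) (scl (1 / 2) ((u - W n) + (u - W m)))"
      unfolding eq by (rule d_le)
    moreover have "(u - W n) - (u - W m) = W m - W n"
      by (simp add: fun_eq_iff)
    ultimately have "B (W m - W n) (W m - W n) \<le> 2 * (1 / real (Suc m) + 1 / real (Suc n))"
      using parallelogram[OF uw[OF W(1)] uw[OF W(1)], of n m] W(2)[of n] W(2)[of m] by simp
    then have "C * B (W m - W n) (W m - W n) \<le> C * (2 * (1 / real (Suc m) + 1 / real (Suc n)))"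
      using C_pos by (intro mult_left_mono) auto
    then show ?thesis
      using B_lower[OF l2_diff[OF first_part_l2[OF W(1)] first_part_l2[OF W(1)]], of m n] by linarith
  qed
  obtain l where l: "l \<in> l2" "(\<lambda>n. lsq (W n - l)) \<longlonglongrightarrow> 0" "\<And>i. (\<lambda>n. W n i) \<longlonglongrightarrow> l i"
  proof (rule l2_complete)
    fix e :: real assume "0 < e"
    then obtain N where N: "4 * C / e < real (Suc N)"
      using reals_Archimedean2 by (meson less_SucI of_nat_less_iff less_trans lessI)
    have "lsq (W m - W n) < e" if "m \<ge> N" "n \<ge> N" for m n
    proof -
      have "1 / real (Suc m) \<le> 1 / real (Suc N)" "1 / real (Suc n) \<le> 1 / real (Suc N)"
        using that by (auto intro!: divide_left_mono)
      then have "C * (2 * (1 / real (Suc m) + 1 / real (Suc n))) \<le> C * (2 * (1 / real (Suc N) + 1 / real (Suc N)))"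
        using C_pos by (intro mult_left_mono add_mono) auto
      also have "\<dots> < e"
        using N \<open>0 < e\<close> by (simp add: field_simps)
      finally show ?thesis
        using dist_W[of m n] by linarith
    qed
    then show "\<exists>N. \<forall>m\<ge>N. \<forall>n\<ge>N. lsq (W m - W n) < e"
      by blast
  qed (use W first_part_l2 in auto)
  have "l (False, k) = 0" for k
    using l(3)[of "(False, k)"] W(1) LIMSEQ_unique[OF _ tendsto_const] by (simp add: first_part_def)
  then have l_in: "l \<in> first_part"
    using l(1) by (simp add: first_part_def)
  have le: "B (u - l) w \<le> 0" if w: "w \<in> first_part" for w
  proof (rule small_slope[where b = "B w w"])
    fix t :: real assume "0 < t"
    note wl = first_part_l2[OF w]
    have "2 * t * B (u - l) w \<le> (1 / real (Suc n) + C * lsq (W n - l)) + 2 * t\<^sup>2 * B w w" for n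
    proof -
      have Wl: "W n - l \<in> l2"
        using l2_diff[OF first_part_l2[OF W(1)] l(1)] .
      have "W n + scl (of_real t) w \<in> first_part"
        by (intro first_part_add first_part_scl W w)
      then have "d \<le> B (u - W n - scl (of_real t) w) (u - W n - scl (of_real t) w)"
        using d_le unfolding diff_diff_eq by blast
      then have "2 * t * B (u - W n) w \<le> 1 / real (Suc n) + t\<^sup>2 * B w w"
        using W(2)[of n] by (intro near_minimiser_slope uw W wl) linarith
      moreover have "2 * t * B (W n - l) w \<le> C * lsq (W n - l) + t\<^sup>2 * B w w"
        using Cauchy_Schwarz_linear[OF Wl wl, of t] B_upper[OF Wl] by linarith
      moreover have "u - l = (u - W n) + (W n - l)"
        by simp
      then have "B (u - l) w = B (u - W n) w + B (W n - l) w"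
        using B_add[OF uw[OF W(1)] Wl wl, of n] by simp
      ultimately show ?thesis
        by (simp add: algebra_simps)
    qed
    moreover have "(\<lambda>n. (1 / real (Suc n) + C * lsq (W n - l)) + 2 * t\<^sup>2 * B w w) \<longlonglongrightarrow>
        (0 + C * 0) + 2 * t\<^sup>2 * B w w"
      by (intro tendsto_intros l(2) LIMSEQ_Suc[OF lim_1_over_n])
    ultimately show "2 * t * B (u - l) w \<le> 2 * t\<^sup>2 * B w w"
      using LIMSEQ_le_const by fastforce
  qed
  have "B (u - l) w = 0" if w: "w \<in> first_part" for w
    using le[OF w] le[OF first_part_minus[OF w]] B_minus_right[OF first_part_l2[OF w] uw[OF l_in]]
    by linarith
  then show ?thesis
    using l_in by blast
qed

definition proj :: "_ \<Rightarrow> _" where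
  "proj u = (SOME w. w \<in> first_part \<and> (\<forall>w'\<in>first_part. B (u - w) w' = 0))"

lemma proj:
  assumes "u \<in> l2"
  shows proj_in: "proj u \<in> first_part" and proj_orth: "\<And>w. w \<in> first_part \<Longrightarrow> B (u - proj u) w = 0"
  using someI_ex[of "\<lambda>w. w \<in> first_part \<and> (\<forall>w'\<in>first_part. B (u - w) w' = 0)"]
    projection_exists[OF assms] unfolding proj_def by blast+

lemma proj_unique:
  assumes u: "u \<in> l2" and w: "w \<in> first_part" "\<And>w'. w' \<in> first_part \<Longrightarrow> B (u - w) w' = 0"
  shows "proj u = w"
proof -
  let ?x = "proj u - w"
  have x: "?x \<in> first_part"
    by (intro first_part_diff proj_in u w)
  have "?x = (u - w) - (u - proj u)"
    by simp
  then have "B ?x ?x = B (u - w) ?x - B (u - proj u) ?x"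
    using B_diff[of "u - w" "u - proj u" ?x] first_part_l2[OF x] u w(1) proj_in[OF u]
    by (simp add: l2_diff first_part_l2)
  then have "B ?x ?x = 0"
    using w(2)[OF x] proj_orth[OF u x] by simp
  then have "?x = 0"
    using lsq_eq_0[OF first_part_l2[OF x]] B_lower[OF first_part_l2[OF x]] by simp
  then show ?thesis
    by simp
qed

lemma proj_l2: "u \<in> l2 \<Longrightarrow> proj u \<in> l2"
  using proj_in first_part_l2 by blast

lemma proj_add:
  assumes "u \<in> l2" "v \<in> l2"
  shows "proj (u + v) = proj u + proj v"
proof (rule proj_unique)
  fix w :: "bool \<times> 'k \<Rightarrow> complex" assume w: "w \<in> first_part"
  have eq: "u + v - (proj u + proj v) = (u - proj u) + (v - proj v)"
    by simp
  show "B (u + v - (proj u + proj v)) w = 0"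
    unfolding eq using B_add[of "u - proj u" "v - proj v" w] proj_orth[OF assms(1) w] proj_orth[OF assms(2) w]
      assms first_part_l2[OF w] by (simp add: l2_diff proj_l2)
qed (auto intro: assms proj_in first_part_add l2_add_bound)

lemma proj_scl:
  assumes "u \<in> l2"
  shows "proj (scl (of_real t) u) = scl (of_real t) (proj u)"
proof (rule proj_unique)
  fix w :: "bool \<times> 'k \<Rightarrow> complex" assume w: "w \<in> first_part"
  have "scl (of_real t) u - scl (of_real t) (proj u) = scl (of_real t) (u - proj u)"
    by (auto simp: scl_def algebra_simps)
  then show "B (scl (of_real t) u - scl (of_real t) (proj u)) w = 0"
    using B_scl[of "u - proj u" w t] proj_orth[OF assms w] assms first_part_l2[OF w]
    by (simp add: l2_diff proj_l2)
qed (auto intro: assms proj_in first_part_scl l2_scl)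

lemma proj_id: "w \<in> first_part \<Longrightarrow> proj w = w"
  by (rule proj_unique) (auto simp: first_part_l2 B_zero)

text \<open>For \<open>B\<close> itself the projection is a contraction; passing from
  \<open>lsq\<close> to \<open>B\<close> and back costs a factor \<open>C\<close> each time.\<close>

lemma proj_bound:
  assumes u: "u \<in> l2"
  shows "lsq (proj u) \<le> C * C * lsq u"
proof -
  let ?p = "proj u"
  have p: "?p \<in> l2" and up: "u - ?p \<in> l2"
    using u proj_l2 l2_diff by auto
  have "B u u = B (u - ?p) (u - ?p) + 2 * B (u - ?p) ?p + B ?p ?p"
    using B_add_self[OF up p] by simp
  then have "B ?p ?p \<le> B u u"
    using proj_orth[OF u proj_in[OF u]] B_nonneg[OF up] by simp
  then have "C * B ?p ?p \<le> C * (C * lsq u)"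
    using B_upper[OF u] C_pos by (intro mult_left_mono) auto
  then show ?thesis
    using B_lower[OF p] by simp
qed

end

section \<open>A uniformly bounded representation without invariant form\<close>

type_synonym coord = "bool \<times> nat \<times> tgrp"

text \<open>\<open>a j x s\<close> is the matrix entry in row \<open>x\<close> and column
  \<open>x + s\<close>, so the column through \<open>z\<close> consists of the entries
  \<open>b j (z - s) s\<close>. The norms grow with \<open>j\<close> because any single one is
  compatible with a large constant \<open>C\<close>.\<close>

locale littlewood =
  fixes S :: "nat \<Rightarrow> tgrp set" and f :: "nat \<Rightarrow> tgrp \<Rightarrow> real" and a b :: "nat \<Rightarrow> tgrp \<Rightarrow> tgrp \<Rightarrow> real"
  assumes finS: "finite (S j)"
    and a_nonneg: "0 \<le> a j x s" and b_nonneg: "0 \<le> b j x s"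
    and ab: "s \<in> S j \<Longrightarrow> a j x s + b j x s = f j s"
    and a_row: "(\<Sum>s\<in>S j. a j x s) \<le> 2" and b_col: "(\<Sum>s\<in>S j. b j (z - s) s) \<le> 2"
    and f_large: "real j \<le> (\<Sum>s\<in>S j. (f j s)\<^sup>2)"
begin

text \<open>
  The off-diagonal block of \<open>rho g\<close> is the derivation \<open>g A - A g\<close> for the (possibly unbounded)
  operator \<open>A\<close> with kernel \<open>a\<close>. As \<open>a + b\<close> is translation invariant, it equals \<open>B g - g B\<close> for the
  operator \<open>B\<close> with kernel \<open>b\<close>; so Schur's test applies, with rows from \<open>a\<close> and columns from \<open>b\<close>.
\<close>

definition ker :: "tgrp \<Rightarrow> nat \<Rightarrow> tgrp \<Rightarrow> tgrp \<Rightarrow> real" where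
  "ker g j x s = a j (- g + x) s - a j x s"

definition rho :: "tgrp \<Rightarrow> (coord \<Rightarrow> complex) \<Rightarrow> coord \<Rightarrow> complex" where
  "rho g v = (\<lambda>(c, j, x). v (c, j, - g + x) +
    (if c then \<Sum>s\<in>S j. complex_of_real (ker g j x s) * v (False, j, - g + x + s) else 0))"

lemma rho_True: "rho g v (True, j, x) = v (True, j, - g + x) +
    (\<Sum>s\<in>S j. complex_of_real (ker g j x s) * v (False, j, - g + x + s))"
  by (simp add: rho_def)

lemma rho_False: "rho g v (False, j, x) = v (False, j, - g + x)"
  by (simp add: rho_def)

lemma rho_add: "rho g (u + v) = rho g u + rho g v"
  by (auto simp: rho_def fun_eq_iff algebra_simps sum.distrib)

lemma rho_scl: "rho g (scl t v) = scl t (rho g v)"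
  by (auto simp: rho_def scl_def fun_eq_iff algebra_simps sum_distrib_left)

text \<open>A telescoping sum, the kernel being a difference of translates. This cocycle identity
  makes \<open>rho\<close> multiplicative.\<close>

lemma ker_cocycle: "ker (g + h) j x s = ker h j (- g + x) s + ker g j x s"
  by (simp add: ker_def minus_add add.assoc del: add_uminus_conv_diff)

lemma rho_comp: "rho g (rho h v) = rho (g + h) v"
proof
  fix i :: "coord"
  obtain c j x where i: "i = (c, j, x)"
    by (cases i) auto
  show "rho g (rho h v) i = rho (g + h) v i"
  proof (cases c)
    case True
    have "(- h + (- g + x)) + s = - h + (- g + x + s)" for s
      by (simp add: add.assoc)
    then show ?thesis
      using True i by (simp add: rho_True rho_False ker_cocycle minus_add sum.distrib algebra_simps add.assoc
          del: add_uminus_conv_diff)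
  next
    case False
    then show ?thesis
      using i by (simp add: rho_False minus_add add.assoc del: add_uminus_conv_diff)
  qed
qed

lemma rho_zero: "rho 0 v = v"
  by (auto simp: rho_def ker_def fun_eq_iff)

lemma ker_row: "(\<Sum>s\<in>S j. \<bar>ker g j x s\<bar>) \<le> 4"
proof -
  have "(\<Sum>s\<in>S j. \<bar>ker g j x s\<bar>) \<le> (\<Sum>s\<in>S j. a j (- g + x) s + a j x s)"
    by (rule sum_mono) (use a_nonneg[of j "- g + x"] a_nonneg[of j x] in \<open>simp add: ker_def abs_le_iff add_nonneg_nonneg\<close>)
  also have "\<dots> \<le> 4"
    using a_row[of j "- g + x"] a_row[of j x] by (simp add: sum.distrib)
  finally show ?thesis .
qed

lemma ker_alt: "s \<in> S j \<Longrightarrow> ker g j x s = b j x s - b j (- g + x) s"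
  using ab[of s j x] ab[of s j "- g + x"] by (simp add: ker_def)

lemma ker_col: "(\<Sum>s\<in>S j. \<bar>ker g j (z - s) s\<bar>) \<le> 4"
proof -
  have "(\<Sum>s\<in>S j. \<bar>ker g j (z - s) s\<bar>) \<le> (\<Sum>s\<in>S j. b j (z - s) s + b j ((- g + z) - s) s)"
  proof (rule sum_mono)
    fix s assume s: "s \<in> S j"
    have "- g + (z - s) = (- g + z) - s"
      by (simp add: add_diff_eq)
    then have "ker g j (z - s) s = b j (z - s) s - b j ((- g + z) - s) s"
      using ker_alt[OF s, of g "z - s"] by simp
    then show "\<bar>ker g j (z - s) s\<bar> \<le> b j (z - s) s + b j ((- g + z) - s) s"
      using b_nonneg[of j "z - s" s] b_nonneg[of j "(- g + z) - s" s] by linarith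
  qed
  also have "\<dots> \<le> 4"
    using b_col[of j z] b_col[of j "- g + z"] by (simp add: sum.distrib)
  finally show ?thesis .
qed

lemma ker_square:
  "(cmod (\<Sum>s\<in>S j. complex_of_real (ker g j x s) * v s))\<^sup>2 \<le> 4 * (\<Sum>s\<in>S j. \<bar>ker g j x s\<bar> * (cmod (v s))\<^sup>2)"
proof -
  let ?k = "\<lambda>s. \<bar>ker g j x s\<bar>"
  have "cmod (\<Sum>s\<in>S j. complex_of_real (ker g j x s) * v s) \<le> (\<Sum>s\<in>S j. ?k s * cmod (v s))"
    by (rule sum_norm_le) (simp add: norm_mult)
  also have "\<dots> = (\<Sum>s\<in>S j. sqrt (?k s) * (sqrt (?k s) * cmod (v s)))"
    by (simp add: mult.assoc[symmetric])
  finally have "(cmod (\<Sum>s\<in>S j. complex_of_real (ker g j x s) * v s))\<^sup>2 \<le>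
      (\<Sum>s\<in>S j. sqrt (?k s) * (sqrt (?k s) * cmod (v s)))\<^sup>2"
    by (intro power_mono) auto
  also have "\<dots> \<le> (\<Sum>s\<in>S j. (sqrt (?k s))\<^sup>2) * (\<Sum>s\<in>S j. (sqrt (?k s) * cmod (v s))\<^sup>2)"
    by (rule Cauchy_Schwarz_ineq_sum)
  also have "\<dots> = (\<Sum>s\<in>S j. ?k s) * (\<Sum>s\<in>S j. ?k s * (cmod (v s))\<^sup>2)"
    by (simp add: power_mult_distrib)
  also have "\<dots> \<le> 4 * (\<Sum>s\<in>S j. ?k s * (cmod (v s))\<^sup>2)"
    by (intro mult_right_mono ker_row sum_nonneg) auto
  finally show ?thesis .
qed

text \<open>Schur's test with row and column bounds 4 gives 16 for the off-diagonal part. Squaring a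
  sum of two terms costs a factor 2, hence \<open>34 = 2 * 1 + 2 * 16\<close>.\<close>

lemma rho_l2:
  assumes v: "v \<in> l2"
  shows "rho g v \<in> l2" "lsq (rho g v) \<le> 34 * lsq v"
proof -
  define sh where "sh = (\<lambda>(c, j, x). (c, j, - g + x) :: coord)"
  define K where "K j x = (\<Sum>s\<in>S j. complex_of_real (ker g j x s) * v (False, j, - g + x + s))" for j x
  have inj: "inj sh"
    by (auto simp: sh_def inj_on_def)
  have K_sum: "(\<Sum>(j, x)\<in>A. (cmod (K j x))\<^sup>2) \<le> 16 * lsq v" if A: "finite A" for A
  proof -
    let ?u = "\<lambda>j z. (cmod (v (False, j, - g + z)))\<^sup>2"
    let ?T = "SIGMA p:A. S (fst p)"
    let ?Z = "(\<lambda>((j, x), s). (j, x + s)) ` ?T"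
    have fT: "finite ?T"
      using A finS by auto
    have "(\<Sum>(j, x)\<in>A. (cmod (K j x))\<^sup>2) \<le> (\<Sum>(j, x)\<in>A. 4 * (\<Sum>s\<in>S j. \<bar>ker g j x s\<bar> * ?u j (x + s)))"
    proof (rule sum_mono, clarify)
      fix j x
      show "(cmod (K j x))\<^sup>2 \<le> 4 * (\<Sum>s\<in>S j. \<bar>ker g j x s\<bar> * ?u j (x + s))"
        using ker_square[of g j x "\<lambda>s. v (False, j, - g + x + s)"] by (simp add: K_def add.assoc)
    qed
    also have "\<dots> = 4 * (\<Sum>p\<in>A. \<Sum>s\<in>S (fst p). \<bar>ker g (fst p) (snd p) s\<bar> * ?u (fst p) (snd p + s))"
      by (simp add: sum_distrib_left split_beta)
    also have "(\<Sum>p\<in>A. \<Sum>s\<in>S (fst p). \<bar>ker g (fst p) (snd p) s\<bar> * ?u (fst p) (snd p + s)) =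
        (\<Sum>((j, x), s)\<in>?T. \<bar>ker g j x s\<bar> * ?u j (x + s))"
      using A finS by (subst sum.Sigma) (auto simp: split_beta)
    \<comment> \<open>The substitution \<open>z = x + s\<close> turns rows into columns; admitting
      all steps at each column only adds nonnegative terms.\<close>
    also have "\<dots> \<le> (\<Sum>((j, z), s)\<in>(SIGMA p:?Z. S (fst p)). \<bar>ker g j (z - s) s\<bar> * ?u j z)"
    proof -
      let ?\<phi> = "\<lambda>((j, x), s). ((j, x + s), s) :: (nat \<times> tgrp) \<times> tgrp"
      have "(\<Sum>((j, x), s)\<in>?T. \<bar>ker g j x s\<bar> * ?u j (x + s)) =
          (\<Sum>((j, z), s)\<in>?\<phi> ` ?T. \<bar>ker g j (z - s) s\<bar> * ?u j z)"
        by (subst sum.reindex) (auto simp: inj_on_def split_beta add_diff_eq[symmetric] intro!: sum.cong)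
      also have "\<dots> \<le> (\<Sum>((j, z), s)\<in>(SIGMA p:?Z. S (fst p)). \<bar>ker g j (z - s) s\<bar> * ?u j z)"
      proof (rule sum_mono2)
        show "finite (SIGMA p:?Z. S (fst p))"
          using fT finS by blast
        show "?\<phi> ` ?T \<subseteq> (SIGMA p:?Z. S (fst p))"
          by force
      qed auto
      finally show ?thesis .
    qed
    also have "\<dots> = (\<Sum>p\<in>?Z. \<Sum>s\<in>S (fst p). \<bar>ker g (fst p) (snd p - s) s\<bar> * ?u (fst p) (snd p))"
      using fT finS by (subst sum.Sigma) (auto simp: split_beta)
    also have "\<dots> = (\<Sum>p\<in>?Z. (\<Sum>s\<in>S (fst p). \<bar>ker g (fst p) (snd p - s) s\<bar>) * ?u (fst p) (snd p))"
      by (simp add: sum_distrib_right)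
    also have "\<dots> \<le> (\<Sum>p\<in>?Z. 4 * ?u (fst p) (snd p))"
      by (intro sum_mono mult_right_mono ker_col) auto
    also have "\<dots> = 4 * (\<Sum>p\<in>?Z. ?u (fst p) (snd p))"
      by (simp add: sum_distrib_left)
    also have "(\<Sum>p\<in>?Z. ?u (fst p) (snd p)) = (\<Sum>i\<in>(\<lambda>p. (False, fst p, - g + snd p)) ` ?Z. (cmod (v i))\<^sup>2)"
      by (subst sum.reindex) (auto simp: inj_on_def)
    also have "\<dots> \<le> lsq v"
      by (rule l2_sum_le[OF v]) (use fT in auto)
    finally show ?thesis
      by simp
  qed
  have "(\<Sum>i\<in>A. (cmod (rho g v i))\<^sup>2) \<le> 34 * lsq v" if A: "finite A" for A
  proof -
    let ?A = "snd ` (A \<inter> {i. fst i})"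
    have "(cmod (rho g v i))\<^sup>2 \<le> 2 * (cmod (v (sh i)))\<^sup>2 + 2 * (if fst i then (cmod (K (fst (snd i)) (snd (snd i))))\<^sup>2 else 0)" for i
    proof -
      obtain c j x where i: "i = (c, j, x)"
        by (cases i) auto
      have "rho g v i = v (sh i) + (if c then K j x else 0)"
        by (simp add: i rho_def sh_def K_def)
      then show ?thesis
        using cmod_add_sq_le[of "v (sh i)" "if c then K j x else 0"] by (auto simp: i)
    qed
    then have "(\<Sum>i\<in>A. (cmod (rho g v i))\<^sup>2) \<le>
        (\<Sum>i\<in>A. 2 * (cmod (v (sh i)))\<^sup>2 + 2 * (if fst i then (cmod (K (fst (snd i)) (snd (snd i))))\<^sup>2 else 0))"
      by (rule sum_mono)
    also have "\<dots> = 2 * (\<Sum>i\<in>A. (cmod (v (sh i)))\<^sup>2) +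
        2 * (\<Sum>i\<in>A. if fst i then (cmod (K (fst (snd i)) (snd (snd i))))\<^sup>2 else 0)"
      by (simp add: sum.distrib sum_distrib_left)
    also have "(\<Sum>i\<in>A. (cmod (v (sh i)))\<^sup>2) = (\<Sum>i\<in>sh ` A. (cmod (v i))\<^sup>2)"
      by (subst sum.reindex) (auto intro: inj_on_subset[OF inj])
    also have "(\<Sum>i\<in>A. if fst i then (cmod (K (fst (snd i)) (snd (snd i))))\<^sup>2 else 0) =
        (\<Sum>i\<in>A \<inter> {i. fst i}. (cmod (K (fst (snd i)) (snd (snd i))))\<^sup>2)"
      using A by (simp add: sum.inter_restrict)
    also have "\<dots> = (\<Sum>(j, x)\<in>?A. (cmod (K j x))\<^sup>2)"
      by (subst sum.reindex) (auto simp: inj_on_def split_beta)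
    finally show ?thesis
      using K_sum[of ?A] l2_sum_le[OF v, of "sh ` A"] A by simp
  qed
  from l2_bound[OF this] show "rho g v \<in> l2" "lsq (rho g v) \<le> 34 * lsq v"
    by blast+
qed

definition unit_vec :: "coord \<Rightarrow> coord \<Rightarrow> complex" where
  "unit_vec i = (\<lambda>i'. if i' = i then 1 else 0)"

lemma unit_vec_l2: "unit_vec i \<in> l2" "lsq (unit_vec i) \<le> 1"
proof -
  have "(\<Sum>i'\<in>A. (cmod (unit_vec i i'))\<^sup>2) \<le> 1" if "finite A" for A
  proof -
    have "(\<Sum>i'\<in>A. (cmod (unit_vec i i'))\<^sup>2) = (\<Sum>i'\<in>A. if i' = i then 1 else 0)"
      by (rule sum.cong) (auto simp: unit_vec_def)
    then show ?thesis
      using that by simp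
  qed
  from l2_bound[OF this] show "unit_vec i \<in> l2" "lsq (unit_vec i) \<le> 1"
    by blast+
qed

definition kerA :: "nat \<Rightarrow> tgrp \<Rightarrow> tgrp \<Rightarrow> real" where
  "kerA j x y = (if - x + y \<in> S j then a j x (- x + y) else 0)"

text \<open>\<open>w\<close> carries the column of the commutator of translation and
  \<open>A\<close> at the basis vector; its entries make sense even if \<open>A\<close> is
  unbounded.\<close>

lemma rho_unit_vec:
  obtains w where "w \<in> first_part" "rho g (unit_vec (False, j, y)) = unit_vec (False, j, g + y) + w"
    "\<And>x. w (True, j, x) = complex_of_real (kerA j (- g + x) y - kerA j x (g + y))"
proof -
  define w where "w = rho g (unit_vec (False, j, y)) - unit_vec (False, j, g + y)"
  have "w \<in> l2"
    unfolding w_def by (intro l2_diff rho_l2 unit_vec_l2)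
  moreover have "- g + x = y \<longleftrightarrow> x = g + y" for x
    by (metis add_minus_cancel minus_add_cancel)
  then have "w (False, k) = 0" for k
    by (cases k) (auto simp: w_def rho_False unit_vec_def)
  ultimately have "w \<in> first_part"
    by (simp add: first_part_def)
  moreover have "rho g (unit_vec (False, j, y)) = unit_vec (False, j, g + y) + w"
    by (simp add: w_def)
  moreover have "w (True, j, x) = complex_of_real (kerA j (- g + x) y - kerA j x (g + y))" for x
  proof -
    have eq: "- g + x + s = y \<longleftrightarrow> s = - x + (g + y)" for s
      by (metis add.assoc add_minus_cancel minus_add_cancel)
    have eq': "- (- g + x) + y = - x + (g + y)"
      by (simp add: minus_add add.assoc)
    have "w (True, j, x) = (\<Sum>s\<in>S j. if s = - x + (g + y) then complex_of_real (ker g j x s) else 0)"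
      unfolding w_def minus_apply rho_True by (simp add: unit_vec_def eq mult_if_delta if_distrib cong: if_cong)
    also have "\<dots> = (if - x + (g + y) \<in> S j then complex_of_real (ker g j x (- x + (g + y))) else 0)"
      using finS by simp
    also have "\<dots> = complex_of_real (kerA j (- g + x) y - kerA j x (g + y))"
      unfolding kerA_def eq' by (simp add: ker_def)
    finally show ?thesis .
  qed
  ultimately show ?thesis
    using that by blast
qed

text \<open>Invariance of the form makes \<open>proj\<close> commute with \<open>rho\<close>, since
  orthogonality characterises it. Only matrix entries are compared, so the unbounded
  \<open>A\<close> never has to act.\<close>

lemma no_invariant_form:
  assumes "equivalent_form B C" and inv: "\<And>g v. v \<in> l2 \<Longrightarrow> B (rho g v) (rho g v) = B v v"
  shows False
proof -
  interpret equivalent_form B C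
    by fact
  have inv2: "B (rho g u) (rho g v) = B u v" if "u \<in> l2" "v \<in> l2" for g u v
    using inv[OF l2_add_bound(1)[OF that], of g] inv[OF that(1), of g] inv[OF that(2), of g]
      B_add_self[OF that] B_add_self[OF rho_l2(1)[OF that(1)] rho_l2(1)[OF that(2)], of g g]
    by (simp add: rho_add)
  have rho_first: "rho g w \<in> first_part" if "w \<in> first_part" for g w
    using that rho_l2(1)[of w g] by (auto simp: first_part_def rho_False)
  have rho_diff: "rho g (u - v) = rho g u - rho g v" for g u v
    using rho_add[of g "u - v" v] by simp
  have equivariant: "proj (rho g u) = rho g (proj u)" if u: "u \<in> l2" for g u
  proof (rule proj_unique)
    fix w :: "coord \<Rightarrow> complex" assume w: "w \<in> first_part"
    have "w = rho g (rho (- g) w)"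
      by (simp add: rho_comp rho_zero)
    then have "B (rho g u - rho g (proj u)) w = B (rho g (u - proj u)) (rho g (rho (- g) w))"
      by (simp add: rho_diff)
    also have "\<dots> = B (u - proj u) (rho (- g) w)"
      by (rule inv2) (use u w in \<open>auto intro: l2_diff proj_l2 rho_l2 first_part_l2\<close>)
    also have "\<dots> = 0"
      by (rule proj_orth[OF u rho_first[OF w]])
    finally show "B (rho g u - rho g (proj u)) w = 0" .
  qed (use u proj_in rho_first rho_l2 in auto)
  define t where "t j x y = Re (proj (unit_vec (False, j, y)) (True, j, x))" for j x y
  have t_shift: "t j x (g + y) + kerA j (- g + x) y - kerA j x (g + y) = t j (- g + x) y" for j g x y
  proof -
    let ?e = "unit_vec (False, j, y)"
    obtain w where w: "w \<in> first_part" "rho g ?e = unit_vec (False, j, g + y) + w"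
      "\<And>x. w (True, j, x) = complex_of_real (kerA j (- g + x) y - kerA j x (g + y))"
      by (rule rho_unit_vec[of g j y]) blast
    have "proj (rho g ?e) = proj (unit_vec (False, j, g + y)) + w"
      unfolding w(2) using proj_add[OF unit_vec_l2(1) first_part_l2[OF w(1)]] proj_id[OF w(1)] by simp
    then have "proj (unit_vec (False, j, g + y)) (True, j, x) + w (True, j, x) = rho g (proj ?e) (True, j, x)"
      using equivariant[OF unit_vec_l2(1)] by (metis plus_fun_apply)
    also have "\<dots> = proj ?e (True, j, - g + x)"
      using proj_in[OF unit_vec_l2(1), of "(False, j, y)"] by (simp add: rho_True first_part_def)
    finally have "Re (proj (unit_vec (False, j, g + y)) (True, j, x) + w (True, j, x)) =
        Re (proj ?e (True, j, - g + x))"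
      by simp
    then show ?thesis
      by (simp add: t_def w(3))
  qed
  define h where "h j x y = kerA j x y - t j x y" for j x y
  have h_shift: "h j x (g + y) = h j (- g + x) y" for j x g y
    using t_shift[of j x g y] by (simp add: h_def)
  have col: "(\<Sum>s\<in>S j. (t j (- s) 0)\<^sup>2) \<le> C * C" for j
  proof -
    let ?p = "proj (unit_vec (False, j, 0))"
    have "(\<Sum>s\<in>S j. (t j (- s) 0)\<^sup>2) \<le> (\<Sum>s\<in>S j. (cmod (?p (True, j, - s)))\<^sup>2)"
      unfolding t_def by (intro sum_mono) (simp add: cmod_power2)
    also have "\<dots> = (\<Sum>i\<in>(\<lambda>s. (True, j, - s)) ` S j. (cmod (?p i))\<^sup>2)"
      by (subst sum.reindex) (auto simp: inj_on_def)
    also have "\<dots> \<le> lsq ?p"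
      by (rule l2_sum_le) (auto intro: proj_l2 unit_vec_l2 finS)
    also have "\<dots> \<le> C * C * lsq (unit_vec (False, j, 0))"
      by (rule proj_bound[OF unit_vec_l2(1)])
    also have "\<dots> \<le> C * C * 1"
      by (rule mult_left_mono[OF unit_vec_l2(2)]) simp
    finally show ?thesis
      by simp
  qed
  \<comment> \<open>A column of \<open>t\<close> is the image of a basis vector, a row is not. By
    duality the projection is applied to the vector whose coefficients are the row itself, which
    bounds the square of \<open>?T\<close> by \<open>C * C * ?T\<close>.\<close>
  have row: "(\<Sum>s\<in>S j. (t j 0 s)\<^sup>2) \<le> C * C" for j
  proof -
    define v where "v c A = (\<lambda>i. \<Sum>s\<in>A. scl (of_real (c s)) (unit_vec (False, j, s)) i)"
      for c :: "tgrp \<Rightarrow> real" and A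
    have v: "v c A \<in> l2 \<and> Re (proj (v c A) (True, j, 0)) = (\<Sum>s\<in>A. c s * t j 0 s)"
      if "finite A" for c A
      using that
    proof (induction A)
      case empty
      have v0: "v c {} = 0"
        by (simp add: v_def fun_eq_iff)
      have p0: "proj 0 = 0"
        by (rule proj_id) (simp add: first_part_def)
      show ?case
        unfolding v0 p0 by (simp add: l2_def)
    next
      case (insert s A)
      let ?e = "unit_vec (False, j, s)"
      have eq: "v c (insert s A) = scl (of_real (c s)) ?e + v c A"
        using insert.hyps by (simp add: v_def fun_eq_iff)
      have e: "scl (of_real (c s)) ?e \<in> l2"
        by (intro l2_scl unit_vec_l2)
      have pr: "proj (v c (insert s A)) = scl (of_real (c s)) (proj ?e) + proj (v c A)"
        unfolding eq using proj_add[OF e] proj_scl[OF unit_vec_l2(1)] insert.IH by simp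
      have "v c (insert s A) \<in> l2"
        unfolding eq using l2_add_bound(1)[OF e] insert.IH by blast
      moreover have "Re (proj (v c (insert s A)) (True, j, 0)) = (\<Sum>s\<in>insert s A. c s * t j 0 s)"
        unfolding pr using insert by (simp add: scl_def t_def)
      ultimately show ?case
        by blast
    qed
    let ?c = "\<lambda>s. t j 0 s"
    let ?T = "\<Sum>s\<in>S j. (t j 0 s)\<^sup>2"
    let ?v = "v ?c (S j)"
    have v_val: "?v i = (if \<exists>s\<in>S j. i = (False, j, s) then complex_of_real (?c (snd (snd i))) else 0)" for i
    proof (cases "\<exists>s\<in>S j. i = (False, j, s)")
      case True
      then obtain s where s: "s \<in> S j" "i = (False, j, s)"
        by blast
      have "?v i = (\<Sum>r\<in>S j. if s = r then complex_of_real (?c r) else 0)"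
        unfolding v_def by (rule sum.cong) (auto simp: scl_def unit_vec_def s)
      then show ?thesis
        using s finS by auto
    next
      case False
      then show ?thesis
        unfolding v_def by (auto simp: scl_def unit_vec_def intro!: sum.neutral)
    qed
    have "lsq ?v \<le> ?T"
    proof (rule l2_bound(2))
      fix A :: "coord set" assume A: "finite A"
      have "(\<Sum>i\<in>A. (cmod (?v i))\<^sup>2) = (\<Sum>i\<in>A \<inter> Pair False ` Pair j ` S j. (cmod (?v i))\<^sup>2)"
        by (rule sum.mono_neutral_right[OF A]) (auto simp: v_val)
      also have "\<dots> \<le> (\<Sum>i\<in>Pair False ` Pair j ` S j. (cmod (?v i))\<^sup>2)"
        by (rule sum_mono2) (auto intro: finS)
      also have "\<dots> = ?T"
        by (subst sum.reindex, force simp: inj_on_def)+ (auto simp: v_val intro!: sum.cong)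
      finally show "(\<Sum>i\<in>A. (cmod (?v i))\<^sup>2) \<le> ?T" .
    qed
    have "?T * ?T = (Re (proj ?v (True, j, 0)))\<^sup>2"
      using v[OF finS, of ?c j] by (simp add: power2_eq_square)
    also have "\<dots> \<le> (cmod (proj ?v (True, j, 0)))\<^sup>2"
      by (simp add: cmod_power2)
    also have "\<dots> \<le> lsq (proj ?v)"
      using v[OF finS] by (intro l2_coord_le proj_l2) blast
    also have "\<dots> \<le> C * C * lsq ?v"
      using v[OF finS] by (intro proj_bound) blast
    also have "\<dots> \<le> C * C * ?T"
      by (rule mult_left_mono[OF \<open>lsq ?v \<le> ?T\<close>]) simp
    finally have "?T * ?T \<le> C * C * ?T" .
    moreover have "0 \<le> ?T"
      by (simp add: sum_nonneg)
    ultimately show ?thesis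
      using C_pos by (cases "?T = 0") auto
  qed
  \<comment> \<open>The outer 4 comes from squaring a sum of four terms; the inner 4 bounds the
    square sum of nonnegative terms with sum at most 2.\<close>
  have f_bound: "(\<Sum>s\<in>S j. (f j s)\<^sup>2) \<le> 4 * (4 + C * C + 4 + C * C)" for j
  proof -
    \<comment> \<open>The invariant entry with offset \<open>s\<close> is read twice: in row 0,
      where \<open>a\<close> has a bounded row sum, and in column 0, where \<open>a = f - b\<close>
      and \<open>b\<close> has a bounded column sum.\<close>
    have f_eq: "f j s = b j (- s) s + t j (- s) 0 + a j 0 s - t j 0 s" if s: "s \<in> S j" for s
    proof -
      have "h j (- s) 0 = h j 0 s"
        using h_shift[of j 0 s 0] by simp
      moreover have "h j 0 s = a j 0 s - t j 0 s"
        using s by (simp add: h_def kerA_def)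
      moreover have "h j (- s) 0 = f j s - b j (- s) s - t j (- s) 0"
        using s ab[OF s, of "- s"] by (simp add: h_def kerA_def)
      ultimately show ?thesis
        by linarith
    qed
    have four: "(p + q + r - u)\<^sup>2 \<le> 4 * (p\<^sup>2 + q\<^sup>2 + r\<^sup>2 + u\<^sup>2)" for p q r u :: real
    proof -
      have "0 \<le> (p - q)\<^sup>2 + (p - r)\<^sup>2 + (p + u)\<^sup>2 + (q - r)\<^sup>2 + (q + u)\<^sup>2 + (r + u)\<^sup>2"
        by simp
      also have "\<dots> = 4 * (p\<^sup>2 + q\<^sup>2 + r\<^sup>2 + u\<^sup>2) - (p + q + r - u)\<^sup>2"
        by (simp add: power2_eq_square algebra_simps)
      finally show ?thesis
        by simp
    qed
    have sq: "(\<Sum>s\<in>S j. (c s)\<^sup>2) \<le> 4" if c: "\<And>s. 0 \<le> c s" "(\<Sum>s\<in>S j. c s) \<le> 2" for c :: "tgrp \<Rightarrow> real"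
    proof -
      have "(\<Sum>s\<in>S j. (c s)\<^sup>2) \<le> (\<Sum>s\<in>S j. 2 * c s)"
      proof (rule sum_mono)
        fix s assume "s \<in> S j"
        then have "c s \<le> 2"
          using member_le_sum[of s "S j" c] c finS by fastforce
        then show "(c s)\<^sup>2 \<le> 2 * c s"
          using c(1)[of s] by (simp add: power2_eq_square mult_right_mono)
      qed
      then show ?thesis
        using c(2) by (simp add: sum_distrib_left[symmetric])
    qed
    have "(\<Sum>s\<in>S j. (f j s)\<^sup>2) \<le>
        (\<Sum>s\<in>S j. 4 * ((b j (- s) s)\<^sup>2 + (t j (- s) 0)\<^sup>2 + (a j 0 s)\<^sup>2 + (t j 0 s)\<^sup>2))"
      by (rule sum_mono) (simp only: f_eq four)
    also have "\<dots> = 4 * ((\<Sum>s\<in>S j. (b j (- s) s)\<^sup>2) + (\<Sum>s\<in>S j. (t j (- s) 0)\<^sup>2) +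
        (\<Sum>s\<in>S j. (a j 0 s)\<^sup>2) + (\<Sum>s\<in>S j. (t j 0 s)\<^sup>2))"
      by (simp add: sum.distrib sum_distrib_left distrib_left)
    also have "\<dots> \<le> 4 * (4 + C * C + 4 + C * C)"
      using sq[of "\<lambda>s. b j (- s) s"] sq[of "a j 0"] b_nonneg a_nonneg b_col[of j 0] a_row[of j 0]
        col[of j] row[of j] by (intro mult_left_mono add_mono) auto
    finally show ?thesis .
  qed
  obtain j :: nat where "4 * (4 + C * C + 4 + C * C) < real j"
    using reals_Archimedean2 by blast
  then show False
    using f_large[of j] f_bound[of j] by linarith
qed

end

section \<open>The Hilbert space of square-summable sequences\<close>

definition ell2 :: "(nat \<Rightarrow> complex) inner_space" where
  "ell2 = \<lparr>carrier = l2, monoid.mult = (\<lambda>_ _. 0), one = 0, zero = 0, add = (+), module.smult = scl, inner_prod = ip\<rparr>"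

lemma ell2_simps [simp]:
  "carrier ell2 = l2" "x \<oplus>\<^bsub>ell2\<^esub> y = x + y" "\<zero>\<^bsub>ell2\<^esub> = 0" "c \<odot>\<^bsub>ell2\<^esub> x = scl c x"
  "inner_prod ell2 = ip"
  by (simp_all add: ell2_def)

lemma cring_complex_field: "cring complex_field"
proof (intro cringI abelian_groupI comm_monoidI)
  show "\<exists>y\<in>carrier complex_field. y \<oplus>\<^bsub>complex_field\<^esub> x = \<zero>\<^bsub>complex_field\<^esub>" for x
    by (auto simp: complex_field_def intro: exI[of _ "- x"])
qed (auto simp: complex_field_def algebra_simps)

lemma abelian_group_ell2: "abelian_group ell2"
proof (rule abelian_groupI)
  show "\<exists>y\<in>carrier ell2. y \<oplus>\<^bsub>ell2\<^esub> x = \<zero>\<^bsub>ell2\<^esub>" if "x \<in> carrier ell2" for x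
    using that l2_minus by (auto intro!: bexI[of _ "- x"])
qed (auto simp: l2_add_bound add.assoc add.commute)

lemma ell2_diff: "x \<in> l2 \<Longrightarrow> y \<in> l2 \<Longrightarrow> x \<ominus>\<^bsub>ell2\<^esub> y = x - y"
  using abelian_group.minus_equality[OF abelian_group_ell2, of "- y" y]
  by (simp add: a_minus_def l2_minus)

lemma hnorm_ell2: "x \<in> l2 \<Longrightarrow> hnorm ell2 x = sqrt (lsq x)"
  by (simp add: hnorm_def Re_ip_self)

lemma scl_algebra:
  "scl (a + b) x = scl a x + scl b x" "scl a (x + y) = scl a x + scl a y"
  "scl (a * b) x = scl a (scl b x)" "scl 1 x = x"
  by (auto simp: scl_def fun_eq_iff algebra_simps)

lemma hilbert_space_ell2: "hilbert_space ell2"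
proof (intro hilbert_space.intro module.intro module_axioms.intro hilbert_space_axioms.intro
    cring_complex_field abelian_group_ell2)
  show "0 < Re (inner_prod ell2 x x)" if "x \<in> carrier ell2" "x \<noteq> \<zero>\<^bsub>ell2\<^esub>" for x
    using that lsq_eq_0[of x] by (auto simp: Re_ip_self not_le[symmetric])
  show "\<exists>l\<in>carrier ell2. (\<lambda>n. hnorm ell2 (X n \<ominus>\<^bsub>ell2\<^esub> l)) \<longlonglongrightarrow> 0"
    if X: "\<And>n :: nat. X n \<in> carrier ell2"
      and C: "\<And>e. 0 < e \<Longrightarrow> \<exists>N. \<forall>m\<ge>N. \<forall>n\<ge>N. hnorm ell2 (X m \<ominus>\<^bsub>ell2\<^esub> X n) < e" for X
  proof -
    have X': "X n \<in> l2" for n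
      using X by simp
    have norm_eq: "hnorm ell2 (X n \<ominus>\<^bsub>ell2\<^esub> y) = sqrt (lsq (X n - y))" if "y \<in> l2" for n y
      using X' that by (simp add: ell2_diff hnorm_ell2 l2_diff)
    obtain l where l: "l \<in> l2" "(\<lambda>n. lsq (X n - l)) \<longlonglongrightarrow> 0"
    proof (rule l2_complete[OF X'])
      fix e :: real assume "0 < e"
      then show "\<exists>N. \<forall>m\<ge>N. \<forall>n\<ge>N. lsq (X m - X n) < e"
        using C[of "sqrt e"] X' by (simp add: norm_eq)
    qed
    have "(\<lambda>n. sqrt (lsq (X n - l))) \<longlonglongrightarrow> sqrt 0"
      by (intro tendsto_real_sqrt l)
    then show ?thesis
      using l(1) by (auto simp: norm_eq)
  qed
qed (auto simp: complex_field_def l2_scl l2_add_bound ip_add_left ip_scl_left ip_commute[symmetric]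
    scl_algebra)

text \<open>Squared norms avoid roots, and a nonnegative constant lets the bounds of two operators
  be multiplied.\<close>

lemma bounded_operators_ell2:
  "T \<in> bounded_operators ell2 \<longleftrightarrow> T \<in> l2 \<rightarrow>\<^sub>E l2 \<and> (\<forall>x\<in>l2. \<forall>y\<in>l2. T (x + y) = T x + T y) \<and>
    (\<forall>c. \<forall>x\<in>l2. T (scl c x) = scl c (T x)) \<and> (\<exists>C\<ge>0. \<forall>x\<in>l2. lsq (T x) \<le> C * lsq x)"
proof -
  have "(\<exists>C. \<forall>x\<in>l2. hnorm ell2 (T x) \<le> C * hnorm ell2 x) \<longleftrightarrow> (\<exists>C\<ge>0. \<forall>x\<in>l2. lsq (T x) \<le> C * lsq x)"
    if T: "T \<in> l2 \<rightarrow>\<^sub>E l2"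
  proof
    have Tx: "T x \<in> l2" if "x \<in> l2" for x
      using T that by auto
    {
      assume "\<exists>C. \<forall>x\<in>l2. hnorm ell2 (T x) \<le> C * hnorm ell2 x"
      then obtain C where C: "\<And>x. x \<in> l2 \<Longrightarrow> sqrt (lsq (T x)) \<le> C * sqrt (lsq x)"
        using Tx by (auto simp: hnorm_ell2)
      have "lsq (T x) \<le> C\<^sup>2 * lsq x" if "x \<in> l2" for x
        using power_mono[OF C[OF that], of 2] lsq_nonneg[of "T x"] lsq_nonneg[of x]
        by (simp add: power_mult_distrib)
      then show "\<exists>C\<ge>0. \<forall>x\<in>l2. lsq (T x) \<le> C * lsq x"
        by (intro exI[of _ "C\<^sup>2"]) auto
    next
      assume "\<exists>C\<ge>0. \<forall>x\<in>l2. lsq (T x) \<le> C * lsq x"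
      then obtain C where C: "\<And>x. x \<in> l2 \<Longrightarrow> lsq (T x) \<le> C * lsq x"
        by blast
      have "hnorm ell2 (T x) \<le> sqrt C * hnorm ell2 x" if "x \<in> l2" for x
        using real_sqrt_le_mono[OF C[OF that]] that Tx by (simp add: hnorm_ell2 real_sqrt_mult)
      then show "\<exists>C. \<forall>x\<in>l2. hnorm ell2 (T x) \<le> C * hnorm ell2 x"
        by blast
    }
  qed
  then show ?thesis
    unfolding bounded_operators_def by auto
qed

lemma op_monoid_ell2: "monoid (op_monoid ell2)"
proof (rule monoidI)
  fix S T assume "S \<in> carrier (op_monoid ell2)" "T \<in> carrier (op_monoid ell2)"
  then have S: "S \<in> bounded_operators ell2" and T: "T \<in> bounded_operators ell2"
    by (auto simp: op_monoid_def)
  have Sx: "S x \<in> l2" and Tx: "T x \<in> l2" if "x \<in> l2" for x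
    using S T that unfolding bounded_operators_ell2 by auto
  obtain C where C: "0 \<le> C" "\<And>x. x \<in> l2 \<Longrightarrow> lsq (S x) \<le> C * lsq x"
    using S unfolding bounded_operators_ell2 by blast
  obtain D where D: "0 \<le> D" "\<And>x. x \<in> l2 \<Longrightarrow> lsq (T x) \<le> D * lsq x"
    using T unfolding bounded_operators_ell2 by blast
  have "lsq (S (T x)) \<le> (C * D) * lsq x" if "x \<in> l2" for x
  proof -
    have "lsq (S (T x)) \<le> C * lsq (T x)"
      using C Tx that by blast
    also have "\<dots> \<le> C * (D * lsq x)"
      using C D that by (intro mult_left_mono) auto
    finally show ?thesis
      by (simp add: mult.assoc)
  qed
  moreover have "0 \<le> C * D"
    using C D by simp
  ultimately have "\<exists>C\<ge>0. \<forall>x\<in>l2. lsq (S (T x)) \<le> C * lsq x"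
    by blast
  then show "S \<otimes>\<^bsub>op_monoid ell2\<^esub> T \<in> carrier (op_monoid ell2)"
    using S T Sx Tx unfolding op_monoid_def
    by (auto simp: bounded_operators_ell2 compose_def l2_add_bound l2_scl)
next
  show "\<one>\<^bsub>op_monoid ell2\<^esub> \<in> carrier (op_monoid ell2)"
    by (auto simp: op_monoid_def bounded_operators_ell2 l2_add_bound l2_scl intro!: exI[of _ 1])
next
  fix S T U
  assume "S \<in> carrier (op_monoid ell2)" "T \<in> carrier (op_monoid ell2)" "U \<in> carrier (op_monoid ell2)"
  then show "S \<otimes>\<^bsub>op_monoid ell2\<^esub> T \<otimes>\<^bsub>op_monoid ell2\<^esub> U = S \<otimes>\<^bsub>op_monoid ell2\<^esub> (T \<otimes>\<^bsub>op_monoid ell2\<^esub> U)"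
    by (auto simp: op_monoid_def compose_def bounded_operators_ell2 fun_eq_iff)
next
  fix S assume "S \<in> carrier (op_monoid ell2)"
  then have S: "S \<in> l2 \<rightarrow>\<^sub>E l2"
    by (simp add: op_monoid_def bounded_operators_ell2)
  then show "\<one>\<^bsub>op_monoid ell2\<^esub> \<otimes>\<^bsub>op_monoid ell2\<^esub> S = S" "S \<otimes>\<^bsub>op_monoid ell2\<^esub> \<one>\<^bsub>op_monoid ell2\<^esub> = S"
    by (auto simp: op_monoid_def compose_def fun_eq_iff PiE_def extensional_def)
qed

lemma reindex_l2:
  assumes "bij d"
  shows "(\<lambda>i. v (d i)) \<in> l2 \<longleftrightarrow> v \<in> l2" "lsq (\<lambda>i. v (d i)) = lsq v"
  using summable_on_reindex_bij_betw[OF assms, of "\<lambda>i. (cmod (v i))\<^sup>2"]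
    infsum_reindex_bij_betw[OF assms, of "\<lambda>i. (cmod (v i))\<^sup>2"]
  by (simp_all add: l2_def lsq_def)

lemma littlewood_exists: "\<exists>S f a b. littlewood S f a b"
proof -
  define P where "P j S f a b \<longleftrightarrow> finite S \<and> (\<forall>x s. 0 \<le> a x s) \<and> (\<forall>x s. 0 \<le> b x s) \<and>
    (\<forall>s\<in>S. \<forall>x. a x s + b x s = f s) \<and> (\<forall>x. (\<Sum>s\<in>S. a x s) \<le> 2) \<and>
    (\<forall>z. (\<Sum>s\<in>S. b (z - s) s) \<le> 2) \<and> real j \<le> (\<Sum>s\<in>S. (f s)\<^sup>2)"
    for j :: nat and S :: "tgrp set" and f :: "tgrp \<Rightarrow> real" and a b :: "tgrp \<Rightarrow> tgrp \<Rightarrow> real"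
  have "\<exists>S f a b. P j S f a b" for j
  proof (rule littlewood_unbounded[of "real j"])
    fix S :: "tgrp set" and f :: "tgrp \<Rightarrow> real" and a b :: "tgrp \<Rightarrow> tgrp \<Rightarrow> real"
    assume "finite S" "\<And>x s. 0 \<le> a x s" "\<And>x s. 0 \<le> b x s" "\<And>x s. s \<in> S \<Longrightarrow> a x s + b x s = f s"
      "\<And>x. (\<Sum>s\<in>S. a x s) \<le> 2" "\<And>z. (\<Sum>s\<in>S. b (z - s) s) \<le> 2" "real j \<le> (\<Sum>s\<in>S. (f s)\<^sup>2)"
    then have "P j S f a b"
      unfolding P_def by blast
    then show "\<exists>S f a b. P j S f a b"
      by blast
  qed
  then have "\<forall>j. \<exists>t. P j (fst t) (fst (snd t)) (fst (snd (snd t))) (snd (snd (snd t)))"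
    by simp
  from choice[OF this] obtain t where
    t: "\<forall>j. P j (fst (t j)) (fst (snd (t j))) (fst (snd (snd (t j)))) (snd (snd (snd (t j))))"
    by blast
  have "littlewood (\<lambda>j. fst (t j)) (\<lambda>j. fst (snd (t j))) (\<lambda>j. fst (snd (snd (t j))))
      (\<lambda>j. snd (snd (snd (t j))))"
    using t unfolding P_def by unfold_locales blast+
  then show ?thesis
    by blast
qed

section \<open>Transfer to groups that map onto the torsion group\<close>

lemma UnitsI:
  assumes "x \<in> carrier G" "y \<in> carrier G" "x \<otimes>\<^bsub>G\<^esub> y = \<one>\<^bsub>G\<^esub>" "y \<otimes>\<^bsub>G\<^esub> x = \<one>\<^bsub>G\<^esub>"
  shows "x \<in> Units G"
  using assms unfolding Units_def by blast

lemma op_monoid_mult: "x \<in> l2 \<Longrightarrow> (S \<otimes>\<^bsub>op_monoid ell2\<^esub> T) x = S (T x)"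
  by (simp add: op_monoid_def compose_def)

text \<open>If \<open>S\<close> makes the pulled-back representation unitary, the inner product
  transported by the inverse of \<open>S\<close> is an invariant form equivalent to the norm;
  surjectivity of \<open>\<psi>\<close> makes it invariant under the whole torsion group. A
  bijection renames the coordinates, as the vectors have to be sequences.\<close>

lemma not_unitarizable_if_onto_tgrp:
  fixes G (structure) and \<psi> :: "'g \<Rightarrow> tgrp"
  assumes "group G" and \<psi>: "\<And>x y. x \<in> carrier G \<Longrightarrow> y \<in> carrier G \<Longrightarrow> \<psi> (x \<otimes> y) = \<psi> x + \<psi> y"
    and onto: "\<psi> ` carrier G = UNIV"
  shows "\<not> unitarizable TYPE(nat \<Rightarrow> complex) G"
proof
  assume unit: "unitarizable TYPE(nat \<Rightarrow> complex) G"
  interpret group G by fact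
  obtain S f a b where "littlewood S f a b"
    using littlewood_exists by blast
  then interpret littlewood S f a b .
  have \<psi>_one: "\<psi> \<one> = 0"
  proof -
    have "\<psi> \<one> + \<psi> \<one> = \<psi> \<one> + 0"
      using \<psi>[of \<one> \<one>] by simp
    then show ?thesis
      by (simp only: add_left_cancel)
  qed
  have "infinite (UNIV :: coord set)"
    by (simp add: finite_prod)
  then obtain e :: "nat \<Rightarrow> coord" where e: "bij e"
    using bij_betw_from_nat_into[of "UNIV :: coord set"] by auto
  define d where "d = inv_into UNIV e"
  have d: "bij d" and ed [simp]: "e (d i) = i" and de [simp]: "d (e n) = n" for i n
    using e by (auto simp: d_def bij_imp_bij_inv bij_is_surj surj_f_inv_f bij_is_inj)
  define pull where "pull v = (\<lambda>i. v (d i))" for v :: "nat \<Rightarrow> complex"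
  define push where "push u = (\<lambda>n. u (e n))" for u :: "coord \<Rightarrow> complex"
  have pull_push [simp]: "pull (push u) = u" and push_pull [simp]: "push (pull v) = v" for u v
    by (simp_all add: pull_def push_def)
  have pull_l2: "pull v \<in> l2 \<longleftrightarrow> v \<in> l2" "lsq (pull v) = lsq v" for v
    unfolding pull_def by (rule reindex_l2[OF d])+
  have push_l2: "push u \<in> l2 \<longleftrightarrow> u \<in> l2" "lsq (push u) = lsq u" for u
    unfolding push_def by (rule reindex_l2[OF e])+
  have pull_add: "pull (u + v) = pull u + pull v" and pull_scl: "pull (scl c u) = scl c (pull u)"
    for u v c
    by (simp_all add: pull_def scl_def fun_eq_iff)
  have push_add: "push (u + v) = push u + push v" and push_scl: "push (scl c u) = scl c (push u)"
    for u v c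
    by (simp_all add: push_def scl_def fun_eq_iff)
  define \<pi> where "\<pi> g = (\<lambda>v\<in>l2. push (rho (\<psi> g) (pull v)))" for g
  have \<pi>_l2: "\<pi> g v \<in> l2" "lsq (\<pi> g v) \<le> 34 * lsq v" if "v \<in> l2" for g v
    using that rho_l2[of "pull v" "\<psi> g"] by (simp_all add: \<pi>_def push_l2 pull_l2)
  have \<pi>_bounded: "\<pi> g \<in> bounded_operators ell2" for g
    unfolding bounded_operators_ell2
  proof (intro conjI ballI allI exI[of _ 34])
    show "\<pi> g \<in> l2 \<rightarrow>\<^sub>E l2"
      using \<pi>_l2 by (auto simp: \<pi>_def)
    show "lsq (\<pi> g x) \<le> 34 * lsq x" if "x \<in> l2" for x
      by (rule \<pi>_l2(2)[OF that])
  qed (auto simp: \<pi>_def l2_add_bound l2_scl pull_add push_add pull_scl push_scl rho_add rho_scl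
      push_l2 pull_l2 rho_l2)
  have \<pi>_mult: "\<pi> (g \<otimes> h) = \<pi> g \<otimes>\<^bsub>op_monoid ell2\<^esub> \<pi> h" if "g \<in> carrier G" "h \<in> carrier G" for g h
  proof
    fix v
    show "\<pi> (g \<otimes> h) v = (\<pi> g \<otimes>\<^bsub>op_monoid ell2\<^esub> \<pi> h) v"
    proof (cases "v \<in> l2")
      case True
      then show ?thesis
        using \<pi>_l2(1)[OF True, of h] that by (simp add: op_monoid_mult) (simp add: \<pi>_def \<psi> rho_comp)
    next
      case False
      then show ?thesis
        by (simp add: op_monoid_def compose_def \<pi>_def)
    qed
  qed
  have \<pi>_one: "\<pi> \<one> = \<one>\<^bsub>op_monoid ell2\<^esub>"
    by (auto simp: \<pi>_def \<psi>_one rho_zero op_monoid_def)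
  have carr: "\<pi> g \<in> carrier (op_monoid ell2)" for g
    using \<pi>_bounded by (simp add: op_monoid_def)
  have "\<pi> g \<in> Units (op_monoid ell2)" if g: "g \<in> carrier G" for g
    by (rule UnitsI[of _ _ "\<pi> (inv g)"]) (use g carr \<pi>_mult[of g "inv g"] \<pi>_mult[of "inv g" g] \<pi>_one in auto)
  then have rep: "representation G ell2 \<pi>"
    unfolding representation_def by (auto simp: hom_def units_of_carrier units_of_mult \<pi>_mult)
  have "op_norm ell2 (\<pi> g) \<le> sqrt 34" for g
    unfolding op_norm_def
  proof (rule cSUP_least)
    have "hnorm ell2 0 \<le> 1"
      by (simp add: hnorm_ell2) (simp add: lsq_def)
    then show "{x \<in> carrier ell2. hnorm ell2 x \<le> 1} \<noteq> {}"
      by force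
    fix x assume "x \<in> {x \<in> carrier ell2. hnorm ell2 x \<le> 1}"
    then have x: "x \<in> l2" "lsq x \<le> 1"
      by (auto simp: hnorm_ell2)
    then have "lsq (\<pi> g x) \<le> 34"
      using \<pi>_l2(2)[OF x(1), of g] by linarith
    then show "hnorm ell2 (\<pi> g x) \<le> sqrt 34"
      using \<pi>_l2(1)[OF x(1)] by (simp add: hnorm_ell2)
  qed
  then have "uniformly_bounded G ell2 \<pi>"
    unfolding uniformly_bounded_def by (auto simp: bdd_above_def)
  then have "unitarizable_representation G ell2 \<pi>"
    using unit hilbert_space_ell2 rep unfolding unitarizable_def by blast
  then obtain S where S: "S \<in> Units (op_monoid ell2)"
    and U: "unitary_representation G ell2
      (\<lambda>g. inv\<^bsub>op_monoid ell2\<^esub> S \<otimes>\<^bsub>op_monoid ell2\<^esub> \<pi> g \<otimes>\<^bsub>op_monoid ell2\<^esub> S)"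
    unfolding unitarizable_representation_def by blast
  interpret M: monoid "op_monoid ell2"
    by (rule op_monoid_ell2)
  define R where "R = inv\<^bsub>op_monoid ell2\<^esub> S"
  have "S \<in> bounded_operators ell2"
    using M.Units_closed[OF S] by (simp add: op_monoid_def)
  then obtain C where Sx: "\<And>x. x \<in> l2 \<Longrightarrow> S x \<in> l2"
    and C: "0 \<le> C" "\<And>x. x \<in> l2 \<Longrightarrow> lsq (S x) \<le> C * lsq x"
    unfolding bounded_operators_ell2 by blast
  have "R \<in> bounded_operators ell2"
    using M.Units_inv_closed[OF S] by (simp add: op_monoid_def R_def)
  then obtain D where Rx: "\<And>x. x \<in> l2 \<Longrightarrow> R x \<in> l2"
    and R_add: "\<And>x y. x \<in> l2 \<Longrightarrow> y \<in> l2 \<Longrightarrow> R (x + y) = R x + R y"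
    and R_scl: "\<And>c x. x \<in> l2 \<Longrightarrow> R (scl c x) = scl c (R x)"
    and D: "0 \<le> D" "\<And>x. x \<in> l2 \<Longrightarrow> lsq (R x) \<le> D * lsq x"
    unfolding bounded_operators_ell2 by blast
  have SR: "S (R x) = x" if "x \<in> l2" for x
    using fun_cong[OF M.Units_r_inv[OF S], of x] that
    by (simp add: op_monoid_mult R_def) (simp add: op_monoid_def)
  define B where "B u v = Re (ip (R (push u)) (R (push v)))" for u v
  have B_self: "B u u = lsq (R (push u))" if "u \<in> l2" for u
    using that Rx by (simp add: B_def Re_ip_self push_l2)
  \<comment> \<open>\<open>C\<close> bounds \<open>S\<close> and gives the lower estimate,
    \<open>D\<close> bounds its inverse and gives the upper one; the 1 secures positivity.\<close>
  have "equivalent_form B (C + D + 1)"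
  proof
    fix u v w :: "coord \<Rightarrow> complex" and t :: real
    assume u: "u \<in> l2"
    have pu: "push u \<in> l2"
      using u by (simp add: push_l2)
    have "lsq u = lsq (S (R (push u)))"
      using SR[OF pu] by (simp add: push_l2)
    also have "\<dots> \<le> C * lsq (R (push u))"
      by (rule C(2)[OF Rx[OF pu]])
    also have "\<dots> \<le> (C + D + 1) * lsq (R (push u))"
      using C D by (intro mult_right_mono) (auto simp: lsq_nonneg)
    finally show "lsq u \<le> (C + D + 1) * B u u"
      using B_self[OF u] by simp
    have "lsq (R (push u)) \<le> D * lsq (push u)"
      by (rule D(2)[OF pu])
    also have "\<dots> \<le> (C + D + 1) * lsq (push u)"
      using C D by (intro mult_right_mono) (auto simp: lsq_nonneg)
    finally show "B u u \<le> (C + D + 1) * lsq u"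
      using B_self[OF u] by (simp add: push_l2)
    assume v: "v \<in> l2"
    show "B u v = B v u"
      unfolding B_def by (subst ip_commute) simp
    show "B (scl (of_real t) u) v = t * B u v"
      using u v Rx by (simp add: B_def push_scl R_scl push_l2 ip_scl_left)
    assume w: "w \<in> l2"
    show "B (u + v) w = B u w + B v w"
      using u v w Rx by (simp add: B_def push_add R_add push_l2 ip_add_left)
  next
    show "0 < C + D + 1"
      using C D by simp
  qed
  moreover have "B (rho q u) (rho q u) = B u u" if u: "u \<in> l2" for q u
  proof -
    obtain g where g: "g \<in> carrier G" "q = \<psi> g"
      using onto by blast
    let ?U = "R \<otimes>\<^bsub>op_monoid ell2\<^esub> \<pi> g \<otimes>\<^bsub>op_monoid ell2\<^esub> S"
    have "?U \<in> unitary_operators ell2"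
      using U g(1) by (simp add: unitary_representation_def R_def)
    then have iso: "ip (?U x) (?U x) = ip x x" if "x \<in> l2" for x
      using that by (simp add: unitary_operators_def)
    let ?x = "R (push u)"
    have pu: "push u \<in> l2"
      using u by (simp add: push_l2)
    have "?U ?x = R (\<pi> g (S ?x))"
      using Rx[OF pu] Sx by (simp add: op_monoid_mult)
    also have "\<dots> = R (push (rho q u))"
      using pu by (simp add: SR \<pi>_def g)
    finally have "?U ?x = R (push (rho q u))" .
    then show ?thesis
      using iso[OF Rx[OF pu]] by (simp add: B_def)
  qed
  ultimately show False
    by (rule no_invariant_form)
qed

section \<open>The torsion-free cover\<close>

primrec mulq :: "nat \<Rightarrow> tgrp \<Rightarrow> tgrp" where
  "mulq 0 q = 0"
| "mulq (Suc n) q = mulq n q + q"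

lemma mulq_add: "mulq (m + n) q = mulq m q + mulq n q"
  by (induction n) (simp_all add: add.assoc)

lemma mulq_ev: "mulq n (ev w) = ev (wpow w n)"
  by (induction n) (simp_all add: wpow_Suc')

lemma tgrp_periodic: "\<exists>n>0. mulq n q = 0"
  using tgrp_torsion[of "rep_tgrp q"] mulq_ev[of "expo (rep_tgrp q)" "rep_tgrp q"] expo_pos
  by (metis ev_rep)

type_synonym flow = "tgrp \<Rightarrow> bool \<Rightarrow> int"

definition shift :: "tgrp \<Rightarrow> flow \<Rightarrow> flow" where
  "shift q v = (\<lambda>x. v (- q + x))"

lemma shift_0 [simp]: "shift 0 v = v"
  by (simp add: shift_def)

lemma shift_shift: "shift q (shift r v) = shift (q + r) v"
  by (simp add: shift_def minus_add add.assoc del: add_uminus_conv_diff)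

lemma shift_plus: "shift q (v + w) = shift q v + shift q w"
  by (simp add: shift_def fun_eq_iff)

text \<open>The ambient semidirect product with arbitrary integer flows. The Magnus embedding takes
  the generators to the single edges at 0.\<close>

definition magnus :: "(flow \<times> tgrp) monoid" where
  "magnus = \<lparr>carrier = UNIV, monoid.mult = (\<lambda>(v, q) (w, r). (v + shift q w, q + r)), one = (0, 0)\<rparr>"

lemma magnus_simps [simp]:
  "carrier magnus = UNIV" "(v, q) \<otimes>\<^bsub>magnus\<^esub> (w, r) = (v + shift q w, q + r)" "\<one>\<^bsub>magnus\<^esub> = (0, 0)"
  by (simp_all add: magnus_def)

lemma group_magnus: "group magnus"
proof (rule groupI)
  fix x y z :: "flow \<times> tgrp"
  obtain v q w r u p where xyz: "x = (v, q)" "y = (w, r)" "z = (u, p)"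
    by (cases x, cases y, cases z) auto
  show "x \<otimes>\<^bsub>magnus\<^esub> y \<otimes>\<^bsub>magnus\<^esub> z = x \<otimes>\<^bsub>magnus\<^esub> (y \<otimes>\<^bsub>magnus\<^esub> z)"
    by (simp add: xyz shift_plus shift_shift add.assoc)
  show "\<one>\<^bsub>magnus\<^esub> \<otimes>\<^bsub>magnus\<^esub> x = x"
    by (simp add: xyz)
  have "(- shift (- q) v, - q) \<otimes>\<^bsub>magnus\<^esub> x = \<one>\<^bsub>magnus\<^esub>"
    by (simp add: xyz)
  then show "\<exists>y\<in>carrier magnus. y \<otimes>\<^bsub>magnus\<^esub> x = \<one>\<^bsub>magnus\<^esub>"
    by auto
qed auto

lemma inv_magnus: "inv\<^bsub>magnus\<^esub> (v, q) = (- shift (- q) v, - q)"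
  by (rule group.inv_equality[OF group_magnus]) auto

text \<open>
  \<open>(v, q)\<close> is a path from \<open>0\<close> to \<open>q\<close> in the Cayley graph if \<open>v\<close> is a finitely supported flow with
  boundary \<open>q - 0\<close>; the boundary is tested against all functions on the vertices.
\<close>

definition pairing :: "tgrp set \<Rightarrow> flow \<Rightarrow> (tgrp \<Rightarrow> int) \<Rightarrow> int" where
  "pairing A v \<Psi> = (\<Sum>x\<in>A. \<Sum>c\<in>UNIV. v x c * (\<Psi> (x + gen c) - \<Psi> x))"

definition path_flow :: "flow \<times> tgrp \<Rightarrow> bool" where
  "path_flow y \<longleftrightarrow> finite {x. fst y x \<noteq> 0} \<and>
    (\<forall>\<Psi>. pairing {x. fst y x \<noteq> 0} (fst y) \<Psi> = \<Psi> (snd y) - \<Psi> 0)"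

lemma pairing_superset:
  assumes "finite A" "{x. v x \<noteq> 0} \<subseteq> A"
  shows "pairing {x. v x \<noteq> 0} v \<Psi> = pairing A v \<Psi>"
  unfolding pairing_def
  by (rule sum.mono_neutral_left) (use assms in \<open>auto simp: zero_fun_def\<close>)

text \<open>Concatenation of paths: translated by \<open>q\<close>, the second flow leads from
  \<open>q\<close> to \<open>q + r\<close>, and the boundaries add up.\<close>

lemma path_flow_mult:
  assumes "path_flow y" "path_flow z"
  shows "path_flow (y \<otimes>\<^bsub>magnus\<^esub> z)"
proof -
  obtain v q w r where yz: "y = (v, q)" "z = (w, r)"
    by (cases y, cases z) auto
  let ?A = "{x. v x \<noteq> 0}" and ?B = "{x. w x \<noteq> 0}"
  have fin: "finite ?A" "finite ?B"
    using assms by (auto simp: path_flow_def yz)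
  let ?C = "(+) q ` ?B"
  have "x \<in> ?C" if "shift q w x \<noteq> 0" for x
    using that by (intro image_eqI[of _ _ "- q + x"]) (auto simp: shift_def add.assoc[symmetric])
  then have sub: "{x. (v + shift q w) x \<noteq> 0} \<subseteq> ?A \<union> ?C" "{x. shift q w x \<noteq> 0} \<subseteq> ?C"
    by auto
  have "pairing {x. (v + shift q w) x \<noteq> 0} (v + shift q w) \<Psi> = \<Psi> (q + r) - \<Psi> 0" for \<Psi>
  proof -
    have "pairing {x. (v + shift q w) x \<noteq> 0} (v + shift q w) \<Psi> = pairing (?A \<union> ?C) (v + shift q w) \<Psi>"
      by (rule pairing_superset) (use fin sub in auto)
    also have "\<dots> = pairing (?A \<union> ?C) v \<Psi> + pairing (?A \<union> ?C) (shift q w) \<Psi>"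
      unfolding pairing_def plus_fun_apply distrib_right sum.distrib ..
    also have "pairing (?A \<union> ?C) v \<Psi> = pairing ?A v \<Psi>"
      by (rule pairing_superset[symmetric]) (use fin in auto)
    also have "\<dots> = \<Psi> q - \<Psi> 0"
      using assms(1) by (simp add: path_flow_def yz)
    also have "pairing (?A \<union> ?C) (shift q w) \<Psi> = pairing {x. shift q w x \<noteq> 0} (shift q w) \<Psi>"
      by (rule pairing_superset[symmetric]) (use fin sub(2) in auto)
    also have "\<dots> = pairing ?C (shift q w) \<Psi>"
      by (rule pairing_superset) (use fin sub(2) in auto)
    also have "\<dots> = pairing ?B w (\<lambda>x. \<Psi> (q + x))"
      unfolding pairing_def by (subst sum.reindex) (auto simp: inj_on_def shift_def add.assoc)
    also have "\<dots> = \<Psi> (q + r) - \<Psi> q"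
      using assms(2) by (simp add: path_flow_def yz)
    finally show ?thesis
      by linarith
  qed
  moreover have "finite {x. (v + shift q w) x \<noteq> 0}"
    by (rule finite_subset[OF sub(1)]) (use fin in auto)
  ultimately show ?thesis
    by (simp add: path_flow_def yz)
qed

lemma path_flow_inv:
  assumes "path_flow y"
  shows "path_flow (inv\<^bsub>magnus\<^esub> y)"
proof -
  obtain v q where y: "y = (v, q)"
    by (cases y)
  let ?A = "{x. v x \<noteq> 0}" and ?w = "- shift (- q) v"
  have fin: "finite ?A"
    using assms by (simp add: path_flow_def y)
  have supp: "{x. ?w x \<noteq> 0} = (+) (- q) ` ?A"
  proof (intro equalityI subsetI)
    fix x assume "x \<in> {x. ?w x \<noteq> 0}"
    then show "x \<in> (+) (- q) ` ?A"
      by (intro image_eqI[of _ _ "q + x"]) (auto simp: shift_def add.assoc[symmetric])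
  qed (auto simp: shift_def add.assoc[symmetric])
  have "pairing {x. ?w x \<noteq> 0} ?w \<Psi> = \<Psi> (- q) - \<Psi> 0" for \<Psi>
  proof -
    have "pairing {x. ?w x \<noteq> 0} ?w \<Psi> = - pairing ?A v (\<lambda>x. \<Psi> (- q + x))"
      unfolding supp pairing_def
      by (subst sum.reindex) (auto simp: inj_on_def shift_def add.assoc sum_negf[symmetric] simp flip: add.assoc intro!: sum.cong)
    then show ?thesis
      using assms by (simp add: path_flow_def y)
  qed
  moreover have "finite {x. ?w x \<noteq> 0}"
    unfolding supp using fin by simp
  ultimately show ?thesis
    unfolding path_flow_def y inv_magnus fst_conv snd_conv by blast
qed

definition edge :: "bool \<Rightarrow> flow \<times> tgrp" where
  "edge c = ((\<lambda>x c'. if x = 0 \<and> c' = c then 1 else 0), gen c)"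

definition magnus_gens :: "(flow \<times> tgrp) set" where
  "magnus_gens = range edge"

lemma path_flow_edge: "path_flow (edge c)"
proof -
  have "{x. fst (edge c) x \<noteq> 0} = {0}"
    by (auto simp: edge_def fun_eq_iff)
  then show ?thesis
    by (cases c) (auto simp: path_flow_def pairing_def edge_def UNIV_bool)
qed

lemma path_flow_generate:
  assumes "y \<in> generate magnus magnus_gens"
  shows "path_flow y"
  using assms
proof (induction rule: generate.induct)
  case one
  then show ?case
    by (simp add: path_flow_def pairing_def)
next
  case (incl h)
  then show ?case
    using path_flow_edge by (auto simp: magnus_gens_def)
next
  case (inv h)
  then show ?case
    using path_flow_inv[OF path_flow_edge] by (auto simp: magnus_gens_def)
next
  case (eng h1 h2)
  then show ?case
    using path_flow_mult by blast
qed

lemma pow_magnus: "(v, q) [^]\<^bsub>magnus\<^esub> n = ((\<lambda>x c. \<Sum>i<n. v (- mulq i q + x) c), mulq n q)"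
proof (induction n)
  case 0
  then show ?case
    by (simp add: fun_eq_iff)
next
  case (Suc n)
  then show ?case
    by (simp add: shift_def fun_eq_iff)
qed

lemma sum_lessThan_add: "(\<Sum>i<m + n. g i) = (\<Sum>i<m. g i) + (\<Sum>i<n. g (m + i :: nat) :: 'a::comm_monoid_add)"
  by (induction n) (simp_all add: add.assoc)

text \<open>
  Let \<open>q\<close> have order \<open>m\<close>, and let \<open>\<Psi>\<close> be the index along the orbits of \<open>q\<close>, so that
  \<open>\<Psi> (q + x) = \<Psi> x + 1\<close> modulo \<open>m\<close>. The coboundary of \<open>\<Psi>\<close> is \<open>q\<close>-invariant modulo \<open>m\<close>,
  hence pairs to \<open>0\<close> with a flow whose sums over the orbits vanish; but the pairing with a path from
  \<open>0\<close> to \<open>q\<close> is \<open>1\<close>.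
\<close>

lemma path_flow_torsion:
  assumes y: "path_flow (v, q)" and n: "0 < n" "mulq n q = 0"
    and sum0: "\<And>x c. (\<Sum>i<n. v (- mulq i q + x) c) = 0"
  shows "q = 0"
proof -
  define m where "m = (LEAST k. 0 < k \<and> mulq k q = 0)"
  have m: "0 < m" "mulq m q = 0"
    using LeastI[of "\<lambda>k. 0 < k \<and> mulq k q = 0" n] n by (auto simp: m_def)
  have least: "m \<le> k" if "0 < k" "mulq k q = 0" for k
    unfolding m_def by (rule Least_le) (use that in blast)
  have mult: "mulq (l * m + k) q = mulq k q" for l k
    by (induction l) (simp_all add: mulq_add m(2) add.assoc)
  have mod_m: "mulq (k mod m) q = mulq k q" for k
    using mult[of "k div m" "k mod m"] by simp
  have dvd_m: "m dvd k" if "mulq k q = 0" for k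
    using least[of "k mod m"] mod_m[of k] that m(1)
    by (metis dvd_eq_mod_eq_0 gr0I leD mod_less_divisor)
  have inj: "mulq k q = mulq l q \<Longrightarrow> int m dvd int k - int l" for k l
  proof (induction k l rule: linorder_wlog)
    case (le k l)
    then have "mulq l q = mulq k q + mulq (l - k) q"
      using mulq_add[of k "l - k" q] by simp
    then have "mulq l q + 0 = mulq l q + mulq (l - k) q"
      using le by simp
    then have "mulq (l - k) q = 0"
      by (simp only: add_left_cancel)
    then have "m dvd l - k"
      by (rule dvd_m)
    then have "int m dvd int (l - k)"
      by (simp only: int_dvd_int_iff)
    then show ?case
      using le(1) by (simp add: of_nat_diff dvd_diff_commute)
  next
    case (sym k l)
    then show ?case
      by (metis dvd_diff_commute)
  qed
  \<comment> \<open>\<open>n\<close> is a multiple of the period \<open>m\<close>; every period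
    contributes the same integer, which therefore vanishes.\<close>
  have sum_m: "(\<Sum>i<m. v (- mulq i q + x) c) = 0" for x c
  proof -
    have "(\<Sum>i<l * m. v (- mulq i q + x) c) = int l * (\<Sum>i<m. v (- mulq i q + x) c)" for l
    proof (induction l)
      case (Suc l)
      have "(\<Sum>i<l * m + m. v (- mulq i q + x) c) =
          (\<Sum>i<l * m. v (- mulq i q + x) c) + (\<Sum>i<m. v (- mulq (l * m + i) q + x) c)"
        by (rule sum_lessThan_add)
      also have "(\<Sum>i<m. v (- mulq (l * m + i) q + x) c) = (\<Sum>i<m. v (- mulq i q + x) c)"
        by (simp only: mult)
      finally show ?case
        using Suc by (simp add: algebra_simps)
    qed simp
    moreover obtain l where "n = l * m"
      using dvd_m[OF n(2)] by (metis dvdE mult.commute)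
    ultimately show ?thesis
      using sum0[of x c] n(1) by (simp add: mult_eq_0_iff)
  qed
  define orb where "orb x = range (\<lambda>i. - mulq i q + x)" for x
  \<comment> \<open>Finite order turns negative multiples into nonnegative ones, so the orbits are
    closed in both directions.\<close>
  have neg: "\<exists>j<m. - mulq i q = mulq j q" for i
  proof -
    have "mulq i q + mulq ((m - 1) * i) q = mulq (i * m + 0) q"
      unfolding mulq_add[symmetric] using m(1) by (intro arg_cong[of _ _ "\<lambda>k. mulq k q"])
        (simp add: algebra_simps diff_mult_distrib)
    then have "- mulq i q = mulq ((m - 1) * i) q"
      using mult[of i 0] by (simp add: minus_unique)
    then show ?thesis
      using mod_m[of "(m - 1) * i"] m(1) by (intro exI[of _ "((m - 1) * i) mod m"]) simp
  qed
  have orb_eq: "orb (mulq i q + x) = orb x" for i x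
  proof (intro equalityI subsetI)
    fix z assume "z \<in> orb (mulq i q + x)"
    then obtain j where z: "z = - mulq j q + (mulq i q + x)"
      by (auto simp: orb_def)
    obtain k where k: "- mulq j q = mulq k q"
      using neg by blast
    obtain l where "- mulq (k + i) q = mulq l q"
      using neg by blast
    then have "mulq (k + i) q = - mulq l q"
      by (metis minus_minus)
    then have "z = - mulq l q + x"
      using z k by (simp add: mulq_add add.assoc[symmetric])
    then show "z \<in> orb x"
      by (auto simp: orb_def)
  next
    fix z assume "z \<in> orb x"
    then obtain j where z: "z = - mulq j q + x"
      by (auto simp: orb_def)
    have "- mulq (i + j) q + (mulq i q + x) = z"
    proof -
      have "mulq (i + j) q = mulq i q + mulq j q" "mulq (i + j) q = mulq j q + mulq i q"
        using mulq_add[of i j q] mulq_add[of j i q] by (simp_all add: add.commute[of i j])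
      then show ?thesis
        using z by (simp add: minus_add add.assoc del: add_uminus_conv_diff)
    qed
    then show "z \<in> orb (mulq i q + x)"
      by (auto simp: orb_def)
  qed
  define \<rho> where "\<rho> x = (SOME z. z \<in> orb x)" for x
  have self: "x \<in> orb x" for x
    unfolding orb_def by (rule image_eqI[of _ _ 0]) auto
  have \<rho>_in: "\<rho> x \<in> orb x" for x
    unfolding \<rho>_def by (rule someI[of _ x]) (rule self)
  have \<rho>_cong: "orb x = orb z \<Longrightarrow> \<rho> x = \<rho> z" for x z
    by (simp add: \<rho>_def)
  have \<rho>_shift: "\<rho> (mulq i q + x) = \<rho> x" for i x
    by (rule \<rho>_cong[OF orb_eq])
  have "\<exists>i. x = mulq i q + \<rho> x" for x
  proof -
    obtain i where "\<rho> x = - mulq i q + x"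
      using \<rho>_in by (auto simp: orb_def)
    then have "x = mulq i q + \<rho> x"
      by (simp add: add.assoc[symmetric])
    then show ?thesis ..
  qed
  then obtain idx where idx: "\<And>x. x = mulq (idx x) q + \<rho> x"
    by metis
  define \<Psi> where "\<Psi> x = int (idx x)" for x
  have \<Psi>_shift: "int m dvd \<Psi> (mulq i q + x) - (\<Psi> x + int i)" for i x
  proof -
    have "mulq (idx (mulq i q + x)) q + \<rho> x = mulq i q + x"
      using idx[of "mulq i q + x"] \<rho>_shift by simp
    also have "\<dots> = mulq (i + idx x) q + \<rho> x"
      using idx[of x] by (simp add: mulq_add add.assoc)
    finally have "mulq (idx (mulq i q + x)) q = mulq (i + idx x) q"
      by simp
    from inj[OF this] show ?thesis
      by (simp add: \<Psi>_def algebra_simps)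
  qed
  define D where "D x c = \<Psi> (x + gen c) - \<Psi> x" for x c
  have D_dvd: "int m dvd D x c - D (\<rho> x) c" for x c
  proof -
    have "x + gen c = mulq (idx x) q + (\<rho> x + gen c)"
      using idx[of x] by (metis add.assoc)
    then have "int m dvd \<Psi> (x + gen c) - (\<Psi> (\<rho> x + gen c) + int (idx x))"
      using \<Psi>_shift by simp
    moreover have "int m dvd \<Psi> x - (\<Psi> (\<rho> x) + int (idx x))"
      using \<Psi>_shift[of "idx x" "\<rho> x"] idx[of x] by simp
    ultimately have "int m dvd (\<Psi> (x + gen c) - (\<Psi> (\<rho> x + gen c) + int (idx x))) -
        (\<Psi> x - (\<Psi> (\<rho> x) + int (idx x)))"
      by (rule dvd_diff)
    then show ?thesis
      by (simp add: D_def algebra_simps)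
  qed
  let ?supp = "{x. v x \<noteq> 0}"
  \<comment> \<open>The support is saturated to full orbits, over which the sums of \<open>v\<close>
    vanish.\<close>
  define A where "A = \<Union> (orb ` ?supp)"
  have orb_image: "orb x = (\<lambda>i. - mulq i q + x) ` {..<m}" for x
  proof
    show "orb x \<subseteq> (\<lambda>i. - mulq i q + x) ` {..<m}"
    proof
      fix z assume "z \<in> orb x"
      then obtain i where "z = - mulq i q + x"
        by (auto simp: orb_def)
      then show "z \<in> (\<lambda>i. - mulq i q + x) ` {..<m}"
        using mod_m[of i] m(1) by (intro image_eqI[of _ _ "i mod m"]) auto
    qed
  qed (auto simp: orb_def)
  have "finite ?supp"
    using y by (simp add: path_flow_def)
  then have finA: "finite A"
    by (auto simp: A_def orb_image)
  have orb_sym: "orb z = orb x" if "z \<in> orb x" for x z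
  proof -
    obtain i where "z = - mulq i q + x"
      using \<open>z \<in> orb x\<close> by (auto simp: orb_def)
    then have "x = mulq i q + z"
      by (simp add: add.assoc[symmetric])
    then show ?thesis
      using orb_eq by simp
  qed
  have "?supp \<subseteq> A"
    using self by (auto simp: A_def)
  have fiber: "{x\<in>A. \<rho> x = t} = orb t" if t: "t \<in> \<rho> ` A" for t
  proof (intro equalityI subsetI)
    fix x assume "x \<in> {x\<in>A. \<rho> x = t}"
    then have "orb x = orb t"
      using \<rho>_in[of x] orb_sym by auto
    then show "x \<in> orb t"
      using self by blast
  next
    fix x assume x: "x \<in> orb t"
    obtain z u where z: "t = \<rho> z" "z \<in> orb u" "u \<in> ?supp"
      using t by (auto simp: A_def)
    have eqs: "orb x = orb t" "orb t = orb z" "orb z = orb u"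
      using orb_sym[OF x] orb_sym[OF \<rho>_in[of z]] orb_sym[OF z(2)] z(1) by simp_all
    then have "x \<in> A"
      using self[of x] z(3) by (auto simp: A_def)
    moreover have "\<rho> x = t"
      using \<rho>_cong[of x z] eqs z(1) by simp
    ultimately show "x \<in> {x\<in>A. \<rho> x = t}"
      by simp
  qed
  have orb_sum: "(\<Sum>x\<in>orb t. v x c) = 0" for t c
  proof -
    have "inj_on (\<lambda>i. - mulq i q + t) {..<m}"
    proof (rule inj_onI)
      fix i j assume ij: "i \<in> {..<m}" "j \<in> {..<m}" "- mulq i q + t = - mulq j q + t"
      then have "int m dvd int i - int j"
        by (intro inj) simp
      moreover have "\<bar>int i - int j\<bar> < int m"
        using ij by auto
      ultimately show "i = j"
        using zdvd_imp_le[of "int m" "\<bar>int i - int j\<bar>"] by fastforce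
    qed
    then show ?thesis
      unfolding orb_image using sum_m[of t c] by (simp add: sum.reindex)
  qed
  have "(\<Sum>x\<in>A. v x c * D (\<rho> x) c) = 0" for c
  proof -
    have "(\<Sum>x\<in>A. v x c * D (\<rho> x) c) = (\<Sum>t\<in>\<rho> ` A. \<Sum>x\<in>{x\<in>A. \<rho> x = t}. v x c * D (\<rho> x) c)"
      by (rule sum.image_gen[OF finA])
    also have "\<dots> = (\<Sum>t\<in>\<rho> ` A. (\<Sum>x\<in>orb t. v x c) * D t c)"
      by (rule sum.cong[OF refl]) (simp add: fiber[symmetric] sum_distrib_right)
    also have "\<dots> = 0"
      by (simp add: orb_sum)
    finally show ?thesis .
  qed
  then have zero: "(\<Sum>c\<in>UNIV. \<Sum>x\<in>A. v x c * D (\<rho> x) c) = 0"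
    by simp
  have "\<Psi> q - \<Psi> 0 = pairing ?supp v \<Psi>"
    using y by (simp add: path_flow_def)
  also have "\<dots> = pairing A v \<Psi>"
    by (rule pairing_superset[OF finA \<open>?supp \<subseteq> A\<close>])
  also have "\<dots> = (\<Sum>c\<in>UNIV. \<Sum>x\<in>A. v x c * D x c)"
    unfolding pairing_def D_def by (rule sum.swap)
  also have "\<dots> = (\<Sum>c\<in>UNIV. \<Sum>x\<in>A. v x c * (D x c - D (\<rho> x) c))"
    using zero by (simp add: right_diff_distrib sum_subtractf)
  finally have "int m dvd \<Psi> q - \<Psi> 0"
    using D_dvd by (auto intro!: dvd_sum dvd_mult)
  moreover have "int m dvd \<Psi> q - (\<Psi> 0 + 1)"
    using \<Psi>_shift[of 1 0] by simp
  \<comment> \<open>The flow sees no increment from 0 to \<open>q\<close> modulo \<open>m\<close>,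
    the index along the orbit sees 1; so the order divides 1.\<close>
  ultimately have "int m dvd (\<Psi> q - \<Psi> 0) - (\<Psi> q - (\<Psi> 0 + 1))"
    by (rule dvd_diff)
  then have "m = 1"
    by (simp add: zdvd1_eq)
  then show "q = 0"
    using m(2) by simp
qed

section \<open>Free subgroups\<close>

lemma word_value_append:
  fixes G (structure)
  assumes "group G" "fst ` set u \<subseteq> carrier G" "fst ` set w \<subseteq> carrier G"
  shows "word_value G w \<in> carrier G" "word_value G (u @ w) = word_value G u \<otimes> word_value G w"
proof -
  interpret group G by fact
  have closed: "word_value G w \<in> carrier G" if "fst ` set w \<subseteq> carrier G" for w
    using that by (induction w) (auto simp: word_value_def letter_value_def)
  then show "word_value G w \<in> carrier G"
    using assms by blast
  show "word_value G (u @ w) = word_value G u \<otimes> word_value G w"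
    using assms(2)
  proof (induction u)
    case Nil
    then show ?case
      using closed[OF assms(3)] by (simp add: word_value_def)
  next
    case (Cons l u)
    have "letter_value G l \<in> carrier G" "word_value G u \<in> carrier G"
      using Cons.prems closed[of u] by (auto simp: letter_value_def)
    then show ?case
      using Cons closed[OF assms(3)] by (simp add: word_value_def m_assoc)
  qed
qed

lemma word_value_replicate:
  fixes G (structure)
  assumes "group G" "x \<in> carrier G"
  shows "word_value G (replicate n (x, c)) = (if c then x else inv x) [^] n"
proof -
  interpret group G by fact
  show ?thesis
  proof (induction n)
    case 0
    then show ?case
      by (simp add: word_value_def)
  next
    case (Suc n)
    let ?y = "if c then x else inv x"
    have "?y \<in> carrier G"
      using assms by simp
    have "word_value G (replicate (Suc n) (x, c)) = ?y \<otimes> word_value G (replicate n (x, c))"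
      by (simp add: word_value_def letter_value_def)
    also have "\<dots> = ?y \<otimes> ?y [^] n"
      unfolding Suc ..
    also have "\<dots> = ?y [^] Suc n"
      by (rule nat_pow_Suc2[symmetric]) fact
    finally show ?case .
  qed
qed

lemma successively_replicate: "P a a \<Longrightarrow> successively P (replicate n a)"
  by (induction n rule: induct_nat_012) auto

text \<open>For distinct basis elements the commutator of suitable powers would be a nonempty
  reduced word with trivial value. So the basis has at most one element and the group is
  cyclic.\<close>

lemma comm_group_if_powers_commute:
  fixes G (structure)
  assumes "group G" and basis: "free_basis G X"
    and comm: "\<And>x y. x \<in> carrier G \<Longrightarrow> y \<in> carrier G \<Longrightarrow>
      \<exists>n>0. \<exists>m>0. x [^] (n::nat) \<otimes> y [^] (m::nat) = y [^] m \<otimes> x [^] n"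
  shows "comm_group G"
proof -
  interpret group G by fact
  have X: "X \<subseteq> carrier G" "generate G X = carrier G"
    and red: "\<And>w. w \<noteq> [] \<Longrightarrow> set w \<subseteq> X \<times> UNIV \<Longrightarrow> reduced_word w \<Longrightarrow> word_value G w \<noteq> \<one>"
    using basis unfolding free_basis_def by blast+
  have eq: "x = y" if xy: "x \<in> X" "y \<in> X" for x y
  proof (rule ccontr)
    assume "x \<noteq> y"
    have c: "x \<in> carrier G" "y \<in> carrier G"
      using xy X by auto
    obtain n m :: nat where nm: "n > 0" "m > 0"
      "x [^] n \<otimes> y [^] m = y [^] m \<otimes> x [^] n"
      using comm[OF c] by blast
    let ?w = "replicate n (x, True) @ replicate m (y, True) @ replicate n (x, False) @ replicate m (y, False)"
    have "word_value G ?w = x [^] n \<otimes> (y [^] m \<otimes> (inv x [^] n \<otimes> inv y [^] m))"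
    proof -
      have step: "word_value G (replicate k (z, b) @ w) =
          (if b then z else inv z) [^] k \<otimes> word_value G w"
        if "z \<in> carrier G" "fst ` set w \<subseteq> carrier G" for k b z w
      proof -
        have "fst ` set (replicate k (z, b)) \<subseteq> carrier G"
          using that(1) by auto
        from word_value_append(2)[OF \<open>group G\<close> this that(2)] show ?thesis
          by (simp only: word_value_replicate[OF \<open>group G\<close> that(1)])
      qed
      have sets: "fst ` set (replicate m (y, False)) \<subseteq> carrier G"
        "fst ` set (replicate n (x, False) @ replicate m (y, False)) \<subseteq> carrier G"
        "fst ` set (replicate m (y, True) @ replicate n (x, False) @ replicate m (y, False)) \<subseteq> carrier G"
        using c by auto
      show ?thesis
        unfolding step[OF c(1) sets(3)] step[OF c(2) sets(2)] step[OF c(1) sets(1)]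
          word_value_replicate[OF \<open>group G\<close> c(2)] by simp
    qed
    also have "\<dots> = (x [^] n \<otimes> y [^] m) \<otimes> (inv (x [^] n) \<otimes> inv (y [^] m))"
      using c by (simp add: nat_pow_inv m_assoc)
    also have "inv (x [^] n) \<otimes> inv (y [^] m) = inv (y [^] m \<otimes> x [^] n)"
      using c by (simp add: inv_mult_group)
    finally have trivial: "word_value G ?w = \<one>"
      using c nm(3) by simp
    have reduced: "reduced_word ?w"
      using \<open>x \<noteq> y\<close> nm(1,2)
      by (auto simp: reduced_word_def successively_append_iff successively_replicate)
    have letters: "?w \<noteq> []" "set ?w \<subseteq> X \<times> UNIV"
      using xy nm by auto
    show False
      using red[OF letters reduced] trivial by (rule notE)
  qed
  show ?thesis
  proof (rule group_comm_groupI)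
    fix u w assume uw: "u \<in> carrier G" "w \<in> carrier G"
    show "u \<otimes> w = w \<otimes> u"
    proof (cases "X = {}")
      case True
      then show ?thesis
        using uw X(2)[symmetric] generate_empty by simp
    next
      case False
      then obtain x where x: "X = {x}"
        using eq by blast
      then have "x \<in> carrier G"
        using X by simp
      then have "carrier G = {x [^] k | k :: int. k \<in> UNIV}"
        using X(2) generate_pow[of x] x by simp
      then obtain i j :: int where "u = x [^] i" "w = x [^] j"
        using uw by blast
      then show ?thesis
        using \<open>x \<in> carrier G\<close> by (simp add: int_pow_mult[symmetric] add.commute)
    qed
  qed
qed

lemma no_free_subgroup_if_powers_commute:
  fixes G (structure)
  assumes "group G"
    and comm: "\<And>x y. x \<in> carrier G \<Longrightarrow> y \<in> carrier G \<Longrightarrow>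
      \<exists>n>0. \<exists>m>0. x [^] (n::nat) \<otimes> y [^] (m::nat) = y [^] m \<otimes> x [^] n"
  shows "\<not> has_nonabelian_free_subgroup G"
proof
  assume "has_nonabelian_free_subgroup G"
  then obtain K X where K: "subgroup K G" "\<not> comm_group (G\<lparr>carrier := K\<rparr>)"
    and X: "group (G\<lparr>carrier := K\<rparr>)" "free_basis (G\<lparr>carrier := K\<rparr>) X"
    unfolding has_nonabelian_free_subgroup_def free_group_def by blast
  have "comm_group (G\<lparr>carrier := K\<rparr>)"
  proof (rule comm_group_if_powers_commute[OF X])
    fix x y assume "x \<in> carrier (G\<lparr>carrier := K\<rparr>)" "y \<in> carrier (G\<lparr>carrier := K\<rparr>)"
    then have "x \<in> carrier G" "y \<in> carrier G"
      using subgroup.subset[OF K(1)] by auto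
    from comm[OF this] show "\<exists>n>0. \<exists>m>0.
        x [^]\<^bsub>G\<lparr>carrier := K\<rparr>\<^esub> (n::nat) \<otimes>\<^bsub>G\<lparr>carrier := K\<rparr>\<^esub> y [^]\<^bsub>G\<lparr>carrier := K\<rparr>\<^esub> (m::nat) =
        y [^]\<^bsub>G\<lparr>carrier := K\<rparr>\<^esub> m \<otimes>\<^bsub>G\<lparr>carrier := K\<rparr>\<^esub> x [^]\<^bsub>G\<lparr>carrier := K\<rparr>\<^esub> n"
      by (simp add: nat_pow_def)
  qed
  then show False
    using K(2) by blast
qed

section \<open>The group\<close>

definition cover :: "(flow \<times> tgrp) monoid" where
  "cover = magnus\<lparr>carrier := generate magnus magnus_gens\<rparr>"

lemma subgroup_cover: "subgroup (generate magnus magnus_gens) magnus"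
  by (rule group.generate_is_subgroup[OF group_magnus]) simp

lemma group_cover: "group cover"
  unfolding cover_def by (rule subgroup.subgroup_is_group[OF subgroup_cover group_magnus])

lemma cover_mult: "y \<otimes>\<^bsub>cover\<^esub> z = y \<otimes>\<^bsub>magnus\<^esub> z" and cover_one: "\<one>\<^bsub>cover\<^esub> = \<one>\<^bsub>magnus\<^esub>"
  by (simp_all add: cover_def)

lemma cover_pow: "y [^]\<^bsub>cover\<^esub> (n::nat) = y [^]\<^bsub>magnus\<^esub> n"
  by (simp add: cover_def nat_pow_def)

lemma generate_cover: "generate cover magnus_gens = carrier cover"
proof -
  have "magnus_gens \<subseteq> generate magnus magnus_gens"
    by (auto intro: generate.incl)
  then show ?thesis
    using group.generate_consistent[OF group_magnus _ subgroup_cover] by (simp add: cover_def)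
qed

lemma snd_cover: "snd ` carrier cover = UNIV"
proof -
  have "\<exists>v. (v, q) \<in> generate magnus magnus_gens" for q
  proof (induction q rule: tgrp_induct)
    case zero
    then show ?case
      using generate.one[of magnus magnus_gens] by auto
  next
    case (gen q c)
    then obtain v where "(v, q) \<in> generate magnus magnus_gens"
      by blast
    moreover have "edge c \<in> generate magnus magnus_gens"
      by (auto simp: magnus_gens_def intro: generate.incl)
    ultimately have "(v, q) \<otimes>\<^bsub>magnus\<^esub> edge c \<in> generate magnus magnus_gens"
      by (rule generate.eng)
    then show ?case
      by (auto simp: edge_def)
  qed
  then show ?thesis
    by (force simp: cover_def)
qed

text \<open>A trivial power makes the orbit sums of the flow vanish, so
  \<open>path_flow_torsion\<close> puts the element into the kernel of the map to the torsion group.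
  There the power multiplies an integer flow by \<open>n\<close>.\<close>

lemma torsion_free_cover: "torsion_free cover"
  unfolding torsion_free_def
proof (intro ballI allI impI)
  fix y :: "flow \<times> tgrp" and n :: nat
  assume y: "y \<in> carrier cover" and n: "0 < n" and pow: "y [^]\<^bsub>cover\<^esub> n = \<one>\<^bsub>cover\<^esub>"
  obtain v q where vq: "y = (v, q)"
    by (cases y)
  have "path_flow (v, q)"
    using path_flow_generate y vq by (simp add: cover_def)
  have sum0: "(\<Sum>i<n. v (- mulq i q + x) c) = 0" and nq: "mulq n q = 0" for x c
    using pow unfolding vq cover_pow cover_one pow_magnus magnus_simps by (auto simp: fun_eq_iff)
  have "q = 0"
    by (rule path_flow_torsion[OF \<open>path_flow (v, q)\<close> n nq sum0])
  moreover have "mulq i 0 = 0" for i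
    by (induction i) auto
  ultimately have "v x c = 0" for x c
    using sum0[of x c] n by simp
  then show "y = \<one>\<^bsub>cover\<^esub>"
    using \<open>q = 0\<close> by (simp add: vq cover_one fun_eq_iff)
qed

text \<open>The type of all flows is uncountable; words in the generators enumerate the subgroup, so
  that it can be moved to the natural numbers.\<close>

lemma countable_cover: "countable (carrier cover)"
proof -
  have "finite magnus_gens"
    by (simp add: magnus_gens_def)
  then have "countable (lists (magnus_gens \<times> (UNIV :: bool set)))"
    by (intro countable_lists countable_finite) simp
  moreover have "carrier cover \<subseteq> word_value magnus ` lists (magnus_gens \<times> UNIV)"
  proof
    fix y assume "y \<in> carrier cover"
    then have "y \<in> generate magnus magnus_gens"
      by (simp add: cover_def)
    then show "y \<in> word_value magnus ` lists (magnus_gens \<times> UNIV)"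
    proof (induction rule: generate.induct)
      case one
      then show ?case
        by (intro image_eqI[of _ _ "[]"]) (auto simp: word_value_def)
    next
      case (incl h)
      then show ?case
        using group.is_monoid[OF group_magnus]
        by (intro image_eqI[of _ _ "[(h, True)]"]) (auto simp: word_value_def letter_value_def monoid.r_one simp del: magnus_simps(3))
    next
      case (inv h)
      then show ?case
        using group.is_monoid[OF group_magnus]
        by (intro image_eqI[of _ _ "[(h, False)]"]) (auto simp: word_value_def letter_value_def monoid.r_one simp del: magnus_simps(3))
    next
      case (eng h1 h2)
      then obtain u w where "u \<in> lists (magnus_gens \<times> UNIV)" "h1 = word_value magnus u"
        "w \<in> lists (magnus_gens \<times> UNIV)" "h2 = word_value magnus w"
        by blast
      then show ?case
        using word_value_append(2)[OF group_magnus, of u w]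
        by (intro image_eqI[of _ _ "u @ w"]) auto
    qed
  qed
  ultimately show ?thesis
    by (meson countable_image countable_subset)
qed

theorem theorem1p3:
  shows "\<exists>G :: nat monoid. group G \<and> finitely_generated G \<and> torsion_free G \<and>
    \<not> unitarizable TYPE(nat \<Rightarrow> complex) G \<and> \<not> has_nonabelian_free_subgroup G"
proof -
  obtain e :: "flow \<times> tgrp \<Rightarrow> nat" where e: "inj_on e (carrier cover)"
    using countable_cover unfolding countable_def by blast
  define d where "d = inv_into (carrier cover) e"
  define G :: "nat monoid" where "G = \<lparr>carrier = e ` carrier cover,
    monoid.mult = (\<lambda>i j. e (d i \<otimes>\<^bsub>cover\<^esub> d j)), one = e \<one>\<^bsub>cover\<^esub>\<rparr>"
  have de: "d (e y) = y" if "y \<in> carrier cover" for y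
    using e that by (simp add: d_def)
  have carr: "carrier G = e ` carrier cover"
    by (simp add: G_def)
  have d_in: "d i \<in> carrier cover" if "i \<in> carrier G" for i
    using that de by (auto simp: G_def)
  have ed: "e (d i) = i" if "i \<in> carrier G" for i
    using that de by (auto simp: G_def)
  interpret C: group cover
    by (rule group_cover)
  have iso: "e \<in> iso cover G"
    using e de by (auto simp: iso_def hom_def G_def bij_betw_def)
  have "group (G\<lparr>one := e \<one>\<^bsub>cover\<^esub>\<rparr>)"
    by (rule C.iso_imp_img_group[OF iso])
  then have grp: "group G"
    by (simp add: G_def)
  have d_mult: "d (i \<otimes>\<^bsub>G\<^esub> j) = d i \<otimes>\<^bsub>cover\<^esub> d j" if "i \<in> carrier G" "j \<in> carrier G" for i j
  proof -
    have "i \<otimes>\<^bsub>G\<^esub> j = e (d i \<otimes>\<^bsub>cover\<^esub> d j)"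
      by (simp add: G_def)
    moreover have "d (e (d i \<otimes>\<^bsub>cover\<^esub> d j)) = d i \<otimes>\<^bsub>cover\<^esub> d j"
      by (intro de C.m_closed d_in that)
    ultimately show ?thesis
      by simp
  qed
  interpret G: group G
    by (rule grp)
  interpret e: group_hom cover G e
    by unfold_locales (use iso in \<open>auto simp: iso_def\<close>)
  have "finitely_generated G"
    unfolding finitely_generated_def
  proof (intro exI conjI)
    have gens: "magnus_gens \<subseteq> carrier cover"
      by (auto simp: cover_def intro: generate.incl)
    show "e ` magnus_gens \<subseteq> carrier G"
      unfolding carr using gens by (rule image_mono)
    show "finite (e ` magnus_gens)"
      by (simp add: magnus_gens_def)
    show "generate G (e ` magnus_gens) = carrier G"
      unfolding e.generate_img[OF gens] generate_cover carr ..
  qed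
  moreover have "torsion_free G"
    unfolding torsion_free_def
  proof (intro ballI allI impI)
    fix i and n :: nat
    assume i: "i \<in> carrier G" and n: "0 < n" "i [^]\<^bsub>G\<^esub> n = \<one>\<^bsub>G\<^esub>"
    have "e (d i [^]\<^bsub>cover\<^esub> n) = e \<one>\<^bsub>cover\<^esub>"
      using n(2) e.hom_nat_pow[OF d_in[OF i], of n] ed[OF i] by simp
    from inj_onD[OF e this C.nat_pow_closed[OF d_in[OF i]] C.one_closed]
    have "d i [^]\<^bsub>cover\<^esub> n = \<one>\<^bsub>cover\<^esub>" .
    then have "d i = \<one>\<^bsub>cover\<^esub>"
      using torsion_free_cover d_in[OF i] n(1) unfolding torsion_free_def by blast
    then show "i = \<one>\<^bsub>G\<^esub>"
      using ed[OF i] by simp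
  qed
  moreover have "\<not> unitarizable TYPE(nat \<Rightarrow> complex) G"
  proof (rule not_unitarizable_if_onto_tgrp[OF grp])
    show "snd (d (i \<otimes>\<^bsub>G\<^esub> j)) = snd (d i) + snd (d j)" if "i \<in> carrier G" "j \<in> carrier G" for i j
      unfolding d_mult[OF that] cover_mult by (cases "d i"; cases "d j") simp
    have "d ` carrier G = carrier cover"
      unfolding carr image_image using de by simp
    then have "snd ` d ` carrier G = UNIV"
      using snd_cover by simp
    then show "(\<lambda>i. snd (d i)) ` carrier G = UNIV"
      by (simp only: image_image)
  qed
  moreover have "\<not> has_nonabelian_free_subgroup G"
  proof (rule no_free_subgroup_if_powers_commute[OF grp])
    \<comment> \<open>As the quotient is torsion, a positive power of each element is a pure flow,
      and flows commute.\<close>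
    have kernel: "\<exists>n>0. \<exists>v. d i [^]\<^bsub>cover\<^esub> (n::nat) = (v, 0)" for i
    proof -
      obtain n where "n > 0" "mulq n (snd (d i)) = 0"
        using tgrp_periodic by blast
      then show ?thesis
        using pow_magnus[of "fst (d i)" "snd (d i)" n] by (auto simp: cover_pow)
    qed
    fix i j assume ij: "i \<in> carrier G" "j \<in> carrier G"
    obtain n :: nat and v where n: "n > 0" "d i [^]\<^bsub>cover\<^esub> n = (v, 0)"
      using kernel[of i] by blast
    obtain m :: nat and w where m: "m > 0" "d j [^]\<^bsub>cover\<^esub> m = (w, 0)"
      using kernel[of j] by blast
    have powers: "i [^]\<^bsub>G\<^esub> n = e (v, 0)" "j [^]\<^bsub>G\<^esub> m = e (w, 0)"
      using e.hom_nat_pow[OF d_in[OF ij(1)], of n] e.hom_nat_pow[OF d_in[OF ij(2)], of m] n m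
      by (simp_all add: ed ij)
    have "(v, 0) \<in> carrier cover" "(w, 0) \<in> carrier cover"
      using C.nat_pow_closed[OF d_in[OF ij(1)], of n] C.nat_pow_closed[OF d_in[OF ij(2)], of m] n m
      by simp_all
    then have "i [^]\<^bsub>G\<^esub> n \<otimes>\<^bsub>G\<^esub> j [^]\<^bsub>G\<^esub> m = j [^]\<^bsub>G\<^esub> m \<otimes>\<^bsub>G\<^esub> i [^]\<^bsub>G\<^esub> n"
      unfolding powers by (simp add: e.hom_mult[symmetric] cover_mult add.commute)
    then show "\<exists>n>0. \<exists>m>0. i [^]\<^bsub>G\<^esub> (n::nat) \<otimes>\<^bsub>G\<^esub> j [^]\<^bsub>G\<^esub> (m::nat) = j [^]\<^bsub>G\<^esub> m \<otimes>\<^bsub>G\<^esub> i [^]\<^bsub>G\<^esub> n"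
      using n m by blast
  qed
  ultimately show ?thesis
    using grp by blast
qed

end
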